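(* Let $\Delta$ be a higher-order unification context and let $\Delta'$ be obtained from $\Delta$ by applying one of the saturation rules. Then the set of unifiers of $\Delta$ equals $\{\Gamma'|_{UV(\Delta)} : \Gamma' \text{ a unifier of } \Delta'\}$. Moreover, domain restriction preserves most general unifiers: if $\Gamma'$ is a most general unifier of $\Delta'$, then $\Gamma'|_{UV(\Delta)}$ is a most general unifier of $\Delta$.
   Context: Simply typed constructors $c,d,e$, bound variables $x,y,z$, unification metavariables tagged contractive ($H^{\mathrm{con}}$) or recursive ($H^{\mathrm{rec}}$; $m$ ranges over the two tags), recursion constants $\underline r,\underline s,\underline t$. $\bar x$ is a list of pairwise distinct variables (a pattern), set operations on such lists act on their underlying sets; $[\bar y/\bar x]$ simultaneous renaming; $FV$ free variables; $h$ ranges over constructors and variables. Terms are $\beta$-normal $\eta$-long except that arguments of metavariables and recursion constants are bare variables; $\lambda$-bound variables up to $\alpha$. Contractive terms $U ::= \lambda\bar x.\,y\,\overline N\mid\lambda\bar x.\,c\,\overline N\mid\lambda\bar x.\,H^{\mathrm{con}}\bar y$; recursive terms $N ::= \lambda\bar x.\,\underline r\,\bar y\mid\lambda\bar x.\,H^{\mathrm{rec}}\bar y$; $M$ either. A unification context $\Delta$: finite collection of well-typed equations $U_1\doteq U_2$, $N_1\doteq N_2$ (possibly with free variables), closed definitions $\underline r=_dU$ (at most one per constant, every used constant defined), possibly $\mathrm{contra}$; $\mathrm{eqs},\mathrm{defs},UV$ as usual. Expansion: $\mathrm{exp}^\Delta_0=\bot$; $\mathrm{exp}^\Delta_{k+1}(\lambda\bar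 x.\,H^m\bar y)=\lambda\bar x.\,H^m\bar y$; $\mathrm{exp}^\Delta_{k+1}(\lambda\bar x.\,h\,N_1\cdots N_n)=\lambda\bar x.\,h\,(\mathrm{exp}^\Delta_k(N_1))\cdots(\mathrm{exp}^\Delta_k(N_n))$; $\mathrm{exp}^\Delta_{k+1}(\lambda\bar x.\,\underline r\,\bar y)=\mathrm{exp}^\Delta_{k+1}(\lambda\bar x.\,[\bar y/\bar z]U)$ for $\underline r=_d\lambda\bar z.\,U\in\Delta$. $M\doteq M'$ holds if expansions agree at all depths. Substitutions: contradiction-free contexts with equations $H^{\mathrm{con}}\bar x\doteq U$ or $H^{\mathrm{rec}}\bar x\doteq N$, $FV$(right side)$\subseteq\bar x$, no top-level $\lambda$ on the right, each metavariable on a left side at most once; $\mathrm{dom}$; restriction $\Gamma|_S$ keeps equations whose left metavariable is in $S$. $M[\Gamma]$ replaces $H^m\bar y$ by $[\bar y/\bar z]M'$ when $H^m\bar z\doteq M'\in\Gamma$. $\Delta[\Gamma]$, $\Gamma_1[\Gamma_2]$: apply to all equation sides (right sides for substitutions) and definition bodies, adding $\mathrm{defs}$ of the applied substitution (constants renamed apart). $\Gamma_1\circ\Gamma_2=\Gamma_1[\Gamma_2]\cup\{H^m\bar x\doteq M\in\Gamma_2\mid H^m\notin\mathrm{dom}(\Gamma_1)\}$. $\Gamma=\Gamma'$ iff same domain and for each $H^m$ (with $\eta$-long form $\lambda\bar x.\,H^m\bar x$) $\mathrm{exp}^\Gamma_k((\lambda\bar x.H^m\bar x)[\Gamma])=\mathrm{exp}^{\Gamma'}_k((\lambda\bar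 x.H^m\bar x)[\Gamma'])$ for all $k$. A unifier of contradiction-free $\Delta$: substitution $\Gamma$ with $\mathrm{dom}(\Gamma)=UV(\Delta)$ and all equations of $\Delta[\Gamma]$ holding; contexts with $\mathrm{contra}$ have none. $\Gamma_1$ more general than $\Gamma_2$ if $\Gamma_1\circ\Gamma'=\Gamma_2$ for some $\Gamma'$; a most general unifier is more general than every unifier. Resolved: $H^{\mathrm{con}}$ is resolved in $\Delta$ if $\Delta$ contains (in either orientation) $H^{\mathrm{con}}\bar y\doteq h\,\overline N$ with $FV(h\,\overline N)\subseteq\bar y$, or $H^{\mathrm{con}}\bar y\doteq G^{\mathrm{con}}\bar w$ with $\bar w\subsetneq\bar y$; $H^{\mathrm{rec}}$ is resolved if $\Delta$ contains $H^{\mathrm{rec}}\bar y\doteq\underline r\,\bar z$ with $\bar z\subseteq\bar y$, or $H^{\mathrm{rec}}\bar y\doteq G^{\mathrm{rec}}\bar w$ with $\bar w\subsetneq\bar y$; otherwise unresolved. Rules (premises in $\Delta$ $\Rightarrow$ add conclusion). A prefix $(\exists X)$ means the listed variables/metavariables/constants are globally fresh and the rule fires only if no instance of the conclusion (for some choice of $X$) is already in $\Delta$. U-INST: $\lambda\bar x.\,U\doteq\lambda\bar x.\,U'\Rightarrow(\exists\bar x)\,U\doteq U'$; N-INST likewise for $N$. SIMP-F1: $x\,\overline N\doteq c\,\overline{N'}\Rightarrow\mathrm{contra}$. SIMP-F2: $x\,\overline N\doteq y\,\overline{N'}$, $x\ne y\Rightarrow\mathrm{contra}$. SIMP-F3: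 $c\,\overline N\doteq d\,\overline{N'}$, $c\neq d\Rightarrow\mathrm{contra}$. SIMP: $h\,N_1\cdots N_n\doteq h\,N'_1\cdots N'_n\Rightarrow N_i\doteq N'_i$ for all $i$. PROJ-F: $H^{\mathrm{con}}\bar y\doteq z\,\overline N$, $z\notin\bar y\Rightarrow\mathrm{contra}$. IMIT: $H^{\mathrm{con}}\bar y\doteq c\,\overline N$, $H^{\mathrm{con}}$ unresolved $\Rightarrow(\exists G^{\mathrm{rec}}_1\dots G^{\mathrm{rec}}_n)\,H^{\mathrm{con}}\bar y\doteq c\,(\lambda\bar w_1.\,G^{\mathrm{rec}}_1\bar y\,\bar w_1)\cdots(\lambda\bar w_n.\,G^{\mathrm{rec}}_n\bar y\,\bar w_n)$ ($\eta$-expanded per the type of $c$). PROJ: $H^{\mathrm{con}}\bar y\doteq y_i\,\overline N$, $y_i\in\bar y$, $H^{\mathrm{con}}$ unresolved $\Rightarrow$ the same with head $y_i$. PRUNE: $H^{\mathrm{rec}}\bar y\doteq\underline r\,\bar x$, $\bar x\not\subseteq\bar y$, $\bar w=\bar x\cap\bar y$, $H^{\mathrm{rec}}$ unresolved $\Rightarrow(\exists\underline t)(\exists G^{\mathrm{con}})\,H^{\mathrm{rec}}\bar y\doteq\underline t\,\bar w,\ \underline r\,\bar x\doteq\underline t\,\bar w,\ \underline t=_d\lambda\bar w.\,G^{\mathrm{con}}\bar w$. FF-D: $G^m\bar x\doteq H^m\bar y$, $G^m\neq H^m$, $\bar z=\bar x\cap\bar y$, $\bar x\not\subseteq\bar y$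 and $\bar y\not\subseteq\bar x$, $H^m$ or $G^m$ unresolved $\Rightarrow(\exists F^m)\,G^m\bar x\doteq F^m\bar z,\ H^m\bar y\doteq F^m\bar z$. FF-S: $G^m\bar x\doteq G^m\bar y$ with $\bar x=x_1..x_n$, $\bar y=y_1..y_n$, $\bar x\neq\bar y$, $\bar z=\{x_i\mid x_i=y_i\}$, $G^m$ unresolved $\Rightarrow(\exists F^m)\,G^m\bar x\doteq F^m\bar z,\ G^m\bar y\doteq F^m\bar z$. REC-EXP: $\underline r\,\bar x\doteq\underline s\,\bar y$, $\underline r=_d\lambda\bar z.\,U_1$, $\underline s=_d\lambda\bar w.\,U_2\Rightarrow[\bar x/\bar z]U_1\doteq[\bar y/\bar w]U_2$. U-AGREE: $H^{\mathrm{con}}\bar x\doteq U_1$, $H^{\mathrm{con}}\bar y\doteq U_2$, $FV(U_1)\subseteq\bar x$, $FV(U_2)\subseteq\bar y\Rightarrow U_1\doteq[\bar x/\bar y]U_2$; N-AGREE likewise for $H^{\mathrm{rec}}$ and recursive terms. U-SYM, N-SYM, U-TRANS, N-TRANS: symmetry and transitivity of $\doteq$ on contractive terms and on recursive terms.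
   Formalization: "Γ1 more general than Γ2" is read as (Γ1∘Γ')|dom(Γ2) = Γ2 for some Γ', not Γ1∘Γ' = Γ2; read literally the mgu claim fails, e.g. for IMIT on H y ≐ c (F y z), since fresh metavariables left in the restricted mgu could not be instantiated. *)

theory Defs
  imports Main
begin

section \<open>Types, names and terms\<close>

datatype 'b ty = Base 'b | Arr "'b ty" "'b ty"

fun arg_tys :: "'b ty \<Rightarrow> 'b ty list" where
  "arg_tys (Base b) = []"
| "arg_tys (Arr A B) = A # arg_tys B"

fun target :: "'b ty \<Rightarrow> 'b" where
  "target (Base b) = b"
| "target (Arr A B) = target B"

definition arrows :: "'b ty list \<Rightarrow> 'b \<Rightarrow> 'b ty" where
  "arrows As b = foldr Arr As (Base b)"

datatype tag = Con | Rec

text \<open>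
  Names carry their types, so every type has infinitely many variables, metavariables and
  recursion constants. Constructors are an arbitrary type \<open>'c\<close>, typed by a signature
  \<open>sig :: 'c \<Rightarrow> 'b ty\<close>.
\<close>

datatype 'b mvar = MV (mtag: tag) (mname: nat) (mty: "'b ty")

datatype 'b rconst = RC (rname: nat) (rty: "'b ty")

datatype 'b var = Bnd nat | Free nat "'b ty"

datatype ('b, 'c) head = HCon 'c | HVar "'b var"

text \<open>
  Terms are locally nameless, so that terms up to \<open>\<alpha>\<close> are just elements of the datatype.
  The list \<open>Bs\<close> holds the types of the variables of the leading block \<open>\<lambda>x\<^sub>0 \<dots> x\<^sub>n\<^sub>-\<^sub>1\<close>
  (possibly empty). Directly below that block \<open>Bnd i\<close> with \<open>i < n\<close> is \<open>x\<^sub>i\<close>, and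
  \<open>Bnd (n + j)\<close> is what \<open>Bnd j\<close> is outside of it.
  Contractive and recursive terms share one datatype; \<open>has_ty\<close> below imposes the grammar.
\<close>

datatype ('b, 'c) tm =
    Rigid (binders: "'b ty list") "('b, 'c) head" "('b, 'c) tm list"
  | Meta (binders: "'b ty list") "'b mvar" "'b var list"
  | Recur (binders: "'b ty list") "'b rconst" "'b var list"

fun sort_of :: "('b, 'c) tm \<Rightarrow> tag" where
  "sort_of (Rigid Bs h Ns) = Con"
| "sort_of (Meta Bs H ys) = mtag H"
| "sort_of (Recur Bs r ys) = Rec"

fun with_binders :: "'b ty list \<Rightarrow> ('b, 'c) tm \<Rightarrow> ('b, 'c) tm" where
  "with_binders Bs (Rigid _ h Ns) = Rigid Bs h Ns"
| "with_binders Bs (Meta _ H ys) = Meta Bs H ys"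
| "with_binders Bs (Recur _ r ys) = Recur Bs r ys"

text \<open>The \<open>\<eta>\<close>-long form \<open>\<lambda>xs. H xs\<close> of a metavariable.\<close>

definition eta :: "'b mvar \<Rightarrow> ('b, 'c) tm" where
  "eta H = Meta (arg_tys (mty H)) H (map Bnd [0..<length (arg_tys (mty H))])"

section \<open>Typing\<close>

text \<open>\<open>Bs\<close> lists the types of the bound variables in scope: \<open>Bnd i\<close> has type \<open>Bs ! i\<close>.\<close>

fun in_scope :: "'b ty list \<Rightarrow> 'b var \<Rightarrow> bool" where
  "in_scope Bs (Bnd i) \<longleftrightarrow> i < length Bs"
| "in_scope Bs (Free n A) \<longleftrightarrow> True"

fun vtype :: "'b ty list \<Rightarrow> 'b var \<Rightarrow> 'b ty" where
  "vtype Bs (Bnd i) = Bs ! i"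
| "vtype Bs (Free n A) = A"

definition pattern :: "'b ty list \<Rightarrow> 'b var list \<Rightarrow> 'b ty list \<Rightarrow> bool" where
  "pattern Bs ys As \<longleftrightarrow> distinct ys \<and> (\<forall>y \<in> set ys. in_scope Bs y) \<and> map (vtype Bs) ys = As"

fun head_in_scope :: "'b ty list \<Rightarrow> ('b, 'c) head \<Rightarrow> bool" where
  "head_in_scope Bs (HCon c) \<longleftrightarrow> True"
| "head_in_scope Bs (HVar v) \<longleftrightarrow> in_scope Bs v"

fun head_ty :: "('c \<Rightarrow> 'b ty) \<Rightarrow> 'b ty list \<Rightarrow> ('b, 'c) head \<Rightarrow> 'b ty" where
  "head_ty sig Bs (HCon c) = sig c"
| "head_ty sig Bs (HVar v) = vtype Bs v"

text \<open>
  \<open>has_ty sig Bs m M A\<close>: \<open>M\<close> is a contractive (\<open>m = Con\<close>) or recursive (\<open>m = Rec\<close>) term of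
  type \<open>A\<close>. All bodies have base type, i.e. terms are \<open>\<eta>\<close>-long, and arguments of
  metavariables and recursion constants are patterns.
\<close>

inductive has_ty ::
  "('c \<Rightarrow> 'b ty) \<Rightarrow> 'b ty list \<Rightarrow> tag \<Rightarrow> ('b, 'c) tm \<Rightarrow> 'b ty \<Rightarrow> bool" for sig where
  Rigid: "head_in_scope (Bs @ Cs) h
    \<Longrightarrow> list_all2 (has_ty sig (Bs @ Cs) Rec) Ns (arg_tys (head_ty sig (Bs @ Cs) h))
    \<Longrightarrow> has_ty sig Cs Con (Rigid Bs h Ns) (arrows Bs (target (head_ty sig (Bs @ Cs) h)))"
| Meta: "pattern (Bs @ Cs) ys (arg_tys (mty H))
    \<Longrightarrow> has_ty sig Cs (mtag H) (Meta Bs H ys) (arrows Bs (target (mty H)))"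
| Recur: "pattern (Bs @ Cs) ys (arg_tys (rty r))
    \<Longrightarrow> has_ty sig Cs Rec (Recur Bs r ys) (arrows Bs (target (rty r)))"

section \<open>Occurrences and renaming\<close>

fun fvv :: "'b var \<Rightarrow> 'b var set" where
  "fvv (Bnd i) = {}"
| "fvv (Free n A) = {Free n A}"

fun FV :: "('b, 'c) tm \<Rightarrow> 'b var set" where
  "FV (Rigid Bs h Ns) = (case h of HCon c \<Rightarrow> {} | HVar v \<Rightarrow> fvv v) \<union> (\<Union>N \<in> set Ns. FV N)"
| "FV (Meta Bs H ys) = (\<Union>y \<in> set ys. fvv y)"
| "FV (Recur Bs r ys) = (\<Union>y \<in> set ys. fvv y)"

fun mvars :: "('b, 'c) tm \<Rightarrow> 'b mvar set" where
  "mvars (Rigid Bs h Ns) = (\<Union>N \<in> set Ns. mvars N)"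
| "mvars (Meta Bs H ys) = {H}"
| "mvars (Recur Bs r ys) = {}"

fun rconsts :: "('b, 'c) tm \<Rightarrow> 'b rconst set" where
  "rconsts (Rigid Bs h Ns) = (\<Union>N \<in> set Ns. rconsts N)"
| "rconsts (Meta Bs H ys) = {}"
| "rconsts (Recur Bs r ys) = {r}"

fun lift_var :: "nat \<Rightarrow> 'b var \<Rightarrow> 'b var" where
  "lift_var n (Bnd i) = Bnd (n + i)"
| "lift_var n (Free k A) = Free k A"

text \<open>The action of a renaming \<open>\<rho>\<close> below \<open>n\<close> additional binders.\<close>

fun under :: "nat \<Rightarrow> ('b var \<Rightarrow> 'b var) \<Rightarrow> 'b var \<Rightarrow> 'b var" where
  "under n \<rho> (Bnd i) = (if i < n then Bnd i else lift_var n (\<rho> (Bnd (i - n))))"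
| "under n \<rho> (Free k A) = lift_var n (\<rho> (Free k A))"

fun ren_head :: "('b var \<Rightarrow> 'b var) \<Rightarrow> ('b, 'c) head \<Rightarrow> ('b, 'c) head" where
  "ren_head \<rho> (HCon c) = HCon c"
| "ren_head \<rho> (HVar v) = HVar (\<rho> v)"

fun ren :: "('b var \<Rightarrow> 'b var) \<Rightarrow> ('b, 'c) tm \<Rightarrow> ('b, 'c) tm" where
  "ren \<rho> (Rigid Bs h Ns) =
     Rigid Bs (ren_head (under (length Bs) \<rho>) h) (map (ren (under (length Bs) \<rho>)) Ns)"
| "ren \<rho> (Meta Bs H ys) = Meta Bs H (map (under (length Bs) \<rho>) ys)"
| "ren \<rho> (Recur Bs r ys) = Recur Bs r (map (under (length Bs) \<rho>) ys)"

text \<open>\<open>rename ys xs M\<close> is \<open>[ys/xs]M\<close>.\<close>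

definition rename :: "'b var list \<Rightarrow> 'b var list \<Rightarrow> ('b, 'c) tm \<Rightarrow> ('b, 'c) tm" where
  "rename ys xs =
     ren (\<lambda>v. case map_of (zip xs ys) v of Some w \<Rightarrow> w | None \<Rightarrow> v)"

text \<open>If \<open>M\<close> is \<open>\<lambda>zs. M'\<close>, with \<open>zs\<close> all leading binders, then \<open>open_tm ys M\<close> is \<open>[ys/zs]M'\<close>.\<close>

definition open_tm :: "'b var list \<Rightarrow> ('b, 'c) tm \<Rightarrow> ('b, 'c) tm" where
  "open_tm ys M =
     ren (\<lambda>v. case v of
            Bnd i \<Rightarrow> (if i < length ys then ys ! i else Bnd (i - length ys))
          | Free n A \<Rightarrow> Free n A)
       (with_binders [] M)"

fun ren_rc :: "('b rconst \<Rightarrow> 'b rconst) \<Rightarrow> ('b, 'c) tm \<Rightarrow> ('b, 'c) tm" where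
  "ren_rc f (Rigid Bs h Ns) = Rigid Bs h (map (ren_rc f) Ns)"
| "ren_rc f (Meta Bs H ys) = Meta Bs H ys"
| "ren_rc f (Recur Bs r ys) = Recur Bs (f r) ys"

section \<open>Unification contexts\<close>

type_synonym ('b, 'c) eqn = "('b, 'c) tm \<times> ('b, 'c) tm"
type_synonym ('b, 'c) dfn = "'b rconst \<times> ('b, 'c) tm"

record ('b, 'c) uctx =
  eqs :: "('b, 'c) eqn set"
  defs :: "('b, 'c) dfn set"
  contra :: bool

definition UV :: "('b, 'c) uctx \<Rightarrow> 'b mvar set" where
  "UV \<Delta> = (\<Union>(M, M') \<in> eqs \<Delta>. mvars M \<union> mvars M') \<union> (\<Union>(r, U) \<in> defs \<Delta>. mvars U)"

definition ctx_rconsts :: "('b, 'c) uctx \<Rightarrow> 'b rconst set" where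
  "ctx_rconsts \<Delta> =
     (\<Union>(M, M') \<in> eqs \<Delta>. rconsts M \<union> rconsts M')
     \<union> (\<Union>(r, U) \<in> defs \<Delta>. insert r (rconsts U))"

definition ctx_FV :: "('b, 'c) uctx \<Rightarrow> 'b var set" where
  "ctx_FV \<Delta> = (\<Union>(M, M') \<in> eqs \<Delta>. FV M \<union> FV M') \<union> (\<Union>(r, U) \<in> defs \<Delta>. FV U)"

definition wf_ctx :: "('c \<Rightarrow> 'b ty) \<Rightarrow> ('b, 'c) uctx \<Rightarrow> bool" where
  "wf_ctx sig \<Delta> \<longleftrightarrow>
     finite (eqs \<Delta>) \<and> finite (defs \<Delta>) \<and>
     (\<forall>(M, M') \<in> eqs \<Delta>. \<exists>m A. has_ty sig [] m M A \<and> has_ty sig [] m M' A) \<and>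
     (\<forall>(r, U) \<in> defs \<Delta>. has_ty sig [] Con U (rty r) \<and> FV U = {}) \<and>
     single_valued (defs \<Delta>) \<and>
     ctx_rconsts \<Delta> \<subseteq> Domain (defs \<Delta>)"

section \<open>Expansion\<close>

datatype ('b, 'c) etm =
    Bot
  | ERigid "'b ty list" "('b, 'c) head" "('b, 'c) etm list"
  | EMeta "'b ty list" "'b mvar" "'b var list"

definition def_of :: "('b, 'c) dfn set \<Rightarrow> 'b rconst \<Rightarrow> ('b, 'c) tm option" where
  "def_of D r = (if \<exists>U. (r, U) \<in> D then Some (THE U. (r, U) \<in> D) else None)"

fun unfold :: "('b, 'c) dfn set \<Rightarrow> ('b, 'c) tm \<Rightarrow> ('b, 'c) tm" where
  "unfold D (Rigid Bs h Ns) = Rigid Bs h Ns"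
| "unfold D (Meta Bs H ys) = Meta Bs H ys"
| "unfold D (Recur Bs r ys) =
     (case def_of D r of
        Some U \<Rightarrow> with_binders Bs (open_tm ys U)
      | None \<Rightarrow> Recur Bs r ys)"

text \<open>
  Bodies of definitions are contractive, so a single unfolding exposes a rigid or flexible head;
  the \<open>Recur\<close> branch is never reached in a well-formed context. The usual recursion equations
  are the lemma \<open>expand_eqs\<close>.
\<close>

primrec expand :: "('b, 'c) dfn set \<Rightarrow> nat \<Rightarrow> ('b, 'c) tm \<Rightarrow> ('b, 'c) etm" where
  "expand D 0 M = Bot"
| "expand D (Suc k) M =
     (case unfold D M of
        Rigid Bs h Ns \<Rightarrow> ERigid Bs h (map (expand D k) Ns)
      | Meta Bs H ys \<Rightarrow> EMeta Bs H ys
      | Recur Bs r ys \<Rightarrow> Bot)"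

lemma sort_of_with_binders [simp]: "sort_of (with_binders Bs M) = sort_of M"
  by (cases M) auto

lemma sort_of_open_tm [simp]: "sort_of (open_tm ys M) = sort_of M"
  by (cases M) (auto simp: open_tm_def)

lemma unfold_contractive: "sort_of M = Con \<Longrightarrow> unfold D M = M"
  by (cases M) auto

lemma expand_eqs:
  "expand D 0 M = Bot"
  "expand D (Suc k) (Meta Bs H ys) = EMeta Bs H ys"
  "expand D (Suc k) (Rigid Bs h Ns) = ERigid Bs h (map (expand D k) Ns)"
  "single_valued D \<Longrightarrow> (r, U) \<in> D \<Longrightarrow> sort_of U = Con \<Longrightarrow>
     expand D (Suc k) (Recur Bs r ys) = expand D (Suc k) (with_binders Bs (open_tm ys U))"
proof -
  assume *: "single_valued D" "(r, U) \<in> D" "sort_of U = Con"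
  then have "def_of D r = Some U"
    by (auto simp: def_of_def single_valued_def intro!: the_equality)
  with * show
    "expand D (Suc k) (Recur Bs r ys) = expand D (Suc k) (with_binders Bs (open_tm ys U))"
    by (simp add: unfold_contractive)
qed simp_all

definition holds :: "('b, 'c) dfn set \<Rightarrow> ('b, 'c) eqn \<Rightarrow> bool" where
  "holds D e \<longleftrightarrow> (\<forall>k. expand D k (fst e) = expand D k (snd e))"

section \<open>Substitutions\<close>

definition is_subst :: "('c \<Rightarrow> 'b ty) \<Rightarrow> ('b, 'c) uctx \<Rightarrow> bool" where
  "is_subst sig \<Gamma> \<longleftrightarrow>
     wf_ctx sig \<Gamma> \<and> \<not> contra \<Gamma> \<and>
     (\<forall>(L, M) \<in> eqs \<Gamma>. \<exists>H xs. L = Meta [] H xs \<and> FV M \<subseteq> set xs \<and> binders M = []) \<and>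
     (\<forall>H xs M xs' M'. (Meta [] H xs, M) \<in> eqs \<Gamma> \<and> (Meta [] H xs', M') \<in> eqs \<Gamma>
        \<longrightarrow> xs = xs' \<and> M = M')"

definition sdom :: "('b, 'c) uctx \<Rightarrow> 'b mvar set" where
  "sdom \<Gamma> = {H. \<exists>xs M. (Meta [] H xs, M) \<in> eqs \<Gamma>}"

definition restrict :: "'b mvar set \<Rightarrow> ('b, 'c) uctx \<Rightarrow> ('b, 'c) uctx" where
  "restrict S \<Gamma> =
     \<Gamma>\<lparr>eqs := {(L, M) \<in> eqs \<Gamma>. \<exists>H xs. L = Meta [] H xs \<and> H \<in> S}\<rparr>"

definition image_of ::
  "('b, 'c) uctx \<Rightarrow> 'b mvar \<Rightarrow> ('b var list \<times> ('b, 'c) tm) option" where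
  "image_of \<Gamma> H =
     (if H \<in> sdom \<Gamma> then Some (THE (zs, M). (Meta [] H zs, M) \<in> eqs \<Gamma>) else None)"

fun subst :: "('b, 'c) uctx \<Rightarrow> ('b, 'c) tm \<Rightarrow> ('b, 'c) tm" where
  "subst \<Gamma> (Rigid Bs h Ns) = Rigid Bs h (map (subst \<Gamma>) Ns)"
| "subst \<Gamma> (Meta Bs H ys) =
     (case image_of \<Gamma> H of
        Some (zs, M) \<Rightarrow> with_binders Bs (rename ys zs M)
      | None \<Rightarrow> Meta Bs H ys)"
| "subst \<Gamma> (Recur Bs r ys) = Recur Bs r ys"

text \<open>
  Applying a substitution to a context renames the recursion constants of the two apart. This
  is done once and for all: those of the context get even names, those of the substitution odd
  names.
\<close>

definition ctx_rc :: "'b rconst \<Rightarrow> 'b rconst" where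
  "ctx_rc r = RC (2 * rname r) (rty r)"

definition sub_rc :: "'b rconst \<Rightarrow> 'b rconst" where
  "sub_rc r = RC (2 * rname r + 1) (rty r)"

definition ren_ctx :: "('b rconst \<Rightarrow> 'b rconst) \<Rightarrow> ('b, 'c) uctx \<Rightarrow> ('b, 'c) uctx" where
  "ren_ctx f \<Delta> =
     \<lparr>eqs = (\<lambda>(M, M'). (ren_rc f M, ren_rc f M')) ` eqs \<Delta>,
      defs = (\<lambda>(r, U). (f r, ren_rc f U)) ` defs \<Delta>,
      contra = contra \<Delta>\<rparr>"

definition app_defs :: "('b, 'c) uctx \<Rightarrow> ('b, 'c) uctx \<Rightarrow> ('b, 'c) dfn set" where
  "app_defs \<Delta> \<Gamma> =
     (\<lambda>(r, U). (r, subst (ren_ctx sub_rc \<Gamma>) U)) ` defs (ren_ctx ctx_rc \<Delta>) \<union> defs (ren_ctx sub_rc \<Gamma>)"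

text \<open>\<open>\<Delta>[\<Gamma>]\<close> for a context \<open>\<Delta>\<close>: both sides of the equations are instantiated.\<close>

definition app_ctx :: "('b, 'c) uctx \<Rightarrow> ('b, 'c) uctx \<Rightarrow> ('b, 'c) uctx" where
  "app_ctx \<Delta> \<Gamma> =
     \<lparr>eqs = (\<lambda>(M, M'). (subst (ren_ctx sub_rc \<Gamma>) M, subst (ren_ctx sub_rc \<Gamma>) M'))
              ` eqs (ren_ctx ctx_rc \<Delta>),
      defs = app_defs \<Delta> \<Gamma>,
      contra = contra \<Delta>\<rparr>"

text \<open>\<open>\<Gamma>\<^sub>1[\<Gamma>\<^sub>2]\<close> for a substitution \<open>\<Gamma>\<^sub>1\<close>: only right-hand sides are instantiated.\<close>

definition app_subst :: "('b, 'c) uctx \<Rightarrow> ('b, 'c) uctx \<Rightarrow> ('b, 'c) uctx" where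
  "app_subst \<Gamma>1 \<Gamma>2 =
     \<lparr>eqs = (\<lambda>(L, M). (L, subst (ren_ctx sub_rc \<Gamma>2) M)) ` eqs (ren_ctx ctx_rc \<Gamma>1),
      defs = app_defs \<Gamma>1 \<Gamma>2,
      contra = contra \<Gamma>1\<rparr>"

definition compose :: "('b, 'c) uctx \<Rightarrow> ('b, 'c) uctx \<Rightarrow> ('b, 'c) uctx" where
  "compose \<Gamma>1 \<Gamma>2 =
     (app_subst \<Gamma>1 \<Gamma>2)\<lparr>eqs := eqs (app_subst \<Gamma>1 \<Gamma>2) \<union>
        {(L, M) \<in> eqs (ren_ctx sub_rc \<Gamma>2). \<exists>H xs. L = Meta [] H xs \<and> H \<notin> sdom \<Gamma>1}\<rparr>"

definition subst_eq :: "('b, 'c) uctx \<Rightarrow> ('b, 'c) uctx \<Rightarrow> bool" (infix "\<approx>" 50) where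
  "\<Gamma> \<approx> \<Gamma>' \<longleftrightarrow>
     sdom \<Gamma> = sdom \<Gamma>' \<and>
     (\<forall>H k. expand (defs \<Gamma>) k (subst \<Gamma> (eta H)) = expand (defs \<Gamma>') k (subst \<Gamma>' (eta H)))"

section \<open>Unifiers\<close>

definition unifier :: "('c \<Rightarrow> 'b ty) \<Rightarrow> ('b, 'c) uctx \<Rightarrow> ('b, 'c) uctx \<Rightarrow> bool" where
  "unifier sig \<Delta> \<Gamma> \<longleftrightarrow>
     \<not> contra \<Delta> \<and> is_subst sig \<Gamma> \<and> sdom \<Gamma> = UV \<Delta> \<and>
     (\<forall>e \<in> eqs (app_ctx \<Delta> \<Gamma>). holds (defs (app_ctx \<Delta> \<Gamma>)) e)"

text \<open>
  The instance relation is read on the domain of the more special substitution, as usual for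
  unifiers: \<open>\<Gamma>1\<close> may mention metavariables outside \<open>sdom \<Gamma>2\<close>, and \<open>\<Gamma>'\<close> must be able to
  instantiate them, yet \<open>compose\<close> puts them into the domain of the composition whereas \<open>\<approx>\<close>
  requires equal domains. Without the restriction, restricted most general unifiers need not
  be most general: for distinct free variables \<open>y\<close>, \<open>z\<close> and the single equation
  \<open>H y \<doteq> c (F y z)\<close>, the imitation rule adds \<open>H y \<doteq> c (G y)\<close>; restricting the most general
  unifier \<open>H y \<doteq> c (G y)\<close>, \<open>F y z \<doteq> G y\<close>, \<open>G y \<doteq> G y\<close> to \<open>{H, F}\<close> leaves
  \<open>G\<close> outside the domain.
\<close>

definition more_general :: "('c \<Rightarrow> 'b ty) \<Rightarrow> ('b, 'c) uctx \<Rightarrow> ('b, 'c) uctx \<Rightarrow> bool" where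
  "more_general sig \<Gamma>1 \<Gamma>2 \<longleftrightarrow>
     (\<exists>\<Gamma>'. is_subst sig \<Gamma>' \<and> restrict (sdom \<Gamma>2) (compose \<Gamma>1 \<Gamma>') \<approx> \<Gamma>2)"

definition is_mgu :: "('c \<Rightarrow> 'b ty) \<Rightarrow> ('b, 'c) uctx \<Rightarrow> ('b, 'c) uctx \<Rightarrow> bool" where
  "is_mgu sig \<Delta> \<Gamma> \<longleftrightarrow>
     unifier sig \<Delta> \<Gamma> \<and> (\<forall>\<Gamma>2. unifier sig \<Delta> \<Gamma>2 \<longrightarrow> more_general sig \<Gamma> \<Gamma>2)"

section \<open>Saturation rules\<close>

text \<open>Either orientation counts for contractive metavariables only.\<close>

definition resolved :: "('b, 'c) uctx \<Rightarrow> 'b mvar \<Rightarrow> bool" where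
  "resolved \<Delta> H \<longleftrightarrow>
     (case mtag H of
        Con \<Rightarrow>
          (\<exists>ys M. ((Meta [] H ys, M) \<in> eqs \<Delta> \<or> (M, Meta [] H ys) \<in> eqs \<Delta>) \<and>
             ((\<exists>h Ns. M = Rigid [] h Ns \<and> FV M \<subseteq> set ys) \<or>
              (\<exists>G ws. M = Meta [] G ws \<and> set ws \<subset> set ys)))
      | Rec \<Rightarrow>
          (\<exists>ys M. (Meta [] H ys, M) \<in> eqs \<Delta> \<and>
             ((\<exists>r zs. M = Recur [] r zs \<and> set zs \<subseteq> set ys) \<or>
              (\<exists>G ws. M = Meta [] G ws \<and> set ws \<subset> set ys))))"

definition add_eqs :: "('b, 'c) eqn set \<Rightarrow> ('b, 'c) uctx \<Rightarrow> ('b, 'c) uctx" where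
  "add_eqs E \<Delta> = \<Delta>\<lparr>eqs := eqs \<Delta> \<union> E\<rparr>"

definition add_def :: "('b, 'c) dfn \<Rightarrow> ('b, 'c) uctx \<Rightarrow> ('b, 'c) uctx" where
  "add_def d \<Delta> = \<Delta>\<lparr>defs := insert d (defs \<Delta>)\<rparr>"

definition add_contra :: "('b, 'c) uctx \<Rightarrow> ('b, 'c) uctx" where
  "add_contra \<Delta> = \<Delta>\<lparr>contra := True\<rparr>"

text \<open>Pairwise distinct named variables of the given types.\<close>

definition named_vars :: "'b ty list \<Rightarrow> 'b var list \<Rightarrow> bool" where
  "named_vars Bs xs \<longleftrightarrow> pattern [] xs Bs"

text \<open>
  For a head of argument types \<open>As\<close>, the terms \<open>\<lambda>ws\<^sub>i. G\<^sub>i ys ws\<^sub>i\<close>, \<open>\<eta>\<close>-expanded at \<open>As ! i\<close>;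
  \<open>imit_mvs\<close> says that the \<open>G\<^sub>i\<close> are recursive metavariables of the types this requires.
\<close>

definition imit_arg :: "'b var list \<Rightarrow> 'b ty \<Rightarrow> 'b mvar \<Rightarrow> ('b, 'c) tm" where
  "imit_arg ys A G =
     (let n = length (arg_tys A)
      in Meta (arg_tys A) G (map (lift_var n) ys @ map Bnd [0..<n]))"

definition imit_args :: "'b var list \<Rightarrow> 'b ty list \<Rightarrow> 'b mvar list \<Rightarrow> ('b, 'c) tm list" where
  "imit_args ys As Gs = map2 (imit_arg ys) As Gs"

definition imit_mvs :: "'b var list \<Rightarrow> 'b ty list \<Rightarrow> 'b mvar list \<Rightarrow> bool" where
  "imit_mvs ys As Gs \<longleftrightarrow>
     list_all2 (\<lambda>A G. mtag G = Rec \<and>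
        mty G = arrows (map (vtype []) ys @ arg_tys A) (target A)) As Gs"

definition prune_eqs ::
  "'b mvar \<Rightarrow> 'b var list \<Rightarrow> 'b rconst \<Rightarrow> 'b var list \<Rightarrow> 'b rconst \<Rightarrow> 'b var list
     \<Rightarrow> ('b, 'c) eqn set" where
  "prune_eqs H ys r xs t ws =
     {(Meta [] H ys, Recur [] t ws), (Recur [] r xs, Recur [] t ws)}"

definition ff_eqs ::
  "'b mvar \<Rightarrow> 'b var list \<Rightarrow> 'b mvar \<Rightarrow> 'b var list \<Rightarrow> 'b mvar \<Rightarrow> 'b var list
     \<Rightarrow> ('b, 'c) eqn set" where
  "ff_eqs G xs H ys F zs =
     {(Meta [] G xs, Meta [] F zs), (Meta [] H ys, Meta [] F zs)}"

text \<open>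
  The negated existential premises express that no instance of the conclusion is present. In
  \<open>U_INST\<close> and \<open>N_INST\<close> an instance opens the binders with variables that do not occur free
  under them. A list such as \<open>ws = xs \<inter> ys\<close> may enumerate the intersection in any order.
  The rules on bodies only speak about equations whose sides have no leading binders.
\<close>

inductive sat_rule ::
  "('c \<Rightarrow> 'b ty) \<Rightarrow> ('b, 'c) uctx \<Rightarrow> ('b, 'c) uctx \<Rightarrow> bool" for sig \<Delta> where
  U_INST:
  "(M, M') \<in> eqs \<Delta> \<Longrightarrow> sort_of M = Con \<Longrightarrow> sort_of M' = Con
   \<Longrightarrow> binders M = Bs \<Longrightarrow> binders M' = Bs
   \<Longrightarrow> \<not> (\<exists>xs'. named_vars Bs xs' \<and> set xs' \<inter> (FV M \<union> FV M') = {} \<and>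
            (open_tm xs' M, open_tm xs' M') \<in> eqs \<Delta>)
   \<Longrightarrow> named_vars Bs xs \<Longrightarrow> set xs \<inter> ctx_FV \<Delta> = {}
   \<Longrightarrow> sat_rule sig \<Delta> (add_eqs {(open_tm xs M, open_tm xs M')} \<Delta>)"
| N_INST:
  "(M, M') \<in> eqs \<Delta> \<Longrightarrow> sort_of M = Rec \<Longrightarrow> sort_of M' = Rec
   \<Longrightarrow> binders M = Bs \<Longrightarrow> binders M' = Bs
   \<Longrightarrow> \<not> (\<exists>xs'. named_vars Bs xs' \<and> set xs' \<inter> (FV M \<union> FV M') = {} \<and>
            (open_tm xs' M, open_tm xs' M') \<in> eqs \<Delta>)
   \<Longrightarrow> named_vars Bs xs \<Longrightarrow> set xs \<inter> ctx_FV \<Delta> = {}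
   \<Longrightarrow> sat_rule sig \<Delta> (add_eqs {(open_tm xs M, open_tm xs M')} \<Delta>)"
| SIMP_F1:
  "(Rigid [] (HVar x) Ns, Rigid [] (HCon c) Ns') \<in> eqs \<Delta>
   \<Longrightarrow> sat_rule sig \<Delta> (add_contra \<Delta>)"
| SIMP_F2:
  "(Rigid [] (HVar x) Ns, Rigid [] (HVar y) Ns') \<in> eqs \<Delta> \<Longrightarrow> x \<noteq> y
   \<Longrightarrow> sat_rule sig \<Delta> (add_contra \<Delta>)"
| SIMP_F3:
  "(Rigid [] (HCon c) Ns, Rigid [] (HCon d) Ns') \<in> eqs \<Delta> \<Longrightarrow> c \<noteq> d
   \<Longrightarrow> sat_rule sig \<Delta> (add_contra \<Delta>)"
| SIMP:
  "(Rigid [] h Ns, Rigid [] h Ns') \<in> eqs \<Delta>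
   \<Longrightarrow> sat_rule sig \<Delta> (add_eqs (set (zip Ns Ns')) \<Delta>)"
| PROJ_F:
  "(Meta [] H ys, Rigid [] (HVar z) Ns) \<in> eqs \<Delta> \<Longrightarrow> mtag H = Con \<Longrightarrow> z \<notin> set ys
   \<Longrightarrow> sat_rule sig \<Delta> (add_contra \<Delta>)"
| IMIT:
  "(Meta [] H ys, Rigid [] (HCon c) Ns) \<in> eqs \<Delta> \<Longrightarrow> mtag H = Con \<Longrightarrow> \<not> resolved \<Delta> H
   \<Longrightarrow> As = arg_tys (sig c)
   \<Longrightarrow> \<not> (\<exists>Gs'. imit_mvs ys As Gs' \<and>
            (Meta [] H ys, Rigid [] (HCon c) (imit_args ys As Gs')) \<in> eqs \<Delta>)
   \<Longrightarrow> imit_mvs ys As Gs \<Longrightarrow> distinct Gs \<Longrightarrow> set Gs \<inter> UV \<Delta> = {}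
   \<Longrightarrow> sat_rule sig \<Delta>
        (add_eqs {(Meta [] H ys, Rigid [] (HCon c) (imit_args ys As Gs))} \<Delta>)"
| PROJ:
  "(Meta [] H ys, Rigid [] (HVar y) Ns) \<in> eqs \<Delta> \<Longrightarrow> mtag H = Con \<Longrightarrow> y \<in> set ys
   \<Longrightarrow> \<not> resolved \<Delta> H
   \<Longrightarrow> As = arg_tys (vtype [] y)
   \<Longrightarrow> \<not> (\<exists>Gs'. imit_mvs ys As Gs' \<and>
            (Meta [] H ys, Rigid [] (HVar y) (imit_args ys As Gs')) \<in> eqs \<Delta>)
   \<Longrightarrow> imit_mvs ys As Gs \<Longrightarrow> distinct Gs \<Longrightarrow> set Gs \<inter> UV \<Delta> = {}
   \<Longrightarrow> sat_rule sig \<Delta>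
        (add_eqs {(Meta [] H ys, Rigid [] (HVar y) (imit_args ys As Gs))} \<Delta>)"
| PRUNE:
  "(Meta [] H ys, Recur [] r xs) \<in> eqs \<Delta> \<Longrightarrow> mtag H = Rec
   \<Longrightarrow> \<not> set xs \<subseteq> set ys \<Longrightarrow> distinct ws \<Longrightarrow> set ws = set xs \<inter> set ys
   \<Longrightarrow> \<not> resolved \<Delta> H
   \<Longrightarrow> \<not> (\<exists>t' G'. mtag G' = Con \<and> mty G' = rty t' \<and>
            prune_eqs H ys r xs t' ws \<subseteq> eqs \<Delta> \<and> (t', eta G') \<in> defs \<Delta>)
   \<Longrightarrow> rty t = arrows (map (vtype []) ws) (target (rty r)) \<Longrightarrow> t \<notin> ctx_rconsts \<Delta>
   \<Longrightarrow> mtag G = Con \<Longrightarrow> mty G = rty t \<Longrightarrow> G \<notin> UV \<Delta>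
   \<Longrightarrow> sat_rule sig \<Delta> (add_def (t, eta G) (add_eqs (prune_eqs H ys r xs t ws) \<Delta>))"
| FF_D:
  "(Meta [] G xs, Meta [] H ys) \<in> eqs \<Delta> \<Longrightarrow> mtag G = mtag H \<Longrightarrow> G \<noteq> H
   \<Longrightarrow> distinct zs \<Longrightarrow> set zs = set xs \<inter> set ys
   \<Longrightarrow> \<not> set xs \<subseteq> set ys \<Longrightarrow> \<not> set ys \<subseteq> set xs
   \<Longrightarrow> \<not> resolved \<Delta> H \<or> \<not> resolved \<Delta> G
   \<Longrightarrow> \<not> (\<exists>F'. mtag F' = mtag G \<and> ff_eqs G xs H ys F' zs \<subseteq> eqs \<Delta>)
   \<Longrightarrow> mtag F = mtag G \<Longrightarrow> mty F = arrows (map (vtype []) zs) (target (mty G))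
   \<Longrightarrow> F \<notin> UV \<Delta>
   \<Longrightarrow> sat_rule sig \<Delta> (add_eqs (ff_eqs G xs H ys F zs) \<Delta>)"
| FF_S:
  "(Meta [] G xs, Meta [] G ys) \<in> eqs \<Delta> \<Longrightarrow> xs \<noteq> ys
   \<Longrightarrow> distinct zs \<Longrightarrow> set zs = {xs ! i |i. i < length xs \<and> xs ! i = ys ! i}
   \<Longrightarrow> \<not> resolved \<Delta> G
   \<Longrightarrow> \<not> (\<exists>F'. mtag F' = mtag G \<and> ff_eqs G xs G ys F' zs \<subseteq> eqs \<Delta>)
   \<Longrightarrow> mtag F = mtag G \<Longrightarrow> mty F = arrows (map (vtype []) zs) (target (mty G))
   \<Longrightarrow> F \<notin> UV \<Delta>
   \<Longrightarrow> sat_rule sig \<Delta> (add_eqs (ff_eqs G xs G ys F zs) \<Delta>)"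
| REC_EXP:
  "(Recur [] r xs, Recur [] s ys) \<in> eqs \<Delta> \<Longrightarrow> (r, U1) \<in> defs \<Delta> \<Longrightarrow> (s, U2) \<in> defs \<Delta>
   \<Longrightarrow> sat_rule sig \<Delta> (add_eqs {(open_tm xs U1, open_tm ys U2)} \<Delta>)"
| U_AGREE:
  "(Meta [] H xs, U1) \<in> eqs \<Delta> \<Longrightarrow> (Meta [] H ys, U2) \<in> eqs \<Delta> \<Longrightarrow> mtag H = Con
   \<Longrightarrow> FV U1 \<subseteq> set xs \<Longrightarrow> FV U2 \<subseteq> set ys
   \<Longrightarrow> sat_rule sig \<Delta> (add_eqs {(U1, rename xs ys U2)} \<Delta>)"
| N_AGREE:
  "(Meta [] H xs, N1) \<in> eqs \<Delta> \<Longrightarrow> (Meta [] H ys, N2) \<in> eqs \<Delta> \<Longrightarrow> mtag H = Rec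
   \<Longrightarrow> FV N1 \<subseteq> set xs \<Longrightarrow> FV N2 \<subseteq> set ys
   \<Longrightarrow> sat_rule sig \<Delta> (add_eqs {(N1, rename xs ys N2)} \<Delta>)"
| U_SYM:
  "(U1, U2) \<in> eqs \<Delta> \<Longrightarrow> sort_of U1 = Con \<Longrightarrow> sort_of U2 = Con
   \<Longrightarrow> sat_rule sig \<Delta> (add_eqs {(U2, U1)} \<Delta>)"
| N_SYM:
  "(N1, N2) \<in> eqs \<Delta> \<Longrightarrow> sort_of N1 = Rec \<Longrightarrow> sort_of N2 = Rec
   \<Longrightarrow> sat_rule sig \<Delta> (add_eqs {(N2, N1)} \<Delta>)"
| U_TRANS:
  "(U1, U2) \<in> eqs \<Delta> \<Longrightarrow> (U2, U3) \<in> eqs \<Delta>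
   \<Longrightarrow> sort_of U1 = Con \<Longrightarrow> sort_of U2 = Con \<Longrightarrow> sort_of U3 = Con
   \<Longrightarrow> sat_rule sig \<Delta> (add_eqs {(U1, U3)} \<Delta>)"
| N_TRANS:
  "(N1, N2) \<in> eqs \<Delta> \<Longrightarrow> (N2, N3) \<in> eqs \<Delta>
   \<Longrightarrow> sort_of N1 = Rec \<Longrightarrow> sort_of N2 = Rec \<Longrightarrow> sort_of N3 = Rec
   \<Longrightarrow> sat_rule sig \<Delta> (add_eqs {(N1, N3)} \<Delta>)"

end

theory Submission
  imports Defs
begin

text \<open>
  A substitution \<open>\<Gamma>\<close> matters to a context \<open>\<Delta>\<close> only through the expansions of the terms that it
  substitutes: expansions of \<open>M[\<Gamma>]\<close> are computed by expanding \<open>M\<close> over \<open>defs \<Delta>\<close> and splicing in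
  those expansions at the metavariables. Hence \<open>\<approx>\<close> preserves unifiers, and restricting a unifier of
  \<open>\<Delta>'\<close> to \<open>UV \<Delta>\<close> gives one of \<open>\<Delta>\<close>.

  Conversely a unifier of \<open>\<Delta>\<close> is extended to the fresh metavariables of a rule. Imitation and
  projection read off the arguments of the term substituted for \<open>H\<close>. For pruning and the
  flex-flex rules, the two sides have equal expansions, so only variables common to both patterns
  occur in the expansion; but others may remain in the term itself. Replacing every
  recursion constant by one that takes just the arguments occurring in its expansion removes them,
  and the term can then be substituted for the fresh metavariable.
\<close>

text \<open>Everything is compared depth by depth, which works because unfolding a recursion
  constant costs no depth: bodies are contractive, so a term and its unfolding agree at the same
  \<open>k\<close>. Pruning shows the obstacle that remains: its fresh constant is defined through a
  contractive metavariable, whereas the term it must equal is recursive, so that term has to be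
  unfolded before it can serve as an image.

  A second obstacle is that the enlarged context is never shown to be well-formed. The arguments
  about it rest on a weaker invariant, closed contractive definition bodies and full argument lists
  (\<open>defs_ok\<close>, \<open>arities_ok\<close>), which is easy to check for each rule.

  Unifiers are compared up to \<open>\<approx>\<close>, and this is what allows a unifier to be
  cleaned of invisible variables first: cleaning changes terms and recursion constants, but neither
  the domain nor any expansion. For most general unifiers a purely syntactic fact is enough:
  restricting before or after composing gives the same equations on
  \<open>UV \<Delta>\<close>.\<close>

section \<open>Renaming and occurrences\<close>

text \<open>What remains of the free variables \<open>V\<close> of a body outside of its \<open>n\<close> binders.\<close>

definition unshift :: "nat \<Rightarrow> 'b var set \<Rightarrow> 'b var set" where
  "unshift n V = {v. lift_var n v \<in> V}"

fun hvars :: "('b, 'c) head \<Rightarrow> 'b var set" where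
  "hvars (HCon c) = {}"
| "hvars (HVar v) = {v}"

text \<open>Unlike \<open>FV\<close>, this also records dangling indices, which congruence of
  renaming needs below binders. On terms typed in the empty scope the two agree
  (\<open>has_ty_occ_FV\<close>).\<close>

fun occ :: "('b, 'c) tm \<Rightarrow> 'b var set" where
  "occ (Rigid Bs h Ns) = unshift (length Bs) (hvars h \<union> (\<Union>N \<in> set Ns. occ N))"
| "occ (Meta Bs H ys) = unshift (length Bs) (set ys)"
| "occ (Recur Bs r ys) = unshift (length Bs) (set ys)"

definition opn :: "'b var list \<Rightarrow> 'b var \<Rightarrow> 'b var" where
  "opn ys v = (case v of
     Bnd i \<Rightarrow> (if i < length ys then ys ! i else Bnd (i - length ys))
   | Free n A \<Rightarrow> Free n A)"

definition rn :: "'b var list \<Rightarrow> 'b var list \<Rightarrow> 'b var \<Rightarrow> 'b var" where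
  "rn ys xs v = (case map_of (zip xs ys) v of Some w \<Rightarrow> w | None \<Rightarrow> v)"

lemma open_tm_opn: "open_tm ys M = ren (opn ys) (with_binders [] M)"
  by (simp add: open_tm_def opn_def[abs_def])

lemma rename_rn: "rename ys xs = ren (rn ys xs)"
  by (simp add: rename_def rn_def[abs_def])

lemma opn_Bnd [simp]: "i < length ys \<Longrightarrow> opn ys (Bnd i) = ys ! i"
  by (simp add: opn_def)

lemma rn_nth: "distinct xs \<Longrightarrow> length ys = length xs \<Longrightarrow> i < length xs \<Longrightarrow> rn ys xs (xs ! i) = ys ! i"
  by (simp add: rn_def map_of_zip_nth)

lemma map_rn: "distinct xs \<Longrightarrow> length ys = length xs \<Longrightarrow> map (rn ys xs) xs = ys"
  by (rule nth_equalityI) (auto simp: rn_nth)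

lemma inj_lift_var: "lift_var n v = lift_var n w \<longleftrightarrow> v = w"
  by (cases v; cases w) auto

lemma under_lift [simp]: "under n \<rho> (lift_var n v) = lift_var n (\<rho> v)"
  by (cases v) auto

text \<open>Replaces index arithmetic under binders: \<open>under n \<rho>\<close> fixes variables
  of the first kind and acts like \<open>\<rho>\<close> on those of the second.\<close>

lemma var_split_cases:
  obtains (bound) i where "v = Bnd i" "i < n" | (lifted) w where "v = lift_var n w"
proof (cases v)
  case (Bnd i)
  show ?thesis
  proof (cases "i < n")
    case True with Bnd bound show ?thesis by blast
  next
    case False
    with Bnd have "v = lift_var n (Bnd (i - n))" by simp
    with lifted show ?thesis by blast
  qed
next
  case (Free k A)
  then have "v = lift_var n (Free k A)" by simp
  with lifted show ?thesis by blast
qed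

lemma lift_neq_bound [simp]: "i < n \<Longrightarrow> lift_var n w \<noteq> Bnd i" "i < n \<Longrightarrow> Bnd i \<noteq> lift_var n w"
  by (cases w; simp)+

lemma lift_0 [simp]: "lift_var 0 v = v"
  by (cases v) auto

lemma unshift_0 [simp]: "unshift 0 V = V"
  by (auto simp: unshift_def)

lemma under_0 [simp]: "under 0 \<rho> = \<rho>"
proof
  show "under 0 \<rho> v = \<rho> v" for v by (cases v) auto
qed

lemma under_under: "under n \<rho> (under n \<tau> v) = under n (\<rho> \<circ> \<tau>) v"
  by (rule var_split_cases[of v n]) auto

lemma under_comp: "under n \<rho> \<circ> under n \<tau> = under n (\<rho> \<circ> \<tau>)"
  by (rule ext) (simp add: under_under)

lemma under_id: "under n (\<lambda>v. v) v = v"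
  by (rule var_split_cases[of v n]) auto

lemma under_cong:
  assumes "\<And>v. v \<in> unshift n V \<Longrightarrow> \<rho> v = \<tau> v" and "v \<in> V"
  shows "under n \<rho> v = under n \<tau> v"
  using assms by (cases rule: var_split_cases[of v n]) (auto simp: unshift_def)

lemma unshift_under_image: "unshift n (under n \<rho> ` V) = \<rho> ` unshift n V"
proof
  show "unshift n (under n \<rho> ` V) \<subseteq> \<rho> ` unshift n V"
  proof
    fix v assume "v \<in> unshift n (under n \<rho> ` V)"
    then obtain u where u: "u \<in> V" "lift_var n v = under n \<rho> u" by (auto simp: unshift_def)
    then show "v \<in> \<rho> ` unshift n V"
      by (cases rule: var_split_cases[of u n]) (auto simp: unshift_def inj_lift_var)
  qed
  show "\<rho> ` unshift n V \<subseteq> unshift n (under n \<rho> ` V)"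
  proof
    fix v assume "v \<in> \<rho> ` unshift n V"
    then obtain u where u: "lift_var n u \<in> V" "v = \<rho> u" by (auto simp: unshift_def)
    then have "lift_var n v = under n \<rho> (lift_var n u)" by simp
    with u(1) show "v \<in> unshift n (under n \<rho> ` V)" unfolding unshift_def by blast
  qed
qed

lemma inj_on_under:
  assumes "inj_on \<rho> (unshift n V)" shows "inj_on (under n \<rho>) V"
proof (rule inj_onI)
  fix v w assume *: "v \<in> V" "w \<in> V" "under n \<rho> v = under n \<rho> w"
  show "v = w"
  proof (cases v rule: var_split_cases[of _ n])
    case (bound i)
    with * show ?thesis by (cases w rule: var_split_cases[of _ n]) auto
  next
    case (lifted v')
    then show ?thesis
    proof (cases w rule: var_split_cases[of _ n])
      case (bound i)
      with * lifted show ?thesis by auto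
    next
      case (lifted w')
      with * \<open>v = lift_var n v'\<close> assms show ?thesis
        by (auto simp: inj_on_def unshift_def inj_lift_var)
    qed
  qed
qed

lemma ren_head_comp: "ren_head \<rho> (ren_head \<tau> h) = ren_head (\<rho> \<circ> \<tau>) h"
  by (cases h) auto

lemma hvars_ren_head: "hvars (ren_head \<rho> h) = \<rho> ` hvars h"
  by (cases h) auto

lemma ren_head_cong: "(\<And>v. v \<in> hvars h \<Longrightarrow> \<rho> v = \<tau> v) \<Longrightarrow> ren_head \<rho> h = ren_head \<tau> h"
  by (cases h) auto

lemma ren_head_eqD: "ren_head \<rho> h = ren_head \<tau> h \<Longrightarrow> v \<in> hvars h \<Longrightarrow> \<rho> v = \<tau> v"
  by (cases h) auto

lemma ren_ren: "ren \<rho> (ren \<tau> M) = ren (\<rho> \<circ> \<tau>) M"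
  by (induction M arbitrary: \<rho> \<tau>) (simp_all add: ren_head_comp under_comp under_under)

lemma ren_cong: "(\<And>v. v \<in> occ M \<Longrightarrow> \<rho> v = \<tau> v) \<Longrightarrow> ren \<rho> M = ren \<tau> M"
proof (induction M arbitrary: \<rho> \<tau>)
  case (Rigid Bs h Ns)
  let ?V = "hvars h \<union> (\<Union>N \<in> set Ns. occ N)"
  have u: "under (length Bs) \<rho> v = under (length Bs) \<tau> v" if "v \<in> ?V" for v
    using under_cong[of "length Bs" ?V \<rho> \<tau> v] Rigid.prems that by simp
  have "ren_head (under (length Bs) \<rho>) h = ren_head (under (length Bs) \<tau>) h"
    using u by (intro ren_head_cong) auto
  moreover have "ren (under (length Bs) \<rho>) N = ren (under (length Bs) \<tau>) N" if "N \<in> set Ns" for N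
    using u that by (intro Rigid.IH) auto
  ultimately show ?case by simp
next
  case (Meta Bs H ys)
  then show ?case using under_cong[of "length Bs" "set ys" \<rho> \<tau>] by simp
next
  case (Recur Bs r ys)
  then show ?case using under_cong[of "length Bs" "set ys" \<rho> \<tau>] by simp
qed

lemma ren_id: "ren (\<lambda>v. v) M = M"
proof (induction M)
  case (Rigid Bs h Ns)
  have "under (length Bs) (\<lambda>v. v) = (\<lambda>v :: 'a var. v)" by (rule ext) (rule under_id)
  with Rigid show ?case by (cases h) (simp_all add: map_idI)
qed (simp_all add: under_id map_idI)

lemma ren_idI: "(\<And>v. v \<in> occ M \<Longrightarrow> \<rho> v = v) \<Longrightarrow> ren \<rho> M = M"
  using ren_cong[of M \<rho> "\<lambda>v. v"] by (simp add: ren_id)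

lemma occ_ren: "occ (ren \<rho> M) = \<rho> ` occ M"
proof (induction M arbitrary: \<rho>)
  case (Rigid Bs h Ns)
  have "hvars (ren_head (under (length Bs) \<rho>) h) \<union> (\<Union>N \<in> set Ns. occ (ren (under (length Bs) \<rho>) N))
    = under (length Bs) \<rho> ` (hvars h \<union> (\<Union>N \<in> set Ns. occ N))"
    using Rigid by (auto simp: hvars_ren_head)
  then show ?case by (simp add: unshift_under_image)
qed (simp_all add: unshift_under_image)

lemma binders_with_binders [simp]: "binders (with_binders Bs M) = Bs"
  by (cases M) auto

lemma with_binders_with_binders [simp]: "with_binders Bs (with_binders Cs M) = with_binders Bs M"
  by (cases M) auto

lemma with_binders_binders [simp]: "with_binders (binders M) M = M"
  by (cases M) auto

lemma binders_ren [simp]: "binders (ren \<rho> M) = binders M"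
  by (cases M) auto

lemma binders_open_tm [simp]: "binders (open_tm ys M) = []"
  by (simp add: open_tm_opn)

lemma with_binders_open_tm [simp]: "with_binders [] (open_tm ys M) = open_tm ys M"
  by (metis binders_open_tm with_binders_binders)

lemma occ_with_binders: "occ M = unshift (length (binders M)) (occ (with_binders [] M))"
  by (cases M) auto

lemma ren_with_binders:
  "binders N = [] \<Longrightarrow> ren \<rho> (with_binders Bs N) = with_binders Bs (ren (under (length Bs) \<rho>) N)"
  by (cases N) auto

lemma with_binders_ren:
  "with_binders Cs (ren \<rho> M) = with_binders Cs (ren (under (length (binders M)) \<rho>) (with_binders [] M))"
  by (cases M) auto

text \<open>The number of binders is fixed along with closedness so that opening at \<open>n\<close>
  variables replaces every variable left in the body. A later renaming then acts on those
  \<open>n\<close> variables alone (\<open>ren_open\<close>).\<close>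

definition closed_tm :: "nat \<Rightarrow> ('b, 'c) tm \<Rightarrow> bool" where
  "closed_tm n T \<longleftrightarrow> occ T = {} \<and> length (binders T) = n"

lemma closed_body:
  assumes "closed_tm n T" "v \<in> occ (with_binders [] T)"
  obtains i where "v = Bnd i" "i < n"
  using assms occ_with_binders[of T]
  by (cases v rule: var_split_cases[of _ n]) (auto simp: closed_tm_def unshift_def)

lemma ren_open:
  assumes "closed_tm (length ys) T"
  shows "ren \<rho> (open_tm ys T) = open_tm (map \<rho> ys) T"
  unfolding open_tm_opn ren_ren
  by (rule ren_cong) (auto elim: closed_body[OF assms])

lemma ren_with_binders_open:
  assumes "closed_tm (length ys) T"
  shows "ren \<rho> (with_binders Bs (open_tm ys T)) =
    with_binders Bs (open_tm (map (under (length Bs) \<rho>) ys) T)"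
  using assms by (simp add: ren_with_binders ren_open)

section \<open>Expansions\<close>

fun eocc :: "('b, 'c) etm \<Rightarrow> 'b var set" where
  "eocc Bot = {}"
| "eocc (ERigid Bs h Ns) = unshift (length Bs) (hvars h \<union> (\<Union>N \<in> set Ns. eocc N))"
| "eocc (EMeta Bs H ys) = unshift (length Bs) (set ys)"

fun eren :: "('b var \<Rightarrow> 'b var) \<Rightarrow> ('b, 'c) etm \<Rightarrow> ('b, 'c) etm" where
  "eren \<rho> Bot = Bot"
| "eren \<rho> (ERigid Bs h Ns) =
     ERigid Bs (ren_head (under (length Bs) \<rho>) h) (map (eren (under (length Bs) \<rho>)) Ns)"
| "eren \<rho> (EMeta Bs H ys) = EMeta Bs H (map (under (length Bs) \<rho>) ys)"

fun ewith :: "'b ty list \<Rightarrow> ('b, 'c) etm \<Rightarrow> ('b, 'c) etm" where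
  "ewith Bs Bot = Bot"
| "ewith Bs (ERigid _ h Ns) = ERigid Bs h Ns"
| "ewith Bs (EMeta _ H ys) = EMeta Bs H ys"

definition eopen :: "'b var list \<Rightarrow> ('b, 'c) etm \<Rightarrow> ('b, 'c) etm" where
  "eopen ys T = eren (opn ys) (ewith [] T)"

fun ebinders :: "('b, 'c) etm \<Rightarrow> 'b ty list" where
  "ebinders Bot = []"
| "ebinders (ERigid Bs h Ns) = Bs"
| "ebinders (EMeta Bs H ys) = Bs"

lemma eren_eren: "eren \<rho> (eren \<tau> M) = eren (\<rho> \<circ> \<tau>) M"
  by (induction M arbitrary: \<rho> \<tau>) (simp_all add: ren_head_comp under_comp under_under)

lemma eren_cong: "(\<And>v. v \<in> eocc M \<Longrightarrow> \<rho> v = \<tau> v) \<Longrightarrow> eren \<rho> M = eren \<tau> M"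
proof (induction M arbitrary: \<rho> \<tau>)
  case (ERigid Bs h Ns)
  let ?V = "hvars h \<union> (\<Union>N \<in> set Ns. eocc N)"
  have u: "under (length Bs) \<rho> v = under (length Bs) \<tau> v" if "v \<in> ?V" for v
    using under_cong[of "length Bs" ?V \<rho> \<tau> v] ERigid.prems that by simp
  have "ren_head (under (length Bs) \<rho>) h = ren_head (under (length Bs) \<tau>) h"
    using u by (intro ren_head_cong) auto
  moreover have "eren (under (length Bs) \<rho>) N = eren (under (length Bs) \<tau>) N" if "N \<in> set Ns" for N
    using u that by (intro ERigid.IH) auto
  ultimately show ?case by simp
next
  case (EMeta Bs H ys)
  then show ?case using under_cong[of "length Bs" "set ys" \<rho> \<tau>] by simp
qed simp

text \<open>Expansions record each variable at its position, so two renamings with the same result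
  must agree on everything visible. For FF_S this forces equal arguments at visible
  positions.\<close>

lemma eren_eqD: "eren \<rho> M = eren \<tau> M \<Longrightarrow> v \<in> eocc M \<Longrightarrow> \<rho> v = \<tau> v"
proof (induction M arbitrary: \<rho> \<tau> v)
  case (ERigid Bs h Ns)
  from ERigid.prems(2) consider "lift_var (length Bs) v \<in> hvars h"
    | N where "N \<in> set Ns" "lift_var (length Bs) v \<in> eocc N"
    by (auto simp: unshift_def)
  then have "under (length Bs) \<rho> (lift_var (length Bs) v) = under (length Bs) \<tau> (lift_var (length Bs) v)"
  proof cases
    case 1
    with ERigid.prems(1) show ?thesis by (intro ren_head_eqD) auto
  next
    case 2
    with ERigid.prems(1) show ?thesis by (intro ERigid.IH[OF 2(1) _ 2(2)]) simp
  qed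
  then show ?case by (simp add: inj_lift_var)
next
  case (EMeta Bs H ys)
  then have "under (length Bs) \<rho> (lift_var (length Bs) v) = under (length Bs) \<tau> (lift_var (length Bs) v)"
    by (simp add: unshift_def del: under_lift)
  then show ?case by (simp add: inj_lift_var)
qed simp

lemma eocc_eren: "eocc (eren \<rho> M) = \<rho> ` eocc M"
proof (induction M arbitrary: \<rho>)
  case (ERigid Bs h Ns)
  have "hvars (ren_head (under (length Bs) \<rho>) h) \<union> (\<Union>N \<in> set Ns. eocc (eren (under (length Bs) \<rho>) N))
    = under (length Bs) \<rho> ` (hvars h \<union> (\<Union>N \<in> set Ns. eocc N))"
    using ERigid by (auto simp: hvars_ren_head)
  then show ?case by (simp add: unshift_under_image)
qed (simp_all add: unshift_under_image)

lemma ewith_ewith [simp]: "ewith Bs (ewith Cs T) = ewith Bs T"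
  by (cases T) auto

lemma eocc_ewith: "eocc T = unshift (length (ebinders T)) (eocc (ewith [] T))"
  by (cases T) auto

lemma eren_ewith:
  "ebinders N = [] \<Longrightarrow> eren \<rho> (ewith Bs N) = ewith Bs (eren (under (length Bs) \<rho>) N)"
  by (cases N) auto

lemma ebinders_ewith_Nil [simp]: "ebinders (ewith [] T) = []"
  by (cases T) auto

lemma ebinders_eren [simp]: "ebinders (eren \<rho> T) = ebinders T"
  by (cases T) auto

lemma ebinders_eopen [simp]: "ebinders (eopen ys T) = []"
  by (simp add: eopen_def)

lemma eopen_Bot [simp]: "eopen ys Bot = Bot"
  by (simp add: eopen_def)

text \<open>\<open>Bot\<close> has lost its binder block, so it counts as closed for every
  \<open>n\<close>.\<close>

definition closed_etm :: "nat \<Rightarrow> ('b, 'c) etm \<Rightarrow> bool" where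
  "closed_etm n T \<longleftrightarrow> eocc T = {} \<and> (T = Bot \<or> length (ebinders T) = n)"

lemma closed_ebody:
  assumes "closed_etm n T" "v \<in> eocc (ewith [] T)"
  obtains i where "v = Bnd i" "i < n"
  using assms eocc_ewith[of T]
  by (cases v rule: var_split_cases[of _ n]) (auto simp: closed_etm_def unshift_def)

lemma eren_eopen:
  assumes "closed_etm (length ys) T"
  shows "eren \<rho> (eopen ys T) = eopen (map \<rho> ys) T"
  unfolding eopen_def eren_eren
  by (rule eren_cong) (auto elim: closed_ebody[OF assms])

lemma eren_ewith_eopen:
  assumes "closed_etm (length ys) T"
  shows "eren \<rho> (ewith Bs (eopen ys T)) = ewith Bs (eopen (map (under (length Bs) \<rho>) ys) T)"
  using assms by (simp add: eren_ewith eren_eopen)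

lemma eocc_eopen:
  assumes "closed_etm (length ys) T"
  shows "eocc (eopen ys T) = {ys ! i |i. Bnd i \<in> eocc (ewith [] T)}"
  unfolding eopen_def eocc_eren
proof (intro equalityI subsetI)
  fix v assume "v \<in> opn ys ` eocc (ewith [] T)"
  then obtain u where u: "u \<in> eocc (ewith [] T)" "v = opn ys u" by blast
  from closed_ebody[OF assms u(1)] obtain i where "u = Bnd i" "i < length ys" .
  with u show "v \<in> {ys ! i |i. Bnd i \<in> eocc (ewith [] T)}" by auto
next
  fix v assume "v \<in> {ys ! i |i. Bnd i \<in> eocc (ewith [] T)}"
  then obtain i where i: "v = ys ! i" "Bnd i \<in> eocc (ewith [] T)" by blast
  from closed_ebody[OF assms i(2)] have "i < length ys" by auto
  then have "v = opn ys (Bnd i)" using i by simp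
  with i show "v \<in> opn ys ` eocc (ewith [] T)" by blast
qed

lemma eocc_eopen_subset:
  assumes "closed_etm (length ys) T" shows "eocc (eopen ys T) \<subseteq> set ys"
  unfolding eopen_def eocc_eren by (auto elim!: closed_ebody[OF assms])

text \<open>The fragment of typing that expansion relies on: argument lists fill all parameters of a
  closed definition or image. It can be checked for single equations of an enlarged context without
  typing that context.\<close>

fun arities_ok :: "('b, 'c) tm \<Rightarrow> bool" where
  "arities_ok (Rigid Bs h Ns) \<longleftrightarrow> (\<forall>N \<in> set Ns. arities_ok N)"
| "arities_ok (Meta Bs H ys) \<longleftrightarrow> length ys = length (arg_tys (mty H))"
| "arities_ok (Recur Bs r ys) \<longleftrightarrow> length ys = length (arg_tys (rty r))"

definition defs_ok :: "('b, 'c) dfn set \<Rightarrow> bool" where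
  "defs_ok D \<longleftrightarrow> single_valued D \<and>
     (\<forall>(r, U) \<in> D. sort_of U = Con \<and> closed_tm (length (arg_tys (rty r))) U \<and> arities_ok U)"

lemma defs_okD:
  assumes "defs_ok D" "(r, U) \<in> D"
  shows "sort_of U = Con" "closed_tm (length (arg_tys (rty r))) U" "arities_ok U"
  using assms by (auto simp: defs_ok_def)

lemma arities_ok_ren [simp]: "arities_ok (ren \<rho> M) = arities_ok M"
  by (induction M arbitrary: \<rho>) auto

lemma arities_ok_with_binders [simp]: "arities_ok (with_binders Bs M) = arities_ok M"
  by (cases M) auto

lemma arities_ok_open_tm [simp]: "arities_ok (open_tm ys M) = arities_ok M"
  by (simp add: open_tm_opn)

lemma def_of_eq: "single_valued D \<Longrightarrow> (r, U) \<in> D \<Longrightarrow> def_of D r = Some U"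
  by (auto simp: def_of_def single_valued_def intro!: the_equality)

lemma def_of_None: "r \<notin> Domain D \<Longrightarrow> def_of D r = None"
  by (auto simp: def_of_def)

lemma def_of_cases:
  assumes "single_valued D"
  obtains (Some) U where "(r, U) \<in> D" "def_of D r = Some U" | (None) "r \<notin> Domain D" "def_of D r = None"
  using assms def_of_eq def_of_None by (metis Domain.simps)

lemma unfold_with_binders: "unfold D (with_binders Bs M) = with_binders Bs (unfold D M)"
  by (cases M) (auto split: option.splits)

lemma unfold_ren:
  assumes "defs_ok D" "arities_ok M" shows "unfold D (ren \<rho> M) = ren \<rho> (unfold D M)"
proof (cases M)
  case (Recur Bs r ys)
  have sv: "single_valued D" using assms by (simp add: defs_ok_def)
  show ?thesis
  proof (cases rule: def_of_cases[OF sv, where r = r, case_names Some None])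
    case (Some U)
    with defs_okD[OF assms(1) Some(1)] assms(2) Recur show ?thesis
      by (simp add: ren_with_binders_open)
  next
    case None
    with Recur show ?thesis by simp
  qed
qed simp_all

lemma arities_ok_unfold:
  assumes "defs_ok D" "arities_ok M" shows "arities_ok (unfold D M)"
proof (cases M)
  case (Recur Bs r ys)
  have sv: "single_valued D" using assms by (simp add: defs_ok_def)
  show ?thesis
    by (cases rule: def_of_cases[OF sv, where r = r, case_names Some None]) (use Recur assms in \<open>auto dest: defs_okD\<close>)
qed (use assms in simp_all)

lemma expand_with_binders: "expand D k (with_binders Bs M) = ewith Bs (expand D k M)"
  by (cases k; cases "unfold D M"; simp add: unfold_with_binders)

text \<open>Definition bodies are closed, so unfolding passes a renaming through to the arguments of
  the constant.\<close>

lemma expand_ren: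
  assumes "defs_ok D" shows "arities_ok M \<Longrightarrow> expand D k (ren \<rho> M) = eren \<rho> (expand D k M)"
proof (induction k arbitrary: M \<rho>)
  case (Suc k)
  have "arities_ok (unfold D M)" using arities_ok_unfold[OF assms] Suc.prems .
  with Suc.IH show ?case
    by (cases "unfold D M") (simp_all add: unfold_ren[OF assms Suc.prems])
qed simp

lemma expand_open:
  assumes "defs_ok D" "arities_ok T"
  shows "expand D k (with_binders Bs (open_tm ys T)) = ewith Bs (eopen ys (expand D k T))"
    "expand D k (open_tm ys T) = eopen ys (expand D k T)"
  using assms by (simp_all add: expand_with_binders open_tm_opn expand_ren eopen_def)

text \<open>
  A variable outside of \<open>occ M\<close> can be renamed without changing \<open>M\<close>, hence without changing a
  result \<open>e M\<close> that commutes with renaming.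
\<close>

lemma eocc_equivariant:
  assumes "\<And>\<rho>. e (ren \<rho> M) = eren \<rho> (e M)" shows "eocc (e M) \<subseteq> occ M"
proof
  fix v assume v: "v \<in> eocc (e M)"
  obtain n where n: "v \<noteq> Bnd n" by (metis n_not_Suc_n var.inject(1))
  let ?\<rho> = "(\<lambda>w. w)(v := Bnd n)"
  show "v \<in> occ M"
  proof (rule ccontr)
    assume "v \<notin> occ M"
    then have "ren ?\<rho> M = ren (\<lambda>w. w) M" by (intro ren_cong) auto
    then have "eren ?\<rho> (e M) = eren (\<lambda>w. w) (e M)" using assms by metis
    from eren_eqD[OF this v] n show False by simp
  qed
qed

lemma closed_expand:
  assumes "defs_ok D" "arities_ok T" "closed_tm n T" shows "closed_etm n (expand D k T)"
proof -
  have "binders (unfold D T) = binders T"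
    by (cases T) (auto split: option.splits)
  then have "expand D k T = Bot \<or> ebinders (expand D k T) = binders T"
    by (cases k) (auto split: tm.splits)
  moreover have "eocc (expand D k T) \<subseteq> occ T"
    by (rule eocc_equivariant) (rule expand_ren[OF assms(1,2)])
  ultimately show ?thesis using assms(3) by (auto simp: closed_tm_def closed_etm_def)
qed

section \<open>Evaluation of terms under a substitution\<close>

text \<open>
  \<open>eval D s\<close> is expansion over the definitions \<open>D\<close> with every metavariable instantiated on the
  fly; \<open>s H k\<close> is the depth-\<open>k\<close> expansion of the term substituted for \<open>H\<close>. It depends on a
  substitution only through its expansions, and avoids the renaming apart of constants.
\<close>

primrec eval ::
  "('b, 'c) dfn set \<Rightarrow> ('b mvar \<Rightarrow> nat \<Rightarrow> ('b, 'c) etm) \<Rightarrow> nat \<Rightarrow> ('b, 'c) tm \<Rightarrow> ('b, 'c) etm"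
where
  "eval D s 0 M = Bot"
| "eval D s (Suc k) M =
     (case unfold D M of
        Rigid Bs h Ns \<Rightarrow> ERigid Bs h (map (eval D s k) Ns)
      | Meta Bs H ys \<Rightarrow> ewith Bs (eopen ys (s H (Suc k)))
      | Recur Bs r ys \<Rightarrow> Bot)"

text \<open>The clause at depth \<open>0\<close> makes \<open>eval_Meta\<close> valid at every
  depth, since \<open>eval\<close> is \<open>Bot\<close> there by definition.\<close>

definition sem_ok :: "('b mvar \<Rightarrow> nat \<Rightarrow> ('b, 'c) etm) \<Rightarrow> bool" where
  "sem_ok s \<longleftrightarrow> (\<forall>H. s H 0 = Bot \<and> (\<forall>k. closed_etm (length (arg_tys (mty H))) (s H k)))"

lemma sem_okD: "sem_ok s \<Longrightarrow> s H 0 = Bot" "sem_ok s \<Longrightarrow> closed_etm (length (arg_tys (mty H))) (s H k)"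
  by (auto simp: sem_ok_def)

lemma eval_with_binders: "eval D s k (with_binders Bs M) = ewith Bs (eval D s k M)"
  by (cases k; cases "unfold D M"; simp add: unfold_with_binders)

lemma eval_ren:
  assumes "defs_ok D" "sem_ok s"
  shows "arities_ok M \<Longrightarrow> eval D s k (ren \<rho> M) = eren \<rho> (eval D s k M)"
proof (induction k arbitrary: M \<rho>)
  case (Suc k)
  have arities_ok: "arities_ok (unfold D M)" using arities_ok_unfold[OF assms(1)] Suc.prems .
  show ?case
  proof (cases "unfold D M")
    case (Meta Bs H ys)
    then have "closed_etm (length ys) (s H (Suc k))" using sem_okD(2)[OF assms(2), of H "Suc k"] arities_ok by simp
    then show ?thesis by (simp add: unfold_ren[OF assms(1) Suc.prems] Meta eren_ewith_eopen)
  qed (use Suc.IH arities_ok in \<open>simp_all add: unfold_ren[OF assms(1) Suc.prems]\<close>)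
qed simp

lemma eocc_eval:
  assumes "defs_ok D" "sem_ok s" "arities_ok M" shows "eocc (eval D s k M) \<subseteq> occ M"
  by (rule eocc_equivariant) (rule eval_ren[OF assms])

lemma eval_open:
  assumes "defs_ok D" "sem_ok s" "arities_ok T"
  shows "eval D s k (open_tm ys T) = eopen ys (eval D s k T)"
  using assms by (simp add: eval_with_binders open_tm_opn eval_ren eopen_def)

lemma eval_Rigid: "eval D s (Suc k) (Rigid Bs h Ns) = ERigid Bs h (map (eval D s k) Ns)"
  by simp

lemma eval_Meta: "sem_ok s \<Longrightarrow> eval D s k (Meta Bs H ys) = ewith Bs (eopen ys (s H k))"
  by (cases k) (simp_all add: sem_okD)

text \<open>No depth is lost: the body is contractive, so it is its own unfolding and both sides
  look at the same head.\<close>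

lemma eval_Recur:
  assumes "defs_ok D" "(r, U) \<in> D"
  shows "eval D s k (Recur Bs r ys) = eval D s k (with_binders Bs (open_tm ys U))"
proof (cases k)
  case (Suc j)
  have "def_of D r = Some U" using assms by (intro def_of_eq) (auto simp: defs_ok_def)
  moreover have "unfold D (with_binders Bs (open_tm ys U)) = with_binders Bs (open_tm ys U)"
    using defs_okD(1)[OF assms] by (intro unfold_contractive) simp
  ultimately show ?thesis using Suc by simp
qed simp

text \<open>\<open>R\<close> is closed under unfolding and \<open>V\<close> covers the metavariables
  met on the way, so evaluation never leaves the part where both sides have the same data.\<close>

lemma eval_cong:
  assumes "\<And>H k. H \<in> V \<Longrightarrow> s H k = s' H k"
    and "\<And>r. r \<in> R \<Longrightarrow> def_of D r = def_of D' r"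
    and "\<And>r U. r \<in> R \<Longrightarrow> def_of D r = Some U \<Longrightarrow> mvars U \<subseteq> V \<and> rconsts U \<subseteq> R"
  shows "mvars M \<subseteq> V \<Longrightarrow> rconsts M \<subseteq> R \<Longrightarrow> eval D s k M = eval D' s' k M"
proof (induction k arbitrary: M)
  case (Suc k)
  have rm: "mvars (ren \<rho> N) = mvars N" "rconsts (ren \<rho> N) = rconsts N" for \<rho> and N :: "('a, 'b) tm"
    by (induction N arbitrary: \<rho>) auto
  have bm: "mvars (with_binders Bs N) = mvars N" "rconsts (with_binders Bs N) = rconsts N"
    for Bs and N :: "('a, 'b) tm"
    by (cases N; simp)+
  have u: "unfold D M = unfold D' M"
    using Suc.prems assms(2) by (cases M) (auto split: option.splits)
  have "mvars (unfold D M) \<subseteq> V" "rconsts (unfold D M) \<subseteq> R"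
    using Suc.prems assms(3)
    by (cases M; auto simp: open_tm_opn rm bm split: option.splits)+
  then have IH: "eval D s k N = eval D' s' k N" if "unfold D M = Rigid Bs h Ns" "N \<in> set Ns" for Bs h Ns N
    using that by (intro Suc.IH) auto
  have V: "s H (Suc k) = s' H (Suc k)" if "unfold D M = Meta Bs H ys" for Bs H ys
    using that \<open>mvars (unfold D M) \<subseteq> V\<close> assms(1) by auto
  show ?case
    using u[symmetric] IH V by (cases "unfold D M") auto
qed simp

section \<open>Typing\<close>

lemma target_arrows [simp]: "target (arrows Bs b) = b"
  by (induction Bs) (auto simp: arrows_def)

lemma arg_tys_arrows [simp]: "arg_tys (arrows Bs b) = Bs"
  by (induction Bs) (auto simp: arrows_def)

lemma arrows_arg_tys [simp]: "arrows (arg_tys A) (target A) = A"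
  by (induction A) (auto simp: arrows_def)

lemma arrows_Nil [simp]: "arrows [] b = Base b"
  by (simp add: arrows_def)

lemma has_ty_iff:
  "has_ty sig Cs m (Rigid Bs h Ns) A \<longleftrightarrow> m = Con \<and> head_in_scope (Bs @ Cs) h \<and>
     list_all2 (has_ty sig (Bs @ Cs) Rec) Ns (arg_tys (head_ty sig (Bs @ Cs) h)) \<and>
     A = arrows Bs (target (head_ty sig (Bs @ Cs) h))"
  "has_ty sig Cs m (Meta Bs H ys) A \<longleftrightarrow> m = mtag H \<and> pattern (Bs @ Cs) ys (arg_tys (mty H)) \<and>
     A = arrows Bs (target (mty H))"
  "has_ty sig Cs m (Recur Bs r ys) A \<longleftrightarrow> m = Rec \<and> pattern (Bs @ Cs) ys (arg_tys (rty r)) \<and>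
     A = arrows Bs (target (rty r))"
  by (auto elim: has_ty.cases intro: has_ty.intros)

lemma has_ty_sort: "has_ty sig Cs m M A \<Longrightarrow> sort_of M = m"
  by (cases M) (auto simp: has_ty_iff)

lemma has_ty_binders: "has_ty sig Cs m M A \<Longrightarrow> binders M = arg_tys A"
  by (cases M) (auto simp: has_ty_iff)

lemma pattern_length: "pattern Bs ys As \<Longrightarrow> length ys = length As"
  by (auto simp: pattern_def)

lemma has_ty_arities_ok: "has_ty sig Cs m M A \<Longrightarrow> arities_ok M"
proof (induction M arbitrary: Cs m A)
  case (Rigid Bs h Ns)
  then show ?case by (fastforce simp: has_ty_iff list_all2_conv_all_nth in_set_conv_nth)
qed (auto simp: has_ty_iff pattern_length)

lemma in_scope_lift [simp]: "in_scope (Bs @ Cs) (lift_var (length Bs) v) = in_scope Cs v"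
  by (cases v) auto

lemma vtype_lift [simp]: "vtype (Bs @ Cs) (lift_var (length Bs) v) = vtype Cs v"
  by (cases v) auto

lemma has_ty_occ: "has_ty sig Cs m M A \<Longrightarrow> v \<in> occ M \<Longrightarrow> in_scope Cs v"
proof (induction M arbitrary: Cs m A v)
  case (Rigid Bs h Ns)
  then have "lift_var (length Bs) v \<in> hvars h \<union> (\<Union>N \<in> set Ns. occ N)" by (simp add: unshift_def)
  then show ?case
  proof
    assume "lift_var (length Bs) v \<in> hvars h"
    with Rigid.prems(1) show ?thesis by (cases h) (auto simp: has_ty_iff)
  next
    assume "lift_var (length Bs) v \<in> (\<Union>N \<in> set Ns. occ N)"
    then obtain i where i: "i < length Ns" "lift_var (length Bs) v \<in> occ (Ns ! i)"
      by (auto simp: in_set_conv_nth)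
    with Rigid.prems(1)
    have "has_ty sig (Bs @ Cs) Rec (Ns ! i) (arg_tys (head_ty sig (Bs @ Cs) h) ! i)"
      by (auto simp: has_ty_iff list_all2_conv_all_nth)
    from Rigid.IH[OF nth_mem[OF i(1)] this i(2)] show ?thesis by simp
  qed
qed (auto simp: has_ty_iff pattern_def unshift_def)

lemma Free_occ: "Free n A \<in> occ M \<longleftrightarrow> Free n A \<in> FV M"
proof (induction M)
  case (Rigid Bs h Ns)
  then show ?case
  proof (cases h)
    case (HVar v)
    with Rigid show ?thesis by (cases v) (auto simp: unshift_def)
  qed (auto simp: unshift_def)
next
  case (Meta Bs H ys)
  have "Free n A \<in> fvv y \<longleftrightarrow> y = Free n A" for y by (cases y) auto
  then show ?case by (auto simp: unshift_def)
next
  case (Recur Bs H ys)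
  have "Free n A \<in> fvv y \<longleftrightarrow> y = Free n A" for y by (cases y) auto
  then show ?case by (auto simp: unshift_def)
qed

lemma fvv_Free: "v \<in> fvv x \<Longrightarrow> \<exists>n A. v = Free n A"
  by (cases x) auto

lemma FV_Free: "v \<in> FV M \<Longrightarrow> \<exists>n A. v = Free n A"
  by (induction M) (auto split: head.splits dest: fvv_Free)

lemma has_ty_occ_FV:
  assumes "has_ty sig [] m M A" shows "occ M = FV M"
proof (intro set_eqI)
  fix v
  show "v \<in> occ M \<longleftrightarrow> v \<in> FV M"
    using has_ty_occ[OF assms, of v] FV_Free[of v M] Free_occ[of _ _ M] by (cases v) auto
qed

lemma has_ty_closed:
  "has_ty sig [] m T A \<Longrightarrow> FV T = {} \<Longrightarrow> closed_tm (length (arg_tys A)) T"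
  by (simp add: closed_tm_def has_ty_occ_FV has_ty_binders)

text \<open>Injectivity on the occurring variables keeps argument lists distinct, that is, keeps
  them patterns.\<close>

lemma has_ty_ren:
  fixes M :: "('b, 'c) tm"
  assumes "has_ty sig Cs m M A"
    and "\<And>v. v \<in> occ M \<Longrightarrow> in_scope Cs v \<Longrightarrow> in_scope Cs' (\<rho> v) \<and> vtype Cs' (\<rho> v) = vtype Cs v"
    and "inj_on \<rho> (occ M)"
  shows "has_ty sig Cs' m (ren \<rho> M) A"
proof -
  have ty: "in_scope (Bs @ Cs') (under (length Bs) \<rho> v) \<and>
      vtype (Bs @ Cs') (under (length Bs) \<rho> v) = vtype (Bs @ Cs) v"
    if "v \<in> V" "in_scope (Bs @ Cs) v"
      and "\<And>v. v \<in> unshift (length Bs) V \<Longrightarrow> in_scope Cs v \<Longrightarrow> in_scope Cs' (\<rho> v) \<and> vtype Cs' (\<rho> v) = vtype Cs v"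
    for Bs Cs Cs' \<rho> and v :: "'b var" and V
    using that
  proof (cases v rule: var_split_cases[of _ "length Bs"])
    case (bound i)
    then show ?thesis by (simp add: nth_append)
  next
    case (lifted w)
    with that show ?thesis by (auto simp: unshift_def)
  qed
  have pat: "pattern (Bs @ Cs') (map (under (length Bs) \<rho>) ys) As"
    if "pattern (Bs @ Cs) ys As" "inj_on \<rho> (unshift (length Bs) (set ys))"
      and "\<And>v. v \<in> unshift (length Bs) (set ys) \<Longrightarrow> in_scope Cs v \<Longrightarrow> in_scope Cs' (\<rho> v) \<and> vtype Cs' (\<rho> v) = vtype Cs v"
    for Bs Cs Cs' \<rho> and ys :: "'b var list" and As
    using that(1) ty[of _ "set ys", OF _ _ that(3)] inj_on_under[OF that(2)]
    by (auto simp: pattern_def distinct_map)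
  show ?thesis
    using assms
  proof (induction M arbitrary: Cs Cs' m A \<rho>)
    case (Rigid Bs h Ns)
    let ?V = "hvars h \<union> (\<Union>N \<in> set Ns. occ N)"
    note t = ty[of _ ?V, OF _ _ Rigid.prems(2)]
    have inj: "inj_on (under (length Bs) \<rho>) ?V"
      using inj_on_under[of \<rho> "length Bs" ?V] Rigid.prems(3) by simp
    have h: "head_in_scope (Bs @ Cs') (ren_head (under (length Bs) \<rho>) h) \<and>
      head_ty sig (Bs @ Cs') (ren_head (under (length Bs) \<rho>) h) = head_ty sig (Bs @ Cs) h"
      using Rigid.prems(1) t by (cases h) (auto simp: has_ty_iff)
    have "has_ty sig (Bs @ Cs') Rec (ren (under (length Bs) \<rho>) (Ns ! i))
        (arg_tys (head_ty sig (Bs @ Cs) h) ! i)" if "i < length Ns" for i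
    proof (rule Rigid.IH)
      show "Ns ! i \<in> set Ns" using that by simp
      show "has_ty sig (Bs @ Cs) Rec (Ns ! i) (arg_tys (head_ty sig (Bs @ Cs) h) ! i)"
        using Rigid.prems(1) that by (auto simp: has_ty_iff list_all2_conv_all_nth)
      show "inj_on (under (length Bs) \<rho>) (occ (Ns ! i))"
        using inj that by (auto elim!: inj_on_subset)
      show "in_scope (Bs @ Cs') (under (length Bs) \<rho> v) \<and>
        vtype (Bs @ Cs') (under (length Bs) \<rho> v) = vtype (Bs @ Cs) v"
        if "v \<in> occ (Ns ! i)" "in_scope (Bs @ Cs) v" for v
        using that \<open>i < length Ns\<close> by (intro t) auto
    qed
    with h Rigid.prems(1) show ?case by (auto simp: has_ty_iff list_all2_conv_all_nth)
  next
    case (Meta Bs H ys)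
    then show ?case using pat[of Bs Cs ys _ \<rho> Cs'] by (simp add: has_ty_iff)
  next
    case (Recur Bs r ys)
    then show ?case using pat[of Bs Cs ys _ \<rho> Cs'] by (simp add: has_ty_iff)
  qed
qed

lemma has_ty_with_binders:
  "has_ty sig Cs m (with_binders Bs M) A \<longleftrightarrow>
     has_ty sig (Bs @ Cs) m (with_binders [] M) (Base (target A)) \<and> A = arrows Bs (target A)"
  by (cases M) (auto simp: has_ty_iff)

lemma has_ty_body:
  assumes "has_ty sig Cs m M A"
  shows "has_ty sig (binders M @ Cs) m (with_binders [] M) (Base (target A))"
  using has_ty_with_binders[of sig Cs m "binders M" M A] assms by simp

lemma has_ty_eta: "has_ty sig Cs (mtag H) (eta H) (mty H)"
proof -
  have "map (vtype (As @ Cs) \<circ> Bnd) [0..<length As] = As" for As :: "'b ty list"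
    by (rule nth_equalityI) (auto simp: nth_append)
  then show ?thesis by (auto simp: eta_def has_ty_iff pattern_def distinct_map inj_on_def)
qed

lemma FV_eta [simp]: "FV (eta H) = {}"
  by (auto simp: eta_def)

lemma has_ty_open:
  assumes "has_ty sig [] m T A" "FV T = {}" "pattern Cs ys (arg_tys A)"
  shows "has_ty sig Cs m (open_tm ys T) (Base (target A))"
proof -
  have cl: "closed_tm (length ys) T"
    using has_ty_closed[OF assms(1,2)] assms(3) by (simp add: pattern_length)
  have ys: "distinct ys" "\<And>y. y \<in> set ys \<Longrightarrow> in_scope Cs y" "map (vtype Cs) ys = arg_tys A"
    using assms(3) by (auto simp: pattern_def)
  have "has_ty sig (arg_tys A @ []) m (with_binders [] T) (Base (target A))"
    using has_ty_body[OF assms(1)] has_ty_binders[OF assms(1)] by simp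
  then show ?thesis
    unfolding open_tm_opn
  proof (rule has_ty_ren)
    fix v assume "v \<in> occ (with_binders [] T)"
    then obtain i where "v = Bnd i" "i < length ys" using closed_body[OF cl] by metis
    with ys show "in_scope Cs (opn ys v) \<and> vtype Cs (opn ys v) = vtype (arg_tys A @ []) v"
      by (auto simp flip: ys(3))
  next
    show "inj_on (opn ys) (occ (with_binders [] T))"
    proof (rule inj_onI)
      fix v w assume *: "v \<in> occ (with_binders [] T)" "w \<in> occ (with_binders [] T)" "opn ys v = opn ys w"
      from closed_body[OF cl *(1)] closed_body[OF cl *(2)] *(3) ys(1) show "v = w"
        by (metis nth_eq_iff_index_eq opn_Bnd)
    qed
  qed
qed

text \<open>\<open>\<lambda>ws. A\<close> for named variables \<open>ws\<close>\<close>

definition close_tm :: "'b var list \<Rightarrow> ('b, 'c) tm \<Rightarrow> ('b, 'c) tm" where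
  "close_tm ws A = with_binders (map (vtype []) ws) (ren (rn (map Bnd [0..<length ws]) ws) A)"

text \<open>Each variable of \<open>A\<close> is some \<open>ws ! i\<close>, which abstraction sends
  to \<open>Bnd i\<close>. On \<open>occ A\<close> this map is injective, hence preserves typing,
  and opening undoes it.\<close>

lemma
  assumes "has_ty sig [] m A (Base b)" "distinct ws" "FV A \<subseteq> set ws"
  shows has_ty_close_tm: "has_ty sig [] m (close_tm ws A) (arrows (map (vtype []) ws) b)"
    and FV_close_tm: "FV (close_tm ws A) = {}"
    and open_close_tm: "length ys = length ws \<Longrightarrow> open_tm ys (close_tm ws A) = rename ys ws A"
    and open_close_tm_self: "open_tm ws (close_tm ws A) = A"
proof -
  let ?\<rho> = "rn (map Bnd [0..<length ws]) ws"
  have b: "binders A = []" using has_ty_binders[OF assms(1)] by simp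
  have wb: "with_binders [] A = A" using with_binders_binders[of A] b by simp
  have wb': "with_binders [] (ren \<rho> A) = ren \<rho> A" for \<rho> using with_binders_binders[of "ren \<rho> A"] b by simp
  have occ: "occ A \<subseteq> set ws" using has_ty_occ_FV[OF assms(1)] assms(3) by simp
  have \<rho>: "\<exists>i < length ws. v = ws ! i \<and> ?\<rho> v = Bnd i" if "v \<in> occ A" for v
  proof -
    from that occ obtain i where i: "i < length ws" "v = ws ! i"
      by (metis in_set_conv_nth subsetD)
    then have "?\<rho> v = map Bnd [0..<length ws] ! i"
      by (simp only: i(2)) (rule rn_nth, use assms(2) i in auto)
    with i show ?thesis by auto
  qed
  have "has_ty sig (map (vtype []) ws) m (ren ?\<rho> A) (Base b)"
  proof (rule has_ty_ren[OF assms(1)])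
    show "inj_on ?\<rho> (occ A)"
      using \<rho> by (intro inj_onI) (metis var.inject(1))
    fix v assume "v \<in> occ A" "in_scope [] v"
    with \<rho>[OF this(1)] show "in_scope (map (vtype []) ws) (?\<rho> v) \<and>
        vtype (map (vtype []) ws) (?\<rho> v) = vtype [] v" by auto
  qed
  then show ty: "has_ty sig [] m (close_tm ws A) (arrows (map (vtype []) ws) b)"
    by (simp add: close_tm_def has_ty_with_binders wb')
  have "occ (close_tm ws A) = unshift (length ws) (?\<rho> ` occ A)"
    by (subst occ_with_binders) (simp add: close_tm_def wb' occ_ren)
  also have "\<dots> = {}"
  proof -
    have "lift_var (length ws) v \<notin> ?\<rho> ` occ A" for v using \<rho> by force
    then show ?thesis by (auto simp: unshift_def)
  qed
  finally show "FV (close_tm ws A) = {}" using has_ty_occ_FV[OF ty] by simp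
  show op: "open_tm ys (close_tm ws A) = rename ys ws A" if "length ys = length ws" for ys
    unfolding close_tm_def open_tm_opn with_binders_with_binders wb' ren_ren rename_rn
  proof (rule ren_cong)
    fix v assume "v \<in> occ A"
    with \<rho> obtain i where i: "i < length ws" "v = ws ! i" "?\<rho> v = Bnd i" by blast
    with that assms(2) show "(opn ys \<circ> ?\<rho>) v = rn ys ws v" by (simp add: rn_nth)
  qed
  have "rn ws ws v = v" if "v \<in> occ A" for v
    using that occ assms(2) rn_nth[of ws ws] by (metis in_set_conv_nth subsetD)
  then have "rename ws ws A = A" unfolding rename_rn by (rule ren_idI)
  with op[of ws] show "open_tm ws (close_tm ws A) = A" by simp
qed

section \<open>Substitutions\<close>

text \<open>What \<open>wf_ctx\<close> says about the definitions alone; a substitution can be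
  rebuilt over any such set (\<open>realize\<close>).\<close>

definition wf_defs :: "('c \<Rightarrow> 'b ty) \<Rightarrow> ('b, 'c) dfn set \<Rightarrow> bool" where
  "wf_defs sig D \<longleftrightarrow> finite D \<and> single_valued D \<and>
     (\<forall>(r, U) \<in> D. has_ty sig [] Con U (rty r) \<and> FV U = {} \<and> rconsts U \<subseteq> Domain D)"

lemma wf_ctx_defs:
  assumes "wf_ctx sig \<Delta>" shows "wf_defs sig (defs \<Delta>)"
proof -
  have "rconsts U \<subseteq> Domain (defs \<Delta>)" if "(r, U) \<in> defs \<Delta>" for r U
  proof -
    have "rconsts U \<subseteq> ctx_rconsts \<Delta>"
      unfolding ctx_rconsts_def by (rule le_supI2, rule order_trans[OF _ UN_upper[OF that]]) auto
    with assms show ?thesis by (auto simp: wf_ctx_def)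
  qed
  with assms show ?thesis unfolding wf_ctx_def wf_defs_def by blast
qed

lemma wf_defsD:
  assumes "wf_defs sig D" "(r, U) \<in> D"
  shows "has_ty sig [] Con U (rty r)" "FV U = {}" "rconsts U \<subseteq> Domain D"
  using assms unfolding wf_defs_def by blast+

lemma wf_defs_ok:
  assumes "wf_defs sig D" shows "defs_ok D"
  unfolding defs_ok_def
proof (intro conjI ballI)
  show "single_valued D" using assms by (simp add: wf_defs_def)
  fix d assume "d \<in> D"
  moreover obtain r U where d: "d = (r, U)" by (cases d)
  ultimately have "has_ty sig [] Con U (rty r)" "FV U = {}" using wf_defsD[OF assms] by auto
  then show "case d of (r, U) \<Rightarrow> sort_of U = Con \<and> closed_tm (length (arg_tys (rty r))) U \<and> arities_ok U"
    using d by (auto simp: has_ty_sort has_ty_arities_ok has_ty_closed)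
qed

lemma wf_ctx_defs_ok: "wf_ctx sig \<Delta> \<Longrightarrow> defs_ok (defs \<Delta>)"
  by (rule wf_defs_ok[OF wf_ctx_defs])

lemma is_subst_defs_ok: "is_subst sig \<Gamma> \<Longrightarrow> defs_ok (defs \<Gamma>)"
  by (auto simp: is_subst_def intro: wf_ctx_defs_ok)

section \<open>Images of metavariables as closed terms\<close>

lemma is_subst_eqD:
  assumes "is_subst sig \<Gamma>" "(Meta [] H zs, M) \<in> eqs \<Gamma>"
  shows "image_of \<Gamma> H = Some (zs, M)" "H \<in> sdom \<Gamma>"
    "pattern [] zs (arg_tys (mty H))" "has_ty sig [] (mtag H) M (Base (target (mty H)))"
    "FV M \<subseteq> set zs" "binders M = []" "rconsts M \<subseteq> Domain (defs \<Gamma>)"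
proof -
  show "H \<in> sdom \<Gamma>" using assms(2) by (auto simp: sdom_def)
  have "(THE (zs, M). (Meta [] H zs, M) \<in> eqs \<Gamma>) = (zs, M)"
  proof (rule the_equality)
    show "case (zs, M) of (zs, M) \<Rightarrow> (Meta [] H zs, M) \<in> eqs \<Gamma>" using assms(2) by simp
    fix p assume "case p of (zs, M) \<Rightarrow> (Meta [] H zs, M) \<in> eqs \<Gamma>"
    then obtain zs' M' where "p = (zs', M')" "(Meta [] H zs', M') \<in> eqs \<Gamma>" by (cases p) auto
    with assms show "p = (zs, M)" unfolding is_subst_def by blast
  qed
  with \<open>H \<in> sdom \<Gamma>\<close> show "image_of \<Gamma> H = Some (zs, M)" by (simp add: image_of_def)
  have *: "(Meta [] H zs, M) \<in> eqs \<Gamma>" "wf_ctx sig \<Gamma>" using assms by (auto simp: is_subst_def)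
  then obtain m A where "has_ty sig [] m (Meta [] H zs) A" "has_ty sig [] m M A"
    by (fastforce simp: wf_ctx_def)
  then show "pattern [] zs (arg_tys (mty H))" "has_ty sig [] (mtag H) M (Base (target (mty H)))"
    by (auto simp: has_ty_iff)
  have "\<forall>(L, M) \<in> eqs \<Gamma>. \<exists>H xs. L = Meta [] H xs \<and> FV M \<subseteq> set xs \<and> binders M = []"
    using assms(1) by (simp add: is_subst_def)
  from bspec[OF this *(1)] show "FV M \<subseteq> set zs" "binders M = []" by auto
  have "rconsts M \<subseteq> ctx_rconsts \<Gamma>"
    unfolding ctx_rconsts_def
    by (rule le_supI1, rule order_trans[OF _ UN_upper[OF *(1)]]) simp
  with *(2) show "rconsts M \<subseteq> Domain (defs \<Gamma>)" by (auto simp: wf_ctx_def)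
qed

lemma sdomE:
  assumes "H \<in> sdom \<Gamma>" obtains zs M where "(Meta [] H zs, M) \<in> eqs \<Gamma>"
  using assms by (auto simp: sdom_def)

lemma image_of_None: "H \<notin> sdom \<Gamma> \<Longrightarrow> image_of \<Gamma> H = None"
  by (simp add: image_of_def)

lemma subst_eta_None: "H \<notin> sdom \<Gamma> \<Longrightarrow> subst \<Gamma> (eta H) = eta H"
  by (simp add: eta_def image_of_None)

lemma subst_eta_close:
  assumes "is_subst sig \<Gamma>" "(Meta [] H zs, M) \<in> eqs \<Gamma>"
  shows "subst \<Gamma> (eta H) = close_tm zs M"
  using is_subst_eqD[OF assms]
  by (simp add: eta_def close_tm_def rename_rn pattern_def) (metis length_map)

lemma mvars_rconsts_simps [simp]:
  "mvars (ren \<rho> N) = mvars N" "rconsts (ren \<rho> N) = rconsts N"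
  "mvars (with_binders Bs N) = mvars N" "rconsts (with_binders Bs N) = rconsts N"
  "mvars (open_tm ys N) = mvars N" "rconsts (open_tm ys N) = rconsts N"
  "mvars (rename ys zs N) = mvars N" "rconsts (rename ys zs N) = rconsts N"
proof -
  show 1: "mvars (ren \<rho> N) = mvars N" "rconsts (ren \<rho> N) = rconsts N" for \<rho> and N :: "('a, 'b) tm"
    by (induction N arbitrary: \<rho>) auto
  show "mvars (with_binders Bs N) = mvars N" "rconsts (with_binders Bs N) = rconsts N"
    for Bs and N :: "('a, 'b) tm"
    by (cases N; simp)+
  with 1 show "mvars (open_tm ys N) = mvars N" "rconsts (open_tm ys N) = rconsts N"
    "mvars (rename ys zs N) = mvars N" "rconsts (rename ys zs N) = rconsts N"
    by (simp_all add: open_tm_opn rename_rn)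
qed

lemma rconsts_eta [simp]: "rconsts (eta H) = {}"
  by (simp add: eta_def)

text \<open>Outside the domain the image is \<open>eta H\<close> itself, so a substitution can be
  treated as a total family of closed terms of the right types.\<close>

lemma is_subst_image:
  assumes "is_subst sig \<Gamma>"
  shows "has_ty sig [] (mtag H) (subst \<Gamma> (eta H)) (mty H)" "FV (subst \<Gamma> (eta H)) = {}"
    "rconsts (subst \<Gamma> (eta H)) \<subseteq> Domain (defs \<Gamma>)"
proof -
  have "has_ty sig [] (mtag H) (subst \<Gamma> (eta H)) (mty H) \<and> FV (subst \<Gamma> (eta H)) = {} \<and>
    rconsts (subst \<Gamma> (eta H)) \<subseteq> Domain (defs \<Gamma>)"
  proof (cases "H \<in> sdom \<Gamma>")
    case True
    then obtain zs M where e: "(Meta [] H zs, M) \<in> eqs \<Gamma>" by (rule sdomE)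
    note i = is_subst_eqD[OF assms e]
    have d: "distinct zs" "map (vtype []) zs = arg_tys (mty H)" using i(3) by (auto simp: pattern_def)
    show ?thesis
      using has_ty_close_tm[OF i(4) d(1) i(5)] FV_close_tm[OF i(4) d(1) i(5)] d(2) i(7)
      by (simp add: subst_eta_close[OF assms e]) (simp add: close_tm_def)
  next
    case False
    then show ?thesis by (simp add: subst_eta_None has_ty_eta)
  qed
  then show "has_ty sig [] (mtag H) (subst \<Gamma> (eta H)) (mty H)" "FV (subst \<Gamma> (eta H)) = {}"
    "rconsts (subst \<Gamma> (eta H)) \<subseteq> Domain (defs \<Gamma>)" by auto
qed

text \<open>Renaming the parameters of a stored right-hand side is the same as opening its closure,
  so the choice of parameters in the equation for \<open>H\<close> becomes irrelevant.\<close>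

lemma subst_Meta:
  assumes "is_subst sig \<Gamma>" "length ys = length (arg_tys (mty H))"
  shows "subst \<Gamma> (Meta Bs H ys) = with_binders Bs (open_tm ys (subst \<Gamma> (eta H)))"
proof (cases "H \<in> sdom \<Gamma>")
  case True
  then obtain zs M where e: "(Meta [] H zs, M) \<in> eqs \<Gamma>" by (rule sdomE)
  note i = is_subst_eqD[OF assms(1) e]
  have d: "distinct zs" "length zs = length ys"
    using i(3) assms(2) by (auto simp: pattern_def dest: arg_cong[of _ _ length])
  show ?thesis
    using open_close_tm[OF i(4) d(1) i(5), of ys] i(1) d(2)
    by (simp add: subst_eta_close[OF assms(1) e])
next
  case False
  have "map (opn ys) (map Bnd [0..<length ys]) = ys" by (rule nth_equalityI) auto
  with assms(2) show ?thesis
    by (simp add: subst_eta_None[OF False] image_of_None[OF False]) (simp add: eta_def open_tm_opn)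
qed

text \<open>Equality of these functions is the second half of \<open>\<approx>\<close>
  (\<open>subst_eq_sem\<close>); it is the form in which \<open>eval\<close> consumes a
  substitution.\<close>

definition sem :: "('b, 'c) uctx \<Rightarrow> 'b mvar \<Rightarrow> nat \<Rightarrow> ('b, 'c) etm" where
  "sem \<Gamma> H k = expand (defs \<Gamma>) k (subst \<Gamma> (eta H))"

lemma sem_ok_sem:
  assumes "is_subst sig \<Gamma>" shows "sem_ok (sem \<Gamma>)"
  unfolding sem_ok_def sem_def
proof (intro allI conjI)
  fix H k
  note i = is_subst_image[OF assms, of H]
  show "closed_etm (length (arg_tys (mty H))) (expand (defs \<Gamma>) k (subst \<Gamma> (eta H)))"
    by (rule closed_expand[OF is_subst_defs_ok[OF assms] has_ty_arities_ok[OF i(1)] has_ty_closed[OF i(1,2)]])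
qed simp

text \<open>\<open>subst\<close> looks images up among equations. A total family of closed terms
  instead commutes with opening and absorbs the renaming of constants into the family
  (\<open>subst_ren_ctx\<close>).\<close>

fun sub :: "('b mvar \<Rightarrow> ('b, 'c) tm) \<Rightarrow> ('b, 'c) tm \<Rightarrow> ('b, 'c) tm" where
  "sub \<sigma> (Rigid Bs h Ns) = Rigid Bs h (map (sub \<sigma>) Ns)"
| "sub \<sigma> (Meta Bs H ys) = with_binders Bs (open_tm ys (\<sigma> H))"
| "sub \<sigma> (Recur Bs r ys) = Recur Bs r ys"

lemma sub_with_binders: "sub \<sigma> (with_binders Bs M) = with_binders Bs (sub \<sigma> M)"
  by (cases M) auto

lemma sub_ren:
  assumes "\<And>H. closed_tm (length (arg_tys (mty H))) (\<sigma> H)"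
  shows "arities_ok M \<Longrightarrow> sub \<sigma> (ren \<rho> M) = ren \<rho> (sub \<sigma> M)"
proof (induction M arbitrary: \<rho>)
  case (Meta Bs H ys)
  then have "closed_tm (length ys) (\<sigma> H)" using assms[of H] by simp
  then show ?case by (simp add: ren_with_binders_open)
qed auto

lemma sub_open:
  assumes "\<And>H. closed_tm (length (arg_tys (mty H))) (\<sigma> H)" "arities_ok M"
  shows "sub \<sigma> (open_tm ys M) = open_tm ys (sub \<sigma> M)"
  using assms by (simp add: open_tm_opn sub_ren sub_with_binders)

section \<open>Renaming recursion constants apart\<close>

lemma ren_rc_ren: "ren_rc f (ren \<rho> M) = ren \<rho> (ren_rc f M)"
  by (induction M arbitrary: \<rho>) auto

lemma ren_rc_with_binders: "ren_rc f (with_binders Bs M) = with_binders Bs (ren_rc f M)"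
  by (cases M) auto

lemma ren_rc_open: "ren_rc f (open_tm ys M) = open_tm ys (ren_rc f M)"
  by (simp add: open_tm_opn ren_rc_ren ren_rc_with_binders)

lemma ren_rc_rename: "ren_rc f (rename ys zs M) = rename ys zs (ren_rc f M)"
  by (simp add: rename_rn ren_rc_ren)

lemma occ_ren_rc [simp]: "occ (ren_rc f M) = occ M"
  by (induction M) auto

lemma binders_ren_rc [simp]: "binders (ren_rc f M) = binders M"
  by (cases M) auto

lemma sort_of_ren_rc [simp]: "sort_of (ren_rc f M) = sort_of M"
  by (cases M) auto

lemma closed_ren_rc [simp]: "closed_tm n (ren_rc f T) = closed_tm n T"
  by (simp add: closed_tm_def)

lemma arities_ok_ren_rc: "(\<And>r. rty (f r) = rty r) \<Longrightarrow> arities_ok (ren_rc f M) = arities_ok M"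
  by (induction M) auto

lemma sort_of_sub: "(\<And>H. sort_of (\<sigma> H) = mtag H) \<Longrightarrow> sort_of (sub \<sigma> M) = sort_of M"
  by (cases M) auto

lemma image_of_ren_ctx:
  assumes "is_subst sig \<Gamma>"
  shows "image_of (ren_ctx f \<Gamma>) H = map_option (\<lambda>(zs, M). (zs, ren_rc f M)) (image_of \<Gamma> H)"
proof (cases "H \<in> sdom \<Gamma>")
  case True
  then obtain zs M where e: "(Meta [] H zs, M) \<in> eqs \<Gamma>" by (rule sdomE)
  have e': "(Meta [] H zs, ren_rc f M) \<in> eqs (ren_ctx f \<Gamma>)"
    using e by (force simp: ren_ctx_def)
  have "(THE (zs, M). (Meta [] H zs, M) \<in> eqs (ren_ctx f \<Gamma>)) = (zs, ren_rc f M)"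
  proof (rule the_equality)
    show "case (zs, ren_rc f M) of (zs, M) \<Rightarrow> (Meta [] H zs, M) \<in> eqs (ren_ctx f \<Gamma>)" using e' by simp
    fix p assume "case p of (zs, M) \<Rightarrow> (Meta [] H zs, M) \<in> eqs (ren_ctx f \<Gamma>)"
    then obtain zs' M' where p: "p = (zs', M')" "(Meta [] H zs', M') \<in> eqs (ren_ctx f \<Gamma>)"
      by (cases p) auto
    then obtain L M'' where "(L, M'') \<in> eqs \<Gamma>" "ren_rc f L = Meta [] H zs'" "M' = ren_rc f M''"
      by (force simp: ren_ctx_def)
    moreover from this have "L = Meta [] H zs'" by (cases L) auto
    ultimately have "(Meta [] H zs', M'') \<in> eqs \<Gamma>" "M' = ren_rc f M''" by auto
    with is_subst_eqD(1)[OF assms e] is_subst_eqD(1)[OF assms, of H zs' M''] p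
    show "p = (zs, ren_rc f M)" by simp
  qed
  moreover have "H \<in> sdom (ren_ctx f \<Gamma>)" using e' by (auto simp: sdom_def)
  ultimately show ?thesis using is_subst_eqD(1)[OF assms e] by (simp add: image_of_def)
next
  case False
  have "H \<notin> sdom (ren_ctx f \<Gamma>)"
  proof
    assume "H \<in> sdom (ren_ctx f \<Gamma>)"
    then obtain zs M where "(Meta [] H zs, M) \<in> eqs (ren_ctx f \<Gamma>)" by (rule sdomE)
    then obtain L M'' where "(L, M'') \<in> eqs \<Gamma>" "ren_rc f L = Meta [] H zs"
      by (force simp: ren_ctx_def)
    moreover from this have "L = Meta [] H zs" by (cases L) auto
    ultimately show False using False by (auto simp: sdom_def)
  qed
  with False show ?thesis by (simp add: image_of_None)
qed

lemma subst_ren_ctx: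
  assumes "is_subst sig \<Gamma>"
  shows "arities_ok M \<Longrightarrow> subst (ren_ctx f \<Gamma>) M = sub (\<lambda>H. ren_rc f (subst \<Gamma> (eta H))) M"
proof (induction M)
  case (Meta Bs H ys)
  have "subst (ren_ctx f \<Gamma>) (Meta Bs H ys) = ren_rc f (subst \<Gamma> (Meta Bs H ys))"
    by (simp add: image_of_ren_ctx[OF assms] ren_rc_with_binders ren_rc_rename split: option.split)
  with Meta show ?case
    by (simp add: subst_Meta[OF assms] ren_rc_with_binders ren_rc_open del: subst.simps)
qed auto

lemma rc_neq [simp]: "ctx_rc r \<noteq> sub_rc s" "sub_rc s \<noteq> ctx_rc r"
  by (auto simp: ctx_rc_def sub_rc_def) presburger+

lemma rc_inj [simp]: "ctx_rc r = ctx_rc s \<longleftrightarrow> r = s" "sub_rc r = sub_rc s \<longleftrightarrow> r = s"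
  by (cases r; cases s; simp add: ctx_rc_def sub_rc_def)+

lemma rty_rc [simp]: "rty (ctx_rc r) = rty r" "rty (sub_rc r) = rty r"
  by (auto simp: ctx_rc_def sub_rc_def)

text \<open>Expansions contain no recursion constants, so a renaming that carries definitions along
  leaves no trace in them.\<close>

lemma expand_ren_rc:
  assumes "\<And>r. def_of D' (f r) = map_option (ren_rc f) (def_of D r)"
  shows "expand D' k (ren_rc f M) = expand D k M"
proof (induction k arbitrary: M)
  case (Suc k)
  have "unfold D' (ren_rc f M) = ren_rc f (unfold D M)"
    using assms by (cases M) (auto simp: ren_rc_with_binders ren_rc_open split: option.split)
  with Suc.IH show ?case by (cases "unfold D M") simp_all
qed simp

text \<open>The bridge from the literal \<open>app_ctx\<close> to \<open>eval\<close>. Even and odd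
  names keep the two sets of definitions disjoint: below an instantiated metavariable only
  definitions of \<open>\<Gamma>\<close> are unfolded, elsewhere only those of
  \<open>\<Delta>\<close>, which is how \<open>eval\<close> divides the work.\<close>

lemma expand_app_ctx:
  assumes "defs_ok (defs \<Delta>)" "is_subst sig \<Gamma>" "arities_ok M"
  shows "expand (app_defs \<Delta> \<Gamma>) k (subst (ren_ctx sub_rc \<Gamma>) (ren_rc ctx_rc M)) =
    eval (defs \<Delta>) (sem \<Gamma>) k M"
proof -
  define \<sigma> where "\<sigma> = (\<lambda>H. ren_rc sub_rc (subst \<Gamma> (eta H)))"
  note img = is_subst_image[OF assms(2)]
  have cl: "closed_tm (length (arg_tys (mty H))) (subst \<Gamma> (eta H))" for H
    by (rule has_ty_closed[OF img(1,2)])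
  then have cl\<sigma>: "closed_tm (length (arg_tys (mty H))) (\<sigma> H)" for H by (simp add: \<sigma>_def)
  have sort\<sigma>: "sort_of (\<sigma> H) = mtag H" for H
    using has_ty_sort[OF img(1), of H] by (simp add: \<sigma>_def)
  have sv\<Delta>: "single_valued (defs \<Delta>)" using assms(1) by (simp add: defs_ok_def)
  have sv\<Gamma>: "single_valued (defs \<Gamma>)" using is_subst_defs_ok[OF assms(2)] by (simp add: defs_ok_def)
  let ?D = "app_defs \<Delta> \<Gamma>"
  have wac: "arities_ok (ren_rc ctx_rc N) = arities_ok N" for N :: "('a, 'b) tm" by (rule arities_ok_ren_rc) simp
  have sb: "subst (ren_ctx sub_rc \<Gamma>) (ren_rc ctx_rc N) = sub \<sigma> (ren_rc ctx_rc N)" if "arities_ok N" for N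
    unfolding \<sigma>_def using that by (intro subst_ren_ctx[OF assms(2)]) (simp add: wac)
  have D: "?D = {(ctx_rc r, sub \<sigma> (ren_rc ctx_rc U)) |r U. (r, U) \<in> defs \<Delta>} \<union>
      {(sub_rc r, ren_rc sub_rc U) |r U. (r, U) \<in> defs \<Gamma>}"
  proof -
    have "(\<lambda>(r, U). (r, subst (ren_ctx sub_rc \<Gamma>) U)) ` defs (ren_ctx ctx_rc \<Delta>) =
        (\<lambda>(r, U). (ctx_rc r, sub \<sigma> (ren_rc ctx_rc U))) ` defs \<Delta>"
      unfolding ren_ctx_def[of ctx_rc] using defs_okD(3)[OF assms(1)] sb by (auto simp: image_image intro!: image_cong)
    then show ?thesis unfolding app_defs_def by (auto simp: ren_ctx_def)
  qed
  have sv: "single_valued ?D"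
    using sv\<Delta> sv\<Gamma> unfolding D
    by (auto simp: single_valued_def intro: arg_cong[where f = "\<lambda>U. sub \<sigma> (ren_rc ctx_rc U)"]
        arg_cong[where f = "ren_rc sub_rc"])
  have dS: "def_of ?D (sub_rc r) = map_option (ren_rc sub_rc) (def_of (defs \<Gamma>) r)" for r
  proof (cases rule: def_of_cases[OF sv\<Gamma>, where r = r, case_names Some None])
    case (Some U)
    then have "(sub_rc r, ren_rc sub_rc U) \<in> ?D" unfolding D by blast
    with Some show ?thesis by (simp add: def_of_eq[OF sv])
  next
    case None
    then have "sub_rc r \<notin> Domain ?D" unfolding D by auto
    with None show ?thesis by (simp add: def_of_None)
  qed
  have "expand ?D k (sub \<sigma> (ren_rc ctx_rc M)) = eval (defs \<Delta>) (sem \<Gamma>) k M"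
    using assms(3)
  proof (induction k arbitrary: M)
    case (Suc k)
    \<comment> \<open>Terms with an exposed head are treated first: the \<open>Recur\<close> case
      appeals to them at the same depth \<open>Suc k\<close> after one unfolding, where the
      induction hypothesis does not reach.\<close>
    have contr: "expand ?D (Suc k) (sub \<sigma> (ren_rc ctx_rc N)) = eval (defs \<Delta>) (sem \<Gamma>) (Suc k) N"
      if "arities_ok N" "\<And>Bs r ys. N \<noteq> Recur Bs r ys" for N
    proof (cases N)
      case (Rigid Bs h Ns)
      with Suc.IH that show ?thesis by simp
    next
      case (Meta Bs H ys)
      have "expand ?D (Suc k) (sub \<sigma> (ren_rc ctx_rc N)) =
          expand ?D (Suc k) (ren_rc sub_rc (with_binders Bs (open_tm ys (subst \<Gamma> (eta H)))))"
        by (simp only: Meta ren_rc.simps sub.simps \<sigma>_def ren_rc_with_binders ren_rc_open)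
      also have "\<dots> = expand (defs \<Gamma>) (Suc k) (with_binders Bs (open_tm ys (subst \<Gamma> (eta H))))"
        by (rule expand_ren_rc[OF dS])
      also have "\<dots> = ewith Bs (eopen ys (sem \<Gamma> H (Suc k)))"
        unfolding sem_def
        by (rule expand_open(1)[OF is_subst_defs_ok[OF assms(2)] has_ty_arities_ok[OF img(1)]])
      finally show ?thesis using Meta by simp
    qed (use that in auto)
    show ?case
    proof (cases M)
      case (Recur Bs r ys)
      show ?thesis
      proof (cases rule: def_of_cases[OF sv\<Delta>, where r = r, case_names Some None])
        case (Some U)
        note d = defs_okD[OF assms(1) Some(1)]
        let ?N = "with_binders Bs (open_tm ys U)"
        have "(ctx_rc r, sub \<sigma> (ren_rc ctx_rc U)) \<in> ?D" using Some unfolding D by blast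
        then have "expand ?D (Suc k) (sub \<sigma> (ren_rc ctx_rc M)) =
            expand ?D (Suc k) (with_binders Bs (open_tm ys (sub \<sigma> (ren_rc ctx_rc U))))"
          using expand_eqs(4)[OF sv, of "ctx_rc r"] d(1) by (simp add: Recur sort_of_sub[OF sort\<sigma>] del: expand.simps)
        also have "\<dots> = expand ?D (Suc k) (sub \<sigma> (ren_rc ctx_rc ?N))"
          using d(3) by (simp only: ren_rc_with_binders ren_rc_open sub_with_binders sub_open[OF cl\<sigma>] wac)
        also have "\<dots> = eval (defs \<Delta>) (sem \<Gamma>) (Suc k) ?N"
        proof (rule contr)
          show "arities_ok ?N" using d(3) by simp
          have "sort_of ?N = Con" using d(1) by simp
          then show "?N \<noteq> Recur Bs' r' ys'" for Bs' r' ys' by (metis sort_of.simps(3) tag.distinct(1))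
        qed
        also have "\<dots> = eval (defs \<Delta>) (sem \<Gamma>) (Suc k) M"
          unfolding Recur by (rule eval_Recur[OF assms(1) Some(1), symmetric])
        finally show ?thesis .
      next
        case None
        then have "ctx_rc r \<notin> Domain ?D" unfolding D by auto
        with None Recur show ?thesis by (simp add: def_of_None)
      qed
    qed (rule contr[OF Suc.prems], simp)+
  qed simp
  with sb[OF assms(3)] show ?thesis by simp
qed

text \<open>Phrased with \<open>defs_ok\<close> and \<open>arities_ok\<close> in place of
  \<open>wf_ctx\<close> so that it also applies to the context produced by a rule.\<close>

lemma unifier_iff:
  assumes "defs_ok (defs \<Delta>)" "\<And>M M'. (M, M') \<in> eqs \<Delta> \<Longrightarrow> arities_ok M \<and> arities_ok M'"
  shows "unifier sig \<Delta> \<Gamma> \<longleftrightarrow> \<not> contra \<Delta> \<and> is_subst sig \<Gamma> \<and> sdom \<Gamma> = UV \<Delta> \<and>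
    (\<forall>(M, M') \<in> eqs \<Delta>. \<forall>k. eval (defs \<Delta>) (sem \<Gamma>) k M = eval (defs \<Delta>) (sem \<Gamma>) k M')"
proof -
  have "(\<forall>e \<in> eqs (app_ctx \<Delta> \<Gamma>). holds (defs (app_ctx \<Delta> \<Gamma>)) e) \<longleftrightarrow>
    (\<forall>(M, M') \<in> eqs \<Delta>. \<forall>k. eval (defs \<Delta>) (sem \<Gamma>) k M = eval (defs \<Delta>) (sem \<Gamma>) k M')"
    if s: "is_subst sig \<Gamma>"
  proof -
    note e = expand_app_ctx[OF assms(1) s]
    show ?thesis
      unfolding app_ctx_def holds_def ren_ctx_def[of ctx_rc]
      using assms(2) by (fastforce simp: e)
  qed
  then show ?thesis unfolding unifier_def by blast
qed

section \<open>Equivalence and restriction of substitutions\<close>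

lemma subst_eq_sem: "\<Gamma> \<approx> \<Gamma>' \<longleftrightarrow> sdom \<Gamma> = sdom \<Gamma>' \<and> sem \<Gamma> = sem \<Gamma>'"
  by (auto simp: subst_eq_def sem_def fun_eq_iff)

lemma sdom_restrict [simp]: "sdom (restrict S \<Gamma>) = sdom \<Gamma> \<inter> S"
  by (auto simp: sdom_def restrict_def)

lemma sem_notin: "H \<notin> sdom \<Gamma> \<Longrightarrow> sem \<Gamma> H k = expand {} k (eta H)"
  unfolding sem_def subst_eta_None by (cases k) (simp_all add: eta_def)

lemma sem_restrict: "sem (restrict S \<Gamma>) H k = (if H \<in> S then sem \<Gamma> H k else expand {} k (eta H))"
proof (cases "H \<in> S")
  case True
  then have "image_of (restrict S \<Gamma>) H = image_of \<Gamma> H"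
    by (auto simp: image_of_def restrict_def sdom_def)
  then have "subst (restrict S \<Gamma>) (eta H) = subst \<Gamma> (eta H)" by (simp add: eta_def)
  with True show ?thesis by (simp add: sem_def restrict_def)
qed (simp add: sem_notin)

lemma is_subst_restrict:
  assumes "is_subst sig \<Gamma>" shows "is_subst sig (restrict S \<Gamma>)"
proof -
  have sub: "eqs (restrict S \<Gamma>) \<subseteq> eqs \<Gamma>" and [simp]: "defs (restrict S \<Gamma>) = defs \<Gamma>"
    by (auto simp: restrict_def)
  have "ctx_rconsts (restrict S \<Gamma>) \<subseteq> ctx_rconsts \<Gamma>"
    unfolding ctx_rconsts_def using sub by (intro Un_mono UN_mono) simp_all
  moreover have "wf_ctx sig \<Gamma>" using assms by (simp add: is_subst_def)
  ultimately have wf: "wf_ctx sig (restrict S \<Gamma>)"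
    unfolding wf_ctx_def using sub finite_subset[OF sub] by (simp, meson subset_trans subset_eq)
  show ?thesis
    unfolding is_subst_def
  proof (intro conjI)
    show "wf_ctx sig (restrict S \<Gamma>)" by (rule wf)
    show "\<not> contra (restrict S \<Gamma>)" using assms by (simp add: is_subst_def restrict_def)
    have "\<forall>(L, M) \<in> eqs \<Gamma>. \<exists>H xs. L = Meta [] H xs \<and> FV M \<subseteq> set xs \<and> binders M = []"
      using assms by (simp add: is_subst_def)
    with sub show "\<forall>(L, M) \<in> eqs (restrict S \<Gamma>). \<exists>H xs. L = Meta [] H xs \<and> FV M \<subseteq> set xs \<and> binders M = []"
      by (meson subset_eq)
    show "\<forall>H xs M xs' M'. (Meta [] H xs, M) \<in> eqs (restrict S \<Gamma>) \<and>
        (Meta [] H xs', M') \<in> eqs (restrict S \<Gamma>) \<longrightarrow> xs = xs' \<and> M = M'"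
      using is_subst_eqD(1)[OF assms] sub by (metis option.inject prod.inject subsetD)
  qed
qed

lemma occ_open:
  assumes "closed_tm (length ys) T" shows "occ (open_tm ys T) \<subseteq> set ys"
  unfolding open_tm_opn occ_ren by (auto elim!: closed_body[OF assms])

section \<open>Substitutions built from closed terms\<close>

definition nvars :: "'b ty list \<Rightarrow> 'b var list" where
  "nvars As = map (\<lambda>i. Free i (As ! i)) [0..<length As]"

lemma pattern_nvars: "pattern [] (nvars As) As"
  by (auto simp: pattern_def nvars_def distinct_map inj_on_def intro: nth_equalityI)

lemma close_open_tm:
  assumes "closed_tm (length zs) T" "distinct zs" "map (vtype []) zs = binders T"
  shows "close_tm zs (open_tm zs T) = T"
proof -
  let ?\<rho> = "rn (map Bnd [0..<length zs]) zs"
  have "ren ?\<rho> (open_tm zs T) = with_binders [] T"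
    unfolding open_tm_opn ren_ren
  proof (rule ren_idI)
    fix v assume "v \<in> occ (with_binders [] T)"
    then obtain i where i: "v = Bnd i" "i < length zs" using closed_body[OF assms(1)] by metis
    then have "?\<rho> (zs ! i) = map Bnd [0..<length zs] ! i" by (intro rn_nth) (use assms(2) in auto)
    with i show "(?\<rho> \<circ> opn zs) v = v" by simp
  qed
  with assms(3) show ?thesis by (simp add: close_tm_def)
qed

text \<open>The equation for \<open>H\<close> has canonical named parameters on the left and
  \<open>\<sigma> H\<close> opened at them on the right; closing again recovers
  \<open>\<sigma> H\<close> exactly. All later substitutions are obtained this way.\<close>

lemma realize:
  assumes "finite S" "wf_defs sig D"
    and \<sigma>: "\<And>H. H \<in> S \<Longrightarrow>
      has_ty sig [] (mtag H) (\<sigma> H) (mty H) \<and> FV (\<sigma> H) = {} \<and> rconsts (\<sigma> H) \<subseteq> Domain D"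
  shows "\<exists>\<Gamma>. is_subst sig \<Gamma> \<and> sdom \<Gamma> = S \<and> defs \<Gamma> = D \<and>
    (\<forall>H. subst \<Gamma> (eta H) = (if H \<in> S then \<sigma> H else eta H))"
proof -
  let ?zs = "\<lambda>H. nvars (arg_tys (mty H))"
  let ?M = "\<lambda>H. open_tm (?zs H) (\<sigma> H)"
  define \<Gamma> where "\<Gamma> = \<lparr>eqs = (\<lambda>H. (Meta [] H (?zs H), ?M H)) ` S, defs = D, contra = False\<rparr>"
  note pat = pattern_nvars
  have len: "length (nvars As) = length As" for As :: "'a ty list" by (simp add: nvars_def)
  have cl: "closed_tm (length (?zs H)) (\<sigma> H)" if "H \<in> S" for H
    using \<sigma>[OF that] by (auto simp: len intro: has_ty_closed)
  have ty: "has_ty sig [] (mtag H) (?M H) (Base (target (mty H)))" if "H \<in> S" for H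
    using \<sigma>[OF that] pat by (intro has_ty_open) auto
  have FV: "FV (?M H) \<subseteq> set (?zs H)" if "H \<in> S" for H
    using occ_open[OF cl[OF that]] has_ty_occ_FV[OF ty[OF that]] by simp
  have "wf_ctx sig \<Gamma>"
    unfolding wf_ctx_def
  proof (intro conjI)
    show "finite (eqs \<Gamma>)" "finite (defs \<Gamma>)" "single_valued (defs \<Gamma>)"
      using assms(1,2) by (auto simp: \<Gamma>_def wf_defs_def)
    show "\<forall>(M, M') \<in> eqs \<Gamma>. \<exists>m A. has_ty sig [] m M A \<and> has_ty sig [] m M' A"
    proof safe
      fix M M' assume "(M, M') \<in> eqs \<Gamma>"
      then obtain H where "H \<in> S" "M = Meta [] H (?zs H)" "M' = ?M H" by (auto simp: \<Gamma>_def)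
      with ty[of H] pat show "\<exists>m A. has_ty sig [] m M A \<and> has_ty sig [] m M' A"
        by (intro exI[of _ "mtag H"] exI[of _ "Base (target (mty H))"]) (simp add: has_ty_iff)
    qed
    show "\<forall>(r, U) \<in> defs \<Gamma>. has_ty sig [] Con U (rty r) \<and> FV U = {}"
      using wf_defsD[OF assms(2)] by (auto simp: \<Gamma>_def)
    show "ctx_rconsts \<Gamma> \<subseteq> Domain (defs \<Gamma>)"
      using \<sigma> wf_defsD(3)[OF assms(2)] unfolding ctx_rconsts_def \<Gamma>_def by (auto, blast+)
  qed
  then have sub: "is_subst sig \<Gamma>"
    unfolding is_subst_def using FV by (auto simp: \<Gamma>_def)
  moreover have dom: "sdom \<Gamma> = S" by (auto simp: sdom_def \<Gamma>_def)
  moreover have "defs \<Gamma> = D" by (simp add: \<Gamma>_def)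
  moreover have "subst \<Gamma> (eta H) = (if H \<in> S then \<sigma> H else eta H)" for H
  proof (cases "H \<in> S")
    case True
    then have "(Meta [] H (?zs H), ?M H) \<in> eqs \<Gamma>" by (auto simp: \<Gamma>_def)
    then have "subst \<Gamma> (eta H) = close_tm (?zs H) (?M H)" by (rule subst_eta_close[OF sub])
    also have "\<dots> = \<sigma> H"
      using pat[of "arg_tys (mty H)"] has_ty_binders[of sig "[]" "mtag H" "\<sigma> H"] \<sigma>[OF True]
      by (intro close_open_tm cl True) (auto simp: pattern_def)
    finally show ?thesis using True by simp
  next
    case False
    with dom show ?thesis by (simp add: subst_eta_None)
  qed
  ultimately show ?thesis by blast
qed

section \<open>Pruning irrelevant arguments\<close>

text \<open>
  A term may syntactically contain a variable that never shows up in its expansion, as \<open>x\<close> in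
  \<open>r x\<close> for \<open>r =\<^sub>d \<lambda>x. c (r x)\<close>. Unifiers of the conclusion of a pruning or flex-flex rule are built
  from right-hand sides without such variables, so every recursion constant is replaced by one
  that takes only the arguments \<open>keep D r\<close> occurring in its expansion.
\<close>

definition keep :: "('b, 'c) dfn set \<Rightarrow> 'b rconst \<Rightarrow> nat set" where
  "keep D r = {i. \<exists>U k. (r, U) \<in> D \<and> Bnd i \<in> eocc (ewith [] (expand D k U))}"

fun prune :: "('b rconst \<Rightarrow> nat set) \<Rightarrow> ('b rconst \<Rightarrow> 'b rconst) \<Rightarrow> ('b, 'c) tm \<Rightarrow> ('b, 'c) tm" where
  "prune K c (Rigid Bs h Ns) = Rigid Bs h (map (prune K c) Ns)"
| "prune K c (Meta Bs H ys) = Meta Bs H ys"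
| "prune K c (Recur Bs r ys) = Recur Bs (c r) (nths ys (K r))"

lemma prune_ren: "prune K c (ren \<rho> M) = ren \<rho> (prune K c M)"
  by (induction M arbitrary: \<rho>) (auto simp: nths_map)

lemma prune_with_binders: "prune K c (with_binders Bs M) = with_binders Bs (prune K c M)"
  by (cases M) auto

lemma prune_open: "prune K c (open_tm ys M) = open_tm ys (prune K c M)"
  by (simp add: open_tm_opn prune_ren prune_with_binders)

lemma rconsts_prune: "rconsts (prune K c M) = c ` rconsts M"
  by (induction M) auto

lemma pattern_nths:
  assumes "pattern Bs ys As" shows "pattern Bs (nths ys I) (nths As I)"
  using assms set_nths_subset[of ys I] by (auto simp: pattern_def nths_map)

lemma has_ty_prune:
  assumes "\<And>r. rty (c r) = arrows (nths (arg_tys (rty r)) (K r)) (target (rty r))"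
  shows "has_ty sig Cs m M A \<Longrightarrow> has_ty sig Cs m (prune K c M) A"
proof (induction M arbitrary: Cs m A)
  case (Rigid Bs h Ns)
  then show ?case by (auto simp: has_ty_iff list_all2_conv_all_nth)
qed (auto simp: has_ty_iff assms pattern_nths)

lemma expand_Recur:
  assumes "defs_ok D" "(r, U) \<in> D" "arities_ok U"
  shows "expand D k (Recur Bs r ys) = ewith Bs (eopen ys (expand D k U))"
proof (cases k)
  case (Suc j)
  then have "expand D k (Recur Bs r ys) = expand D k (with_binders Bs (open_tm ys U))"
    using assms expand_eqs(4) defs_okD(1)[OF assms(1,2)] by (metis defs_ok_def)
  then show ?thesis using expand_open(1)[OF assms(1,3)] by simp
qed simp

lemma eocc_ewith_unshift: "eocc (ewith Bs T) = unshift (length Bs) (eocc (ewith [] T))"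
  by (cases T) (auto simp: unshift_def)

text \<open>Heads and metavariable arguments are visible at depth 1 already, and an argument of a
  constant survives pruning only if some expansion of the body shows its parameter. Each enclosing
  rigid head adds one to the depth.\<close>

lemma occ_prune_keep:
  assumes "defs_ok D"
  shows "arities_ok M \<Longrightarrow> rconsts M \<subseteq> Domain D \<Longrightarrow> v \<in> occ (prune (keep D) c M) \<Longrightarrow>
    \<exists>k. v \<in> eocc (expand D k M)"
proof (induction M arbitrary: v)
  case (Rigid Bs h Ns)
  then consider "lift_var (length Bs) v \<in> hvars h"
    | N where "N \<in> set Ns" "lift_var (length Bs) v \<in> occ (prune (keep D) c N)"
    by (auto simp: unshift_def)
  then show ?case
  proof cases
    case 1
    then show ?thesis by (intro exI[of _ "Suc 0"]) (simp add: unshift_def)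
  next
    case 2
    with Rigid.prems have "arities_ok N" "rconsts N \<subseteq> Domain D" by auto
    with Rigid.IH[OF 2(1) _ _ 2(2)] obtain k where "lift_var (length Bs) v \<in> eocc (expand D k N)" by blast
    with 2(1) show ?thesis by (intro exI[of _ "Suc k"]) (auto simp: unshift_def)
  qed
next
  case (Meta Bs H ys)
  then show ?case by (intro exI[of _ "Suc 0"]) simp
next
  case (Recur Bs r ys)
  then obtain i where i: "i < length ys" "i \<in> keep D r" "lift_var (length Bs) v = ys ! i"
    by (auto simp: unshift_def set_nths)
  then obtain U k where U: "(r, U) \<in> D" "Bnd i \<in> eocc (ewith [] (expand D k U))"
    by (auto simp: keep_def)
  note d = defs_okD[OF assms U(1)]
  have "closed_etm (length ys) (expand D k U)"
    using closed_expand[OF assms d(3,2)] Recur.prems(1) by simp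
  then have "ys ! i \<in> eocc (eopen ys (expand D k U))" using U(2) by (auto simp: eocc_eopen)
  moreover have "ewith [] (eopen ys (expand D k U)) = eopen ys (expand D k U)"
    by (cases "expand D k U") (simp_all add: eopen_def)
  ultimately have "v \<in> eocc (ewith Bs (eopen ys (expand D k U)))"
    by (subst eocc_ewith_unshift) (simp add: unshift_def i(3))
  then show ?case using expand_Recur[OF assms U(1) d(3)] by metis
qed

lemma rn_nths:
  assumes "distinct xs" "length ys = length xs" "i < length xs" "i \<in> I"
  shows "rn (nths ys I) (nths xs I) (xs ! i) = ys ! i"
proof -
  have "zip (nths xs I) (nths ys I) = nths (zip xs ys) I" using assms(2)
  proof (induction ys xs arbitrary: I rule: list_induct2)
    case (Cons y ys x xs)
    then show ?case by (simp add: nths_Cons)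
  qed simp
  moreover have "(xs ! i, ys ! i) \<in> set (nths (zip xs ys) I)"
    using assms by (force simp: set_nths)
  moreover have "map fst (nths (zip xs ys) I) = nths xs I"
    using assms(2) by (simp flip: nths_map)
  ultimately have "map_of (zip (nths xs I) (nths ys I)) (xs ! i) = Some (ys ! i)"
    using assms(1) by simp
  then show ?thesis by (simp add: rn_def)
qed

text \<open>Passing through named variables, opening at all parameters and closing over the kept
  ones, avoids renumbering indices by hand.\<close>

definition pruned_def ::
  "('b rconst \<Rightarrow> nat set) \<Rightarrow> ('b rconst \<Rightarrow> 'b rconst) \<Rightarrow> 'b rconst \<Rightarrow> ('b, 'c) tm \<Rightarrow> ('b, 'c) tm" where
  "pruned_def K c r U =
     (let xs = nvars (arg_tys (rty r)) in close_tm (nths xs (K r)) (open_tm xs (prune K c U)))"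

text \<open>By \<open>occ_prune_keep\<close> the pruned body uses only parameters in
  \<open>keep D r\<close>. Closing over these therefore leaves nothing free, and opening at the kept
  arguments has the same effect as opening at all of them.\<close>

lemma
  assumes D: "wf_defs sig D"
    and c: "\<And>r. rty (c r) = arrows (nths (arg_tys (rty r)) (keep D r)) (target (rty r))"
    and U: "(r, U) \<in> D"
  shows has_ty_pruned_def: "has_ty sig [] Con (pruned_def (keep D) c r U) (rty (c r))"
    and FV_pruned_def: "FV (pruned_def (keep D) c r U) = {}"
    and rconsts_pruned_def: "rconsts (pruned_def (keep D) c r U) = c ` rconsts U"
    and open_pruned_def: "length ys = length (arg_tys (rty r)) \<Longrightarrow>
      open_tm (nths ys (keep D r)) (pruned_def (keep D) c r U) = open_tm ys (prune (keep D) c U)"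
proof -
  let ?K = "keep D r"
  let ?P = "prune (keep D) c U"
  define xs where "xs = nvars (arg_tys (rty r))"
  have xs: "pattern [] xs (arg_tys (rty r))" unfolding xs_def by (rule pattern_nvars)
  then have len: "length xs = length (arg_tys (rty r))" by (rule pattern_length)
  from xs have dist: "distinct xs" and vt: "map (vtype []) (nths xs ?K) = nths (arg_tys (rty r)) ?K"
    by (auto simp: pattern_def nths_map[symmetric])
  note wU = wf_defsD[OF D U]
  have tyP: "has_ty sig [] Con ?P (rty r)" by (rule has_ty_prune[OF c wU(1)])
  have dk: "defs_ok D" by (rule wf_defs_ok[OF D])
  have body: "\<exists>i. v = Bnd i \<and> i < length xs \<and> i \<in> ?K" if "v \<in> occ (with_binders [] ?P)" for v
  proof -
    from that have "v \<in> occ (prune (keep D) c (with_binders [] U))" by (simp add: prune_with_binders)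
    then obtain k where k: "v \<in> eocc (expand D k (with_binders [] U))"
      using occ_prune_keep[OF dk, of "with_binders [] U" v c] has_ty_arities_ok[OF wU(1)] wU(3) by auto
    then have k: "v \<in> eocc (ewith [] (expand D k U))" by (simp add: expand_with_binders)
    have "closed_etm (length xs) (expand D k U)"
      using closed_expand[OF dk has_ty_arities_ok[OF wU(1)] has_ty_closed[OF wU(1,2)]] len by simp
    from closed_ebody[OF this k] obtain i where i: "v = Bnd i" "i < length xs" .
    with k U show ?thesis by (auto simp: keep_def)
  qed
  have FVP: "FV ?P = {}"
  proof -
    have "occ ?P = {}"
    proof (rule ccontr)
      assume "occ ?P \<noteq> {}"
      then obtain v where "lift_var (length (binders ?P)) v \<in> occ (with_binders [] ?P)"
        by (subst (asm) occ_with_binders) (auto simp: unshift_def)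
      with body have "\<exists>i < length xs. lift_var (length (binders ?P)) v = Bnd i" by blast
      with has_ty_binders[OF tyP] len show False by auto
    qed
    then show ?thesis using has_ty_occ_FV[OF tyP] by simp
  qed
  let ?A = "open_tm xs ?P"
  have tyA: "has_ty sig [] Con ?A (Base (target (rty r)))" by (rule has_ty_open[OF tyP FVP xs])
  have FVA: "FV ?A \<subseteq> set (nths xs ?K)"
  proof
    fix v assume "v \<in> FV ?A"
    then have "v \<in> opn xs ` occ (with_binders [] ?P)"
      using has_ty_occ_FV[OF tyA] by (simp add: open_tm_opn occ_ren)
    with body obtain i where "v = opn xs (Bnd i)" "i < length xs" "i \<in> ?K" by blast
    then show "v \<in> set (nths xs ?K)" by (auto simp: set_nths)
  qed
  have pd: "pruned_def (keep D) c r U = close_tm (nths xs ?K) ?A" by (simp add: pruned_def_def xs_def Let_def)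
  note close = tyA distinct_nthsI[OF dist] FVA
  show "has_ty sig [] Con (pruned_def (keep D) c r U) (rty (c r))"
    using has_ty_close_tm[OF close] by (simp add: pd c vt)
  show "FV (pruned_def (keep D) c r U) = {}" unfolding pd by (rule FV_close_tm[OF close])
  show "rconsts (pruned_def (keep D) c r U) = c ` rconsts U"
    by (simp add: pd close_tm_def rconsts_prune)
  show "open_tm (nths ys ?K) (pruned_def (keep D) c r U) = open_tm ys ?P"
    if "length ys = length (arg_tys (rty r))"
  proof -
    have "open_tm (nths ys ?K) (close_tm (nths xs ?K) ?A) = rename (nths ys ?K) (nths xs ?K) ?A"
      using that len by (intro open_close_tm[OF close]) (simp add: length_nths)
    also have "\<dots> = open_tm ys ?P"
      unfolding rename_rn open_tm_opn[of _ ?P] ren_ren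
    proof (rule ren_cong)
      fix v assume "v \<in> occ (with_binders [] ?P)"
      with body obtain i where "v = Bnd i" "i < length xs" "i \<in> ?K" by blast
      with that len dist show "(rn (nths ys ?K) (nths xs ?K) \<circ> opn xs) v = opn ys v"
        by (simp add: rn_nths)
    qed
    finally show ?thesis by (simp add: pd)
  qed
qed

text \<open>Pruning commutes with unfolding by \<open>open_pruned_def\<close>, and all that it
  alters, the names and arguments of recursion constants, never appears in an expansion.\<close>

lemma expand_prune:
  assumes D: "wf_defs sig D" and inj: "inj_on c (Domain D)"
    and c: "\<And>r. rty (c r) = arrows (nths (arg_tys (rty r)) (keep D r)) (target (rty r))"
    and sv: "single_valued ((\<lambda>(r, U). (c r, pruned_def (keep D) c r U)) ` D)"
  shows "arities_ok M \<Longrightarrow> rconsts M \<subseteq> Domain D \<Longrightarrow>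
    expand ((\<lambda>(r, U). (c r, pruned_def (keep D) c r U)) ` D) k (prune (keep D) c M) = expand D k M"
    (is "_ \<Longrightarrow> _ \<Longrightarrow> expand ?D' _ _ = _")
proof (induction k arbitrary: M)
  case (Suc k)
  have dk: "defs_ok D" by (rule wf_defs_ok[OF D])
  have un: "unfold ?D' (prune (keep D) c M) = prune (keep D) c (unfold D M) \<and> rconsts (unfold D M) \<subseteq> Domain D"
  proof (cases M)
    case (Recur Bs r ys)
    with Suc.prems obtain U where U: "(r, U) \<in> D" by auto
    then have "(c r, pruned_def (keep D) c r U) \<in> ?D'" by force
    then have "def_of ?D' (c r) = Some (pruned_def (keep D) c r U)" by (rule def_of_eq[OF sv])
    moreover have "def_of D r = Some U" using U dk by (intro def_of_eq) (auto simp: defs_ok_def)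
    ultimately show ?thesis
      using open_pruned_def[OF D c U, of ys] Suc.prems wf_defsD(3)[OF D U]
      by (simp add: Recur prune_with_binders prune_open)
  qed (use Suc.prems in auto)
  have "arities_ok (unfold D M)" by (rule arities_ok_unfold[OF dk Suc.prems(1)])
  with un Suc.IH show ?case by (cases "unfold D M") (auto simp: UN_subset_iff)
qed simp

lemma finite_sdom:
  fixes \<Gamma> :: "('b, 'c) uctx"
  assumes "is_subst sig \<Gamma>" shows "finite (sdom \<Gamma>)"
proof -
  have "sdom \<Gamma> \<subseteq> (\<Union>e \<in> eqs \<Gamma>. mvars (fst e))" by (force simp: sdom_def)
  moreover have "finite (mvars M)" for M :: "('b, 'c) tm" by (induction M) auto
  moreover have "finite (eqs \<Gamma>)" using assms by (simp add: is_subst_def wf_ctx_def)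
  ultimately show ?thesis by (meson finite_UN_I finite_subset)
qed

text \<open>Variables of an expansion always occur in the term; this is the converse for images. It
  turns what is known about expansions into scoping of the term itself.\<close>

definition tight :: "('b, 'c) uctx \<Rightarrow> bool" where
  "tight \<Gamma> \<longleftrightarrow> (\<forall>H i. Bnd i \<in> occ (with_binders [] (subst \<Gamma> (eta H))) \<longrightarrow>
     (\<exists>k. Bnd i \<in> eocc (ewith [] (sem \<Gamma> H k))))"

lemma tighten:
  fixes \<Gamma> :: "('b, 'c) uctx"
  assumes "is_subst sig \<Gamma>"
  obtains \<Gamma>' where "is_subst sig \<Gamma>'" "sdom \<Gamma>' = sdom \<Gamma>" "sem \<Gamma>' = sem \<Gamma>" "tight \<Gamma>'"
proof -
  let ?D = "defs \<Gamma>"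
  let ?K = "keep ?D"
  have D: "wf_defs sig ?D" using assms by (intro wf_ctx_defs) (simp add: is_subst_def)
  have dk: "defs_ok ?D" by (rule wf_defs_ok[OF D])
  have "finite (Domain ?D)" using D by (simp add: wf_defs_def finite_Domain)
  \<comment> \<open>Dropping arguments can make different types coincide, so reusing
    \<open>rname\<close> could merge two constants. Numbering the finite domain afresh keeps
    \<open>c\<close> injective.\<close>
  then obtain idx :: "'b rconst \<Rightarrow> nat" where idx: "inj_on idx (Domain ?D)"
    using finite_imp_inj_to_nat_seg by blast
  define c where "c r = RC (idx r) (arrows (nths (arg_tys (rty r)) (?K r)) (target (rty r)))" for r
  have c: "rty (c r) = arrows (nths (arg_tys (rty r)) (?K r)) (target (rty r))" for r
    by (simp add: c_def)
  have inj: "inj_on c (Domain ?D)" using idx by (auto simp: inj_on_def c_def)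
  define D' where "D' = (\<lambda>(r, U). (c r, pruned_def ?K c r U)) ` ?D"
  have sv: "single_valued D'"
  proof (rule single_valuedI)
    fix s V W assume "(s, V) \<in> D'" "(s, W) \<in> D'"
    then obtain r U r' U' where *: "(r, U) \<in> ?D" "(r', U') \<in> ?D" "s = c r" "s = c r'"
      "V = pruned_def ?K c r U" "W = pruned_def ?K c r' U'"
      by (auto simp: D'_def)
    then have "r = r'" using inj by (metis Domain.DomainI inj_onD)
    moreover from this have "U = U'" using * D by (metis wf_defs_def single_valuedD)
    ultimately show "V = W" using * by simp
  qed
  have dom': "Domain D' = c ` Domain ?D" by (force simp: D'_def)
  have D': "wf_defs sig D'"
    unfolding wf_defs_def
  proof (intro conjI ballI)
    show "finite D'" using D by (simp add: D'_def wf_defs_def)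
    fix d assume "d \<in> D'"
    then obtain r U where rU: "(r, U) \<in> ?D" "d = (c r, pruned_def ?K c r U)" by (auto simp: D'_def)
    show "case d of (r, U) \<Rightarrow> has_ty sig [] Con U (rty r) \<and> FV U = {} \<and> rconsts U \<subseteq> Domain D'"
      using has_ty_pruned_def[OF D c rU(1)] FV_pruned_def[OF D c rU(1)] rconsts_pruned_def[OF D c rU(1)]
        wf_defsD(3)[OF D rU(1)] by (auto simp: rU(2) dom')
  qed (rule sv)
  define \<sigma> where "\<sigma> H = prune ?K c (subst \<Gamma> (eta H))" for H
  note img = is_subst_image[OF assms]
  have exp: "expand D' k (\<sigma> H) = sem \<Gamma> H k" for H k
    unfolding \<sigma>_def sem_def D'_def
    by (rule expand_prune[OF D inj c sv[unfolded D'_def] has_ty_arities_ok[OF img(1)] img(3)])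
  have tyS: "has_ty sig [] (mtag H) (\<sigma> H) (mty H)" for H
    unfolding \<sigma>_def by (rule has_ty_prune[OF c img(1)])
  have body: "\<exists>k. v \<in> eocc (ewith [] (sem \<Gamma> H k))" if "v \<in> occ (with_binders [] (\<sigma> H))" for v H
  proof -
    have "v \<in> occ (prune ?K c (with_binders [] (subst \<Gamma> (eta H))))"
      using that by (simp add: \<sigma>_def prune_with_binders)
    from occ_prune_keep[OF dk _ _ this] have "\<exists>k. v \<in> eocc (expand ?D k (with_binders [] (subst \<Gamma> (eta H))))"
      using has_ty_arities_ok[OF img(1)] img(3) by simp
    then show ?thesis by (simp add: expand_with_binders sem_def)
  qed
  have FVS: "FV (\<sigma> H) = {}" for H
  proof (rule ccontr)
    assume "FV (\<sigma> H) \<noteq> {}"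
    then obtain n A where "Free n A \<in> FV (\<sigma> H)" using FV_Free by (metis all_not_in_conv)
    then have "Free n A \<in> occ (\<sigma> H)" by (simp add: Free_occ)
    then have "Free n A \<in> occ (with_binders [] (\<sigma> H))"
      by (subst (asm) occ_with_binders) (simp add: unshift_def)
    with body obtain k where "Free n A \<in> eocc (ewith [] (sem \<Gamma> H k))" by blast
    from closed_ebody[OF sem_okD(2)[OF sem_ok_sem[OF assms]] this] show False by auto
  qed
  have ok: "has_ty sig [] (mtag H) (\<sigma> H) (mty H) \<and> FV (\<sigma> H) = {} \<and> rconsts (\<sigma> H) \<subseteq> Domain D'" for H
    using tyS FVS image_mono[OF img(3), of c H] by (simp add: \<sigma>_def rconsts_prune dom')
  obtain \<Gamma>' where \<Gamma>': "is_subst sig \<Gamma>'" "sdom \<Gamma>' = sdom \<Gamma>" "defs \<Gamma>' = D'"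
    "\<And>H. subst \<Gamma>' (eta H) = (if H \<in> sdom \<Gamma> then \<sigma> H else eta H)"
    using realize[OF finite_sdom[OF assms] D', of \<sigma>, OF ok] by blast
  \<comment> \<open>Outside the domain the image is \<open>eta H\<close>, which contains no
    recursion constant and is fixed by pruning.\<close>
  have "subst \<Gamma>' (eta H) = \<sigma> H" for H
    using \<Gamma>'(4)[of H] by (auto simp: \<sigma>_def subst_eta_None) (simp add: eta_def)
  then have "sem \<Gamma>' = sem \<Gamma>" "tight \<Gamma>'"
    using body by (auto simp: sem_def[of \<Gamma>'] fun_eq_iff \<Gamma>'(3) exp tight_def)
  with \<Gamma>' show thesis using that by blast
qed

section \<open>Extending unifiers\<close>

lemma wf_eqE:
  assumes "wf_ctx sig \<Delta>" "(M, M') \<in> eqs \<Delta>"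
  obtains m A where "has_ty sig [] m M A" "has_ty sig [] m M' A"
  using assms by (fastforce simp: wf_ctx_def)

lemma wf_eq_arities_ok:
  assumes "wf_ctx sig \<Delta>" "(M, M') \<in> eqs \<Delta>" shows "arities_ok M" "arities_ok M'"
  using wf_eqE[OF assms] has_ty_arities_ok by metis+

lemma UV_eqs: "(M, M') \<in> eqs \<Delta> \<Longrightarrow> mvars M \<subseteq> UV \<Delta>" "(M, M') \<in> eqs \<Delta> \<Longrightarrow> mvars M' \<subseteq> UV \<Delta>"
  by (auto simp: UV_def)

lemma UV_defs: "(r, U) \<in> defs \<Delta> \<Longrightarrow> mvars U \<subseteq> UV \<Delta>"
  by (auto simp: UV_def)

lemma wf_eq_rconsts:
  assumes "wf_ctx sig \<Delta>" "(M, M') \<in> eqs \<Delta>"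
  shows "rconsts M \<subseteq> Domain (defs \<Delta>)" "rconsts M' \<subseteq> Domain (defs \<Delta>)"
proof -
  have "rconsts M \<union> rconsts M' \<subseteq> ctx_rconsts \<Delta>"
    unfolding ctx_rconsts_def by (rule le_supI1, rule order_trans[OF _ UN_upper[OF assms(2)]]) simp
  with assms(1) show "rconsts M \<subseteq> Domain (defs \<Delta>)" "rconsts M' \<subseteq> Domain (defs \<Delta>)"
    by (auto simp: wf_ctx_def)
qed

lemma unifier_wf_iff:
  assumes "wf_ctx sig \<Delta>"
  shows "unifier sig \<Delta> \<Gamma> \<longleftrightarrow> \<not> contra \<Delta> \<and> is_subst sig \<Gamma> \<and> sdom \<Gamma> = UV \<Delta> \<and>
    (\<forall>(M, M') \<in> eqs \<Delta>. \<forall>k. eval (defs \<Delta>) (sem \<Gamma>) k M = eval (defs \<Delta>) (sem \<Gamma>) k M')"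
  using wf_eq_arities_ok[OF assms] by (intro unifier_iff wf_ctx_defs_ok[OF assms]) auto

lemma unifier_subst_eq:
  assumes "wf_ctx sig \<Delta>" "unifier sig \<Delta> \<Gamma>" "is_subst sig \<Gamma>'" "\<Gamma> \<approx> \<Gamma>'"
  shows "unifier sig \<Delta> \<Gamma>'"
  using assms unfolding unifier_wf_iff[OF assms(1)] subst_eq_sem by simp

text \<open>Terms over the names of \<open>\<Delta>\<close> reach only constants defined in
  \<open>\<Delta>\<close>, so added definitions and images of fresh metavariables cannot be seen
  from them.\<close>

lemma eval_extend:
  assumes "wf_ctx sig \<Delta>" "defs \<Delta> \<subseteq> D" "defs_ok D" "\<And>H k. H \<in> UV \<Delta> \<Longrightarrow> s H k = s' H k"
    and "mvars M \<subseteq> UV \<Delta>" "rconsts M \<subseteq> Domain (defs \<Delta>)"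
  shows "eval (defs \<Delta>) s k M = eval D s' k M"
proof (rule eval_cong[where V = "UV \<Delta>" and R = "Domain (defs \<Delta>)"])
  have sv: "single_valued (defs \<Delta>)" "single_valued D"
    using assms(1,3) by (auto simp: wf_ctx_def defs_ok_def)
  show "def_of (defs \<Delta>) r = def_of D r" if "r \<in> Domain (defs \<Delta>)" for r
  proof -
    from that obtain U where "(r, U) \<in> defs \<Delta>" by blast
    with assms(2) show ?thesis using def_of_eq sv by (metis subsetD)
  qed
  show "mvars U \<subseteq> UV \<Delta> \<and> rconsts U \<subseteq> Domain (defs \<Delta>)"
    if "r \<in> Domain (defs \<Delta>)" "def_of (defs \<Delta>) r = Some U" for r U
  proof -
    from that(1) obtain U' where U': "(r, U') \<in> defs \<Delta>" by blast
    with that(2) def_of_eq[OF sv(1)] have "(r, U) \<in> defs \<Delta>" by force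
    then show ?thesis using UV_defs wf_defsD(3)[OF wf_ctx_defs[OF assms(1)]] by blast
  qed
qed (use assms in auto)

text \<open>Leaves only the new equations \<open>E\<close> to be checked: the old ones carry over by
  \<open>eval_extend\<close>, and the restriction claim follows from agreement on
  \<open>UV \<Delta>\<close>.\<close>

lemma unifier_extendI:
  assumes "wf_ctx sig \<Delta>" "unifier sig \<Delta> \<Gamma>"
    and "eqs \<Delta>' = eqs \<Delta> \<union> E" "defs \<Delta> \<subseteq> defs \<Delta>'" "contra \<Delta>' = contra \<Delta>"
    and "defs_ok (defs \<Delta>')" "\<And>M M'. (M, M') \<in> E \<Longrightarrow> arities_ok M \<and> arities_ok M'"
    and "is_subst sig \<Gamma>'" "sdom \<Gamma>' = UV \<Delta>'" "\<And>H. H \<in> UV \<Delta> \<Longrightarrow> sem \<Gamma>' H = sem \<Gamma> H"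
    and "\<And>M M' k. (M, M') \<in> E \<Longrightarrow> eval (defs \<Delta>') (sem \<Gamma>') k M = eval (defs \<Delta>') (sem \<Gamma>') k M'"
  shows "unifier sig \<Delta>' \<Gamma>' \<and> restrict (UV \<Delta>) \<Gamma>' \<approx> \<Gamma>"
proof
  note u = assms(2)[unfolded unifier_wf_iff[OF assms(1)]]
  have "unifier sig \<Delta>' \<Gamma>' \<longleftrightarrow> \<not> contra \<Delta>' \<and> is_subst sig \<Gamma>' \<and> sdom \<Gamma>' = UV \<Delta>' \<and>
    (\<forall>(M, M') \<in> eqs \<Delta>'. \<forall>k. eval (defs \<Delta>') (sem \<Gamma>') k M = eval (defs \<Delta>') (sem \<Gamma>') k M')"
    using assms(3,7) wf_eq_arities_ok[OF assms(1)] by (intro unifier_iff assms(6)) auto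
  moreover have "eval (defs \<Delta>') (sem \<Gamma>') k M = eval (defs \<Delta>') (sem \<Gamma>') k M'"
    if e: "(M, M') \<in> eqs \<Delta>" for M M' k
  proof -
    note ext = eval_extend[OF assms(1,4,6), of "sem \<Gamma>" "sem \<Gamma>'"]
    have "eval (defs \<Delta>) (sem \<Gamma>) k M = eval (defs \<Delta>) (sem \<Gamma>) k M'" using u e by blast
    with ext[of M] ext[of M'] assms(10) UV_eqs[OF e] wf_eq_rconsts[OF assms(1) e]
    show ?thesis by simp
  qed
  ultimately show "unifier sig \<Delta>' \<Gamma>'" using u assms(3,5,8,9,11) by auto
  have "UV \<Delta> \<subseteq> UV \<Delta>'" using assms(3,4) by (auto simp: UV_def)
  then have "sdom (restrict (UV \<Delta>) \<Gamma>') = sdom \<Gamma>" using assms(9) u by auto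
  moreover have "sem (restrict (UV \<Delta>) \<Gamma>') = sem \<Gamma>"
    using assms(10) u by (auto simp: fun_eq_iff sem_restrict sem_notin)
  ultimately show "restrict (UV \<Delta>) \<Gamma>' \<approx> \<Gamma>" by (simp add: subst_eq_sem)
qed

lemma eqs_add_eqs [simp]: "eqs (add_eqs E \<Delta>) = eqs \<Delta> \<union> E"
  and defs_add_eqs [simp]: "defs (add_eqs E \<Delta>) = defs \<Delta>"
  and contra_add_eqs [simp]: "contra (add_eqs E \<Delta>) = contra \<Delta>"
  and eqs_add_def [simp]: "eqs (add_def d \<Delta>) = eqs \<Delta>"
  and defs_add_def [simp]: "defs (add_def d \<Delta>) = insert d (defs \<Delta>)"
  and contra_add_def [simp]: "contra (add_def d \<Delta>) = contra \<Delta>"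
  and eqs_add_contra [simp]: "eqs (add_contra \<Delta>) = eqs \<Delta>"
  and defs_add_contra [simp]: "defs (add_contra \<Delta>) = defs \<Delta>"
  and contra_add_contra [simp]: "contra (add_contra \<Delta>)"
  by (simp_all add: add_eqs_def add_def_def add_contra_def)

lemma UV_add_eqs: "UV (add_eqs E \<Delta>) = UV \<Delta> \<union> (\<Union>(M, M') \<in> E. mvars M \<union> mvars M')"
  by (auto simp: UV_def)

text \<open>For conclusions without fresh names the given unifier serves unchanged.\<close>

lemma unifier_add_eqsI:
  assumes "wf_ctx sig \<Delta>" "unifier sig \<Delta> \<Gamma>"
    and "\<And>M M'. (M, M') \<in> E \<Longrightarrow> mvars M \<subseteq> UV \<Delta> \<and> mvars M' \<subseteq> UV \<Delta> \<and> arities_ok M \<and> arities_ok M'"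
    and "\<And>M M' k. (M, M') \<in> E \<Longrightarrow> eval (defs \<Delta>) (sem \<Gamma>) k M = eval (defs \<Delta>) (sem \<Gamma>) k M'"
  shows "unifier sig (add_eqs E \<Delta>) \<Gamma> \<and> restrict (UV \<Delta>) \<Gamma> \<approx> \<Gamma>"
proof (rule unifier_extendI[OF assms(1,2)])
  show "sdom \<Gamma> = UV (add_eqs E \<Delta>)"
    using assms(2,3) by (fastforce simp: unifier_wf_iff[OF assms(1)] UV_add_eqs)
qed (use assms wf_ctx_defs_ok in \<open>auto simp: unifier_wf_iff[OF assms(1)]\<close>)

text \<open>New images may use only constants that \<open>\<Gamma>\<close> defines, so
  \<open>defs\<close> stays the same and the remaining images expand as before.\<close>

lemma extend_subst:
  assumes "is_subst sig \<Gamma>" "finite S"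
    and "\<And>H. H \<in> S \<Longrightarrow> has_ty sig [] (mtag H) (\<tau> H) (mty H) \<and> FV (\<tau> H) = {} \<and>
      rconsts (\<tau> H) \<subseteq> Domain (defs \<Gamma>)"
  obtains \<Gamma>' where "is_subst sig \<Gamma>'" "sdom \<Gamma>' = sdom \<Gamma> \<union> S" "defs \<Gamma>' = defs \<Gamma>"
    "\<forall>H. H \<notin> S \<longrightarrow> sem \<Gamma>' H = sem \<Gamma> H \<and> subst \<Gamma>' (eta H) = subst \<Gamma> (eta H)"
    "\<forall>H \<in> S. subst \<Gamma>' (eta H) = \<tau> H"
proof -
  define \<sigma> where "\<sigma> H = (if H \<in> S then \<tau> H else subst \<Gamma> (eta H))" for H
  have "finite (sdom \<Gamma> \<union> S)" using finite_sdom[OF assms(1)] assms(2) by simp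
  moreover have "wf_defs sig (defs \<Gamma>)" using assms(1) by (intro wf_ctx_defs) (simp add: is_subst_def)
  moreover have "has_ty sig [] (mtag H) (\<sigma> H) (mty H) \<and> FV (\<sigma> H) = {} \<and>
      rconsts (\<sigma> H) \<subseteq> Domain (defs \<Gamma>)" for H
    using assms(3) is_subst_image[OF assms(1)] by (simp add: \<sigma>_def)
  ultimately obtain \<Gamma>' where \<Gamma>': "is_subst sig \<Gamma>'" "sdom \<Gamma>' = sdom \<Gamma> \<union> S" "defs \<Gamma>' = defs \<Gamma>"
    "\<forall>H. subst \<Gamma>' (eta H) = (if H \<in> sdom \<Gamma> \<union> S then \<sigma> H else eta H)"
    using realize[of "sdom \<Gamma> \<union> S" sig "defs \<Gamma>" \<sigma>] by blast
  then have *: "subst \<Gamma>' (eta H) = \<sigma> H" for H by (simp add: \<sigma>_def subst_eta_None)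
  then have "sem \<Gamma>' H = sem \<Gamma> H" if "H \<notin> S" for H
    using that by (auto simp: sem_def \<Gamma>'(3) \<sigma>_def)
  with * \<Gamma>' show thesis by (intro that[of \<Gamma>']) (auto simp: \<sigma>_def)
qed

lemma eval_Meta_sem:
  assumes "is_subst sig \<Gamma>"
  shows "eval D (sem \<Gamma>) k (Meta Bs H ys) =
    expand (defs \<Gamma>) k (with_binders Bs (open_tm ys (subst \<Gamma> (eta H))))"
  using expand_open(1)[OF is_subst_defs_ok[OF assms] has_ty_arities_ok[OF is_subst_image(1)[OF assms]]]
  by (simp add: eval_Meta[OF sem_ok_sem[OF assms]] sem_def)

lemma eval_Meta_Nil:
  assumes "is_subst sig \<Gamma>"
  shows "eval D (sem \<Gamma>) k (Meta [] H ys) = eopen ys (sem \<Gamma> H k)"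
    "eval D (sem \<Gamma>) k (Meta [] H ys) = expand (defs \<Gamma>) k (open_tm ys (subst \<Gamma> (eta H)))"
  using eval_Meta_sem[OF assms, of D k "[]"]
    expand_open(2)[OF is_subst_defs_ok[OF assms] has_ty_arities_ok[OF is_subst_image(1)[OF assms]]]
  by (simp_all add: sem_def)

section \<open>Images of the fresh metavariables in imitation and projection\<close>

lemma wf_Meta_eq:
  assumes "wf_ctx sig \<Delta>" "(Meta [] H ys, M) \<in> eqs \<Delta> \<or> (M, Meta [] H ys) \<in> eqs \<Delta>"
  shows "pattern [] ys (arg_tys (mty H))" "has_ty sig [] (mtag H) M (Base (target (mty H)))" "H \<in> UV \<Delta>"
    "length ys = length (arg_tys (mty H))"
proof -
  show "pattern [] ys (arg_tys (mty H))" "has_ty sig [] (mtag H) M (Base (target (mty H)))"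
    using assms(2) by (auto elim!: wf_eqE[OF assms(1)] simp: has_ty_iff)
  then show "length ys = length (arg_tys (mty H))" by (simp add: pattern_length)
  show "H \<in> UV \<Delta>" using assms(2) UV_eqs by fastforce
qed

text \<open>A contractive image is not a recursion constant, and a metavariable image would expand
  to \<open>EMeta\<close>. So the image is rigid, and being closed it has a constructor or one of
  its own binders as head.\<close>

lemma rigid_image:
  assumes "is_subst sig \<Gamma>" "mtag H = Con" "length ys = length (arg_tys (mty H))"
    and "eopen ys (sem \<Gamma> H (Suc 0)) = ERigid [] h Es"
  obtains h0 Ms where "subst \<Gamma> (eta H) = Rigid (arg_tys (mty H)) h0 Ms" "ren_head (opn ys) h0 = h"
    "\<And>v. v \<in> hvars h0 \<Longrightarrow> \<exists>i < length ys. v = Bnd i"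
proof -
  note i = is_subst_image[OF assms(1), of H]
  note b = has_ty_binders[OF i(1)] has_ty_sort[OF i(1)]
  have cl: "closed_tm (length ys) (subst \<Gamma> (eta H))" using has_ty_closed[OF i(1,2)] assms(3) by simp
  show thesis
  proof (cases "subst \<Gamma> (eta H)")
    case (Rigid Bs h0 Ms)
    have "v \<in> hvars h0 \<Longrightarrow> \<exists>i < length ys. v = Bnd i" for v
      using closed_body[OF cl, of v] Rigid by auto
    then show thesis using that[of h0 Ms] Rigid b assms(4) by (simp add: sem_def eopen_def)
  next
    case (Meta Bs K us)
    with assms(4) show thesis by (simp add: sem_def eopen_def)
  next
    case (Recur Bs r us)
    with b assms(2) show thesis by simp
  qed
qed

text \<open>Serves both IMIT and PROJ. If \<open>H\<close> is mapped to an abstraction of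
  \<open>h0\<close> applied to \<open>Ms\<close>, the \<open>i\<close>-th fresh metavariable
  receives the body of \<open>Ms ! i\<close> with the binders of \<open>H\<close> abstracted as
  well.\<close>

lemma imit_extend:
  fixes \<Delta> \<Gamma> :: "('b, 'c) uctx"
  assumes wf: "wf_ctx sig \<Delta>" and uni: "unifier sig \<Delta> \<Gamma>"
    and eq: "(Meta [] H ys, Rigid [] h Ns) \<in> eqs \<Delta>" and tag: "mtag H = Con"
    and As: "As = arg_tys (head_ty sig [] h)"
    and Gs: "imit_mvs ys As Gs" "distinct Gs" "set Gs \<inter> UV \<Delta> = {}"
  shows "\<exists>\<Gamma>'. unifier sig (add_eqs {(Meta [] H ys, Rigid [] h (imit_args ys As Gs))} \<Delta>) \<Gamma>' \<and>
    restrict (UV \<Delta>) \<Gamma>' \<approx> \<Gamma>"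
proof -
  note u = uni[unfolded unifier_wf_iff[OF wf]]
  then have sub: "is_subst sig \<Gamma>" by simp
  note H = wf_Meta_eq[OF wf disjI1[OF eq]]
  define Bs where "Bs = arg_tys (mty H)"
  have ys: "map (vtype []) ys = Bs" "length Bs = length ys"
    using H(1,4) by (auto simp: pattern_def Bs_def)
  \<comment> \<open>Depth 1 is enough to read off the head of the image.\<close>
  have "eval (defs \<Delta>) (sem \<Gamma>) (Suc 0) (Meta [] H ys) = eval (defs \<Delta>) (sem \<Gamma>) (Suc 0) (Rigid [] h Ns)"
    using u eq by blast
  then have "eopen ys (sem \<Gamma> H (Suc 0)) = ERigid [] h (map (eval (defs \<Delta>) (sem \<Gamma>) 0) Ns)"
    unfolding eval_Meta_Nil(1)[OF sub] eval_Rigid .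
  from rigid_image[OF sub tag H(4) this] obtain h0 Ms where
    T: "subst \<Gamma> (eta H) = Rigid Bs h0 Ms" and h0: "ren_head (opn ys) h0 = h"
    and bnd: "\<And>v. v \<in> hvars h0 \<Longrightarrow> \<exists>i < length ys. v = Bnd i"
    unfolding Bs_def by metis
  note img = is_subst_image[OF sub, of H, unfolded T]
  have "head_ty sig Bs h0 = head_ty sig [] h"
  proof (cases h0)
    case (HCon c)
    with h0 show ?thesis by auto
  next
    case (HVar v)
    with bnd obtain i where "v = Bnd i" "i < length ys" by auto
    with h0 HVar show ?thesis by (auto simp flip: ys(1))
  qed
  with img(1) As have Ms: "list_all2 (has_ty sig Bs Rec) Ms As" by (simp add: has_ty_iff)
  have lens: "length Ms = length As" "length Gs = length As"
    using Ms Gs(1) by (auto simp: imit_mvs_def dest: list_all2_lengthD)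
  \<comment> \<open>In the body of \<open>Ms ! i\<close> the binders of the argument are numbered
    before those of \<open>H\<close>, whereas \<open>imit_arg\<close> passes \<open>ys\<close>
    before the argument's own binders. \<open>sw n\<close> exchanges the two blocks.\<close>
  define sw where "sw n v = (case v of
      Bnd j \<Rightarrow> (if j < n then Bnd (length Bs + j) else Bnd (j - n)) | Free m A \<Rightarrow> Free m A)"
    for n and v :: "'b var"
  define img where "img i = (let Cs = arg_tys (As ! i)
      in with_binders (Bs @ Cs) (ren (sw (length Cs)) (with_binders [] (Ms ! i))))" for i
  define \<tau> where "\<tau> G = the (map_of (zip Gs (map img [0..<length Gs])) G)" for G
  have \<tau>: "\<tau> (Gs ! i) = img i" if "i < length Gs" for i
    using that Gs(2) by (simp add: \<tau>_def map_of_zip_nth)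
  have tyM: "has_ty sig (arg_tys (As ! i) @ Bs) Rec (with_binders [] (Ms ! i)) (Base (target (As ! i)))"
    and binders: "binders (Ms ! i) = arg_tys (As ! i)" if "i < length As" for i
  proof -
    from Ms that lens have "has_ty sig Bs Rec (Ms ! i) (As ! i)" by (simp add: list_all2_conv_all_nth)
    from has_ty_body[OF this] has_ty_binders[OF this]
    show "has_ty sig (arg_tys (As ! i) @ Bs) Rec (with_binders [] (Ms ! i)) (Base (target (As ! i)))"
      "binders (Ms ! i) = arg_tys (As ! i)" by simp_all
  qed
  have "has_ty sig [] (mtag (Gs ! i)) (img i) (mty (Gs ! i)) \<and> FV (img i) = {} \<and>
      rconsts (img i) \<subseteq> Domain (defs \<Gamma>)" if i: "i < length As" for i
  proof (intro conjI)
    let ?Cs = "arg_tys (As ! i)" and ?N = "with_binders [] (Ms ! i)"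
    let ?sw = "sw (length ?Cs)"
    have mty: "mtag (Gs ! i) = Rec" "mty (Gs ! i) = arrows (Bs @ ?Cs) (target (As ! i))"
      using Gs(1) i ys by (auto simp: imit_mvs_def list_all2_conv_all_nth)
    have "has_ty sig (Bs @ ?Cs) Rec (ren ?sw ?N) (Base (target (As ! i)))"
    proof (rule has_ty_ren[OF tyM[OF i]])
      show "in_scope (Bs @ ?Cs) (?sw v) \<and> vtype (Bs @ ?Cs) (?sw v) = vtype (?Cs @ Bs) v"
        if "in_scope (?Cs @ Bs) v" for v
        using that by (cases v) (auto simp: sw_def nth_append)
      have "inj_on ?sw {v. in_scope (?Cs @ Bs) v}"
      proof (rule inj_onI)
        fix v w assume "v \<in> {v. in_scope (?Cs @ Bs) v}" "w \<in> {v. in_scope (?Cs @ Bs) v}" "?sw v = ?sw w"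
        then show "v = w" by (cases v; cases w) (auto simp: sw_def split: if_splits)
      qed
      then show "inj_on ?sw (occ ?N)"
        by (rule inj_on_subset) (use has_ty_occ[OF tyM[OF i]] in blast)
    qed
    moreover have "with_binders [] (ren ?sw ?N) = ren ?sw ?N"
      by (cases "Ms ! i") auto
    ultimately show ty: "has_ty sig [] (mtag (Gs ! i)) (img i) (mty (Gs ! i))"
      by (simp add: mty img_def Let_def has_ty_with_binders)
    have Mi: "Ms ! i \<in> set Ms" using i lens by simp
    show "FV (img i) = {}"
    proof (rule ccontr)
      assume "FV (img i) \<noteq> {}"
      then obtain n A where nA: "Free n A \<in> FV (img i)" using FV_Free by (metis all_not_in_conv)
      then have "Free n A \<in> occ (ren ?sw ?N)"
        unfolding Free_occ by (cases "Ms ! i") (auto simp: img_def Let_def)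
      then obtain v where "v \<in> occ ?N" "Free n A = ?sw v" by (auto simp: occ_ren)
      then have "Free n A \<in> occ ?N" by (cases v) (auto simp: sw_def split: if_splits)
      then have "Free n A \<in> FV (Ms ! i)" unfolding Free_occ by (cases "Ms ! i") auto
      with img(2) Mi show False by auto
    qed
    show "rconsts (img i) \<subseteq> Domain (defs \<Gamma>)"
      using img(3) Mi by (auto simp: img_def Let_def)
  qed
  then have "has_ty sig [] (mtag G) (\<tau> G) (mty G) \<and> FV (\<tau> G) = {} \<and>
      rconsts (\<tau> G) \<subseteq> Domain (defs \<Gamma>)" if "G \<in> set Gs" for G
    using that \<tau> lens by (metis in_set_conv_nth)
  from extend_subst[OF sub _ this, of "set Gs"] obtain \<Gamma>' where
    \<Gamma>': "is_subst sig \<Gamma>'" "sdom \<Gamma>' = sdom \<Gamma> \<union> set Gs" "defs \<Gamma>' = defs \<Gamma>"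
      "\<forall>H. H \<notin> set Gs \<longrightarrow> sem \<Gamma>' H = sem \<Gamma> H \<and> subst \<Gamma>' (eta H) = subst \<Gamma> (eta H)"
      "\<forall>H \<in> set Gs. subst \<Gamma>' (eta H) = \<tau> H"
    by auto
  have arg: "eval (defs \<Delta>) (sem \<Gamma>') k (imit_arg ys (As ! i) (Gs ! i)) =
      expand (defs \<Gamma>) k (ren (opn ys) (Ms ! i))" if i: "i < length As" for i k
  proof -
    let ?Cs = "arg_tys (As ! i)" and ?N = "with_binders [] (Ms ! i)"
    let ?n = "length ?Cs"
    let ?zs = "map (lift_var ?n) ys @ map Bnd [0..<?n]"
    \<comment> \<open>Opening at the lifted \<open>ys\<close> followed by the bound block undoes the
      exchange; what is left is \<open>opn ys\<close> below the binders of the argument.\<close>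
    have "ren (opn ?zs) (ren (sw ?n) ?N) = ren (under ?n (opn ys)) ?N"
      unfolding ren_ren
    proof (rule ren_cong)
      fix v assume "v \<in> occ ?N"
      from has_ty_occ[OF tyM[OF i] this]
      show "(opn ?zs \<circ> sw ?n) v = under ?n (opn ys) v"
        by (cases v) (auto simp: sw_def opn_def nth_append ys(2))
    qed
    moreover have "open_tm ?zs (img i) = ren (opn ?zs) (ren (sw ?n) ?N)"
      unfolding open_tm_opn img_def Let_def by (cases "Ms ! i") auto
    ultimately have "with_binders ?Cs (open_tm ?zs (img i)) = with_binders ?Cs (ren (opn ys) (Ms ! i))"
      using with_binders_ren[of ?Cs "opn ys" "Ms ! i"] binders[OF i] by simp
    also have "\<dots> = ren (opn ys) (Ms ! i)"
      using binders[OF i] with_binders_binders[of "ren (opn ys) (Ms ! i)"] by simp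
    finally show ?thesis
      using \<Gamma>'(5) \<tau>[of i] i lens
      by (simp add: imit_arg_def Let_def eval_Meta_sem[OF \<Gamma>'(1)] \<Gamma>'(3) del: eval.simps)
  qed
  have HGs: "H \<notin> set Gs" using Gs(3) H(3) by blast
  have "unifier sig (add_eqs {(Meta [] H ys, Rigid [] h (imit_args ys As Gs))} \<Delta>) \<Gamma>' \<and>
    restrict (UV \<Delta>) \<Gamma>' \<approx> \<Gamma>"
  proof (rule unifier_extendI[OF wf uni eqs_add_eqs])
    show "is_subst sig \<Gamma>'" by (rule \<Gamma>'(1))
    have "(\<Union>M \<in> set (imit_args ys As Gs). mvars M) = set Gs"
    proof -
      have "map mvars (imit_args ys As Gs) = map (\<lambda>G. {G}) Gs"
        using lens(2) by (intro nth_equalityI) (auto simp: imit_args_def imit_arg_def Let_def)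
      then have "mvars ` set (imit_args ys As Gs) = (\<lambda>G. {G}) ` set Gs" by (metis set_map)
      then show ?thesis by auto
    qed
    then show "sdom \<Gamma>' = UV (add_eqs {(Meta [] H ys, Rigid [] h (imit_args ys As Gs))} \<Delta>)"
      using \<Gamma>'(2) u H(3) by (auto simp: UV_add_eqs)
    show "sem \<Gamma>' K = sem \<Gamma> K" if "K \<in> UV \<Delta>" for K
      using that \<Gamma>'(4) Gs(3) by blast
    fix M M' assume MM: "(M :: ('b, 'c) tm, M') \<in> {(Meta [] H ys, Rigid [] h (imit_args ys As Gs))}"
    have "arities_ok (imit_arg ys (As ! i) (Gs ! i))" if "i < length As" for i
      using that Gs(1) by (auto simp: imit_arg_def Let_def imit_mvs_def list_all2_conv_all_nth)
    then have "\<forall>N \<in> set (imit_args ys As Gs). arities_ok N"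
      using lens(2) by (auto simp: imit_args_def in_set_conv_nth)
    with MM H(4) show "arities_ok M \<and> arities_ok M'" by simp
    show "eval (defs (add_eqs {(Meta [] H ys, Rigid [] h (imit_args ys As Gs))} \<Delta>)) (sem \<Gamma>') k M =
      eval (defs (add_eqs {(Meta [] H ys, Rigid [] h (imit_args ys As Gs))} \<Delta>)) (sem \<Gamma>') k M'" for k
    proof (cases k)
      case (Suc j)
      have "eval (defs \<Delta>) (sem \<Gamma>') k (Meta [] H ys) = expand (defs \<Gamma>) k (open_tm ys (Rigid Bs h0 Ms))"
        using \<Gamma>'(3,4) HGs T by (simp add: eval_Meta_Nil(2)[OF \<Gamma>'(1)] del: eval.simps)
      also have "\<dots> = ERigid [] h (map (\<lambda>M. expand (defs \<Gamma>) j (ren (opn ys) M)) Ms)"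
        using h0 by (simp add: open_tm_opn Suc)
      also have "map (\<lambda>M. expand (defs \<Gamma>) j (ren (opn ys) M)) Ms =
          map (eval (defs \<Delta>) (sem \<Gamma>') j) (imit_args ys As Gs)"
        using lens arg by (intro nth_equalityI) (auto simp: imit_args_def)
      finally show ?thesis using MM Suc by (simp only: eval_Rigid defs_add_eqs) simp
    qed simp
  qed (auto simp: wf_ctx_defs_ok[OF wf])
  then show ?thesis by blast
qed

section \<open>Images of the fresh metavariables in the flex-flex and pruning rules\<close>

lemma tight_occ:
  assumes "is_subst sig \<Gamma>" "tight \<Gamma>" "length ys = length (arg_tys (mty H))"
    and "v \<in> occ (open_tm ys (subst \<Gamma> (eta H)))"
  obtains i k where "v = ys ! i" "i < length ys" "Bnd i \<in> eocc (ewith [] (sem \<Gamma> H k))"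
proof -
  note i = is_subst_image[OF assms(1), of H]
  have cl: "closed_tm (length ys) (subst \<Gamma> (eta H))" using has_ty_closed[OF i(1,2)] assms(3) by simp
  from assms(4) obtain w where "w \<in> occ (with_binders [] (subst \<Gamma> (eta H)))" "v = opn ys w"
    by (auto simp: open_tm_opn occ_ren)
  moreover from closed_body[OF cl this(1)] obtain j where "w = Bnd j" "j < length ys" .
  ultimately show thesis using assms(2) that by (auto simp: tight_def)
qed

text \<open>Common to FF_D and FF_S, which differ only in why the variables of the image of
  \<open>G\<close> at \<open>xs\<close> lie in \<open>zs\<close>. Given that, this image abstracted
  over \<open>zs\<close> serves for \<open>F\<close>; the side of \<open>H\<close> agrees because
  its expansions do.\<close>

lemma ff_extend:
  fixes \<Delta> \<Gamma> :: "('b, 'c) uctx"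
  assumes wf: "wf_ctx sig \<Delta>" and uni: "unifier sig \<Delta> \<Gamma>"
    and eq: "(Meta [] G xs, Meta [] H ys) \<in> eqs \<Delta>"
    and zs: "distinct zs" "occ (open_tm xs (subst \<Gamma> (eta G))) \<subseteq> set zs"
    and F: "mtag F = mtag G" "mty F = arrows (map (vtype []) zs) (target (mty G))" "F \<notin> UV \<Delta>"
  shows "\<exists>\<Gamma>'. unifier sig (add_eqs (ff_eqs G xs H ys F zs) \<Delta>) \<Gamma>' \<and> restrict (UV \<Delta>) \<Gamma>' \<approx> \<Gamma>"
proof -
  note u = uni[unfolded unifier_wf_iff[OF wf]]
  then have sub: "is_subst sig \<Gamma>" by simp
  note G = wf_Meta_eq[OF wf disjI1[OF eq]] and H = wf_Meta_eq[OF wf disjI2[OF eq]]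
  note img = is_subst_image[OF sub, of G]
  let ?A = "open_tm xs (subst \<Gamma> (eta G))"
  have tyA: "has_ty sig [] (mtag G) ?A (Base (target (mty G)))"
    by (rule has_ty_open[OF img(1,2) G(1)])
  have FVA: "FV ?A \<subseteq> set zs" using zs(2) has_ty_occ_FV[OF tyA] by simp
  note cl = tyA zs(1) FVA
  obtain \<Gamma>' where
    \<Gamma>': "is_subst sig \<Gamma>'" "sdom \<Gamma>' = sdom \<Gamma> \<union> {F}" "defs \<Gamma>' = defs \<Gamma>"
      "\<forall>H. H \<notin> {F} \<longrightarrow> sem \<Gamma>' H = sem \<Gamma> H \<and> subst \<Gamma>' (eta H) = subst \<Gamma> (eta H)"
      "\<forall>H \<in> {F}. subst \<Gamma>' (eta H) = close_tm zs ?A"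
  proof (rule extend_subst[OF sub, of "{F}" "\<lambda>_. close_tm zs ?A"])
    show "has_ty sig [] (mtag H) (close_tm zs ?A) (mty H) \<and> FV (close_tm zs ?A) = {} \<and>
      rconsts (close_tm zs ?A) \<subseteq> Domain (defs \<Gamma>)" if "H \<in> {F}" for H
      using that has_ty_close_tm[OF cl] FV_close_tm[OF cl] img(3) F(1,2)
      by (simp add: close_tm_def)
  qed auto
  have "G \<noteq> F" "H \<noteq> F" using F(3) G(3) H(3) by auto
  have FA: "eval (defs \<Delta>) (sem \<Gamma>') k (Meta [] F zs) = expand (defs \<Gamma>) k ?A" for k
    using \<Gamma>'(3,5) open_close_tm_self[OF cl] by (simp add: eval_Meta_Nil(2)[OF \<Gamma>'(1)])
  have GA: "eval (defs \<Delta>) (sem \<Gamma>') k (Meta [] G xs) = expand (defs \<Gamma>) k ?A" for k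
    using \<Gamma>'(3,4) \<open>G \<noteq> F\<close> by (simp add: eval_Meta_Nil(2)[OF \<Gamma>'(1)])
  have HA: "eval (defs \<Delta>) (sem \<Gamma>') k (Meta [] H ys) = expand (defs \<Gamma>) k ?A" for k
  proof -
    have "eval (defs \<Delta>) (sem \<Gamma>) k (Meta [] G xs) = eval (defs \<Delta>) (sem \<Gamma>) k (Meta [] H ys)"
      using u eq by blast
    then have "eopen ys (sem \<Gamma> H k) = expand (defs \<Gamma>) k ?A"
      by (simp only: eval_Meta_Nil(1)[OF sub, of _ _ H] eval_Meta_Nil(2)[OF sub, of _ _ G])
    then show ?thesis
      using \<Gamma>'(4) \<open>H \<noteq> F\<close> by (simp add: eval_Meta_Nil(1)[OF \<Gamma>'(1)])
  qed
  have "unifier sig (add_eqs (ff_eqs G xs H ys F zs) \<Delta>) \<Gamma>' \<and> restrict (UV \<Delta>) \<Gamma>' \<approx> \<Gamma>"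
  proof (rule unifier_extendI[OF wf uni eqs_add_eqs])
    show "is_subst sig \<Gamma>'" by (rule \<Gamma>'(1))
    show "sdom \<Gamma>' = UV (add_eqs (ff_eqs G xs H ys F zs) \<Delta>)"
      using \<Gamma>'(2) u G(3) H(3) by (auto simp: UV_add_eqs ff_eqs_def)
    show "sem \<Gamma>' K = sem \<Gamma> K" if "K \<in> UV \<Delta>" for K
      using that \<Gamma>'(4) F(3) by auto
    show "arities_ok M \<and> arities_ok M'" if "(M, M') \<in> ff_eqs G xs H ys F zs" for M M' :: "('b, 'c) tm"
      using that F(2) G(4) H(4) by (auto simp: ff_eqs_def)
    show "eval (defs (add_eqs (ff_eqs G xs H ys F zs) \<Delta>)) (sem \<Gamma>') k M =
      eval (defs (add_eqs (ff_eqs G xs H ys F zs) \<Delta>)) (sem \<Gamma>') k M'"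
      if "(M, M') \<in> ff_eqs G xs H ys F zs" for M M' :: "('b, 'c) tm" and k
      using that FA GA HA by (auto simp: ff_eqs_def)
  qed (auto simp: wf_ctx_defs_ok[OF wf])
  then show ?thesis by blast
qed

fun not_rec :: "('b, 'c) etm \<Rightarrow> bool" where
  "not_rec (EMeta Bs H ys) \<longleftrightarrow> mtag H = Con"
| "not_rec _ \<longleftrightarrow> True"

lemma not_rec_eren [simp]: "not_rec (eren \<rho> T) = not_rec T"
  by (cases T) auto

lemma not_rec_ewith [simp]: "not_rec (ewith Bs T) = not_rec T"
  by (cases T) auto

text \<open>Images of contractive metavariables are contractive, so no instantiation brings a
  recursive metavariable to the head of a contractive term.\<close>

lemma not_rec_eval:
  assumes "is_subst sig \<Gamma>" "sort_of M = Con" shows "not_rec (eval D (sem \<Gamma>) k M)"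
proof (cases k)
  case (Suc j)
  show ?thesis
  proof (cases M)
    case (Meta Bs H ys)
    have "sort_of (subst \<Gamma> (eta H)) = Con"
      using has_ty_sort[OF is_subst_image(1)[OF assms(1)]] assms(2) Meta by simp
    then have "not_rec (sem \<Gamma> H k)"
      using Suc by (cases "subst \<Gamma> (eta H)") (simp_all add: sem_def)
    then show ?thesis
      by (simp add: Meta eval_Meta[OF sem_ok_sem[OF assms(1)]] eopen_def del: eval.simps)
  qed (use assms(2) Suc in auto)
qed simp

lemma defs_ok_insert_eta:
  assumes "defs_ok D" "t \<notin> Domain D" "mtag G = Con" "mty G = rty t"
  shows "defs_ok (insert (t, eta G) D)"
proof -
  have "closed_tm (length (arg_tys (rty t))) (eta G :: ('a, 'b) tm)"
    using has_ty_closed[OF has_ty_eta FV_eta, of G] assms(4) by simp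
  moreover have "arities_ok (eta G)" "sort_of (eta G) = Con" using assms(3) by (simp_all add: eta_def)
  moreover have "single_valued (insert (t, eta G) D)"
    using assms(1,2) by (auto simp: defs_ok_def single_valued_def)
  ultimately show ?thesis using assms(1) by (auto simp: defs_ok_def)
qed

text \<open>\<open>G\<close> needs a contractive image, but the image of \<open>H\<close> is
  recursive. It cannot be a recursive metavariable, since \<open>r xs\<close> unfolds to a
  contractive body and \<open>not_rec_eval\<close> applies. Hence it is a constant \<open>q\<close>
  with arguments, and one unfolding of \<open>q\<close> gives a contractive term with the same
  expansions.\<close>

lemma prune_extend:
  fixes \<Delta> \<Gamma> :: "('b, 'c) uctx"
  assumes wf: "wf_ctx sig \<Delta>" and uni: "unifier sig \<Delta> \<Gamma>" and tight: "tight \<Gamma>"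
    and eq: "(Meta [] H ys, Recur [] r xs) \<in> eqs \<Delta>"
    and ws: "distinct ws" "set ws = set xs \<inter> set ys"
    and t: "rty t = arrows (map (vtype []) ws) (target (rty r))" "t \<notin> ctx_rconsts \<Delta>"
    and G: "mtag G = Con" "mty G = rty t" "G \<notin> UV \<Delta>"
  shows "\<exists>\<Gamma>'. unifier sig (add_def (t, eta G) (add_eqs (prune_eqs H ys r xs t ws) \<Delta>)) \<Gamma>' \<and>
    restrict (UV \<Delta>) \<Gamma>' \<approx> \<Gamma>"
proof -
  let ?\<Delta>' = "add_def (t, eta G) (add_eqs (prune_eqs H ys r xs t ws) \<Delta>)"
  note u = uni[unfolded unifier_wf_iff[OF wf]]
  then have sub: "is_subst sig \<Gamma>" by simp
  note H = wf_Meta_eq[OF wf disjI1[OF eq]]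
  have tag: "mtag H = Rec" and tgt: "target (rty r) = target (mty H)"
    and xs: "length xs = length (arg_tys (rty r))"
    using H(2) by (auto simp: has_ty_iff pattern_length)
  note img = is_subst_image[OF sub, of H]
  let ?D = "defs \<Gamma>"
  have dk: "defs_ok (defs \<Delta>)" and dk\<Gamma>: "defs_ok ?D" by (rule wf_ctx_defs_ok[OF wf], rule is_subst_defs_ok[OF sub])
  have ok: "sem_ok (sem \<Gamma>)" by (rule sem_ok_sem[OF sub])
  have ev: "eopen ys (sem \<Gamma> H k) = eval (defs \<Delta>) (sem \<Gamma>) k (Recur [] r xs)" for k
  proof -
    have "eval (defs \<Delta>) (sem \<Gamma>) k (Meta [] H ys) = eval (defs \<Delta>) (sem \<Gamma>) k (Recur [] r xs)"
      using u eq by blast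
    then show ?thesis by (simp only: eval_Meta_Nil(1)[OF sub])
  qed
  obtain U where U: "(r, U) \<in> defs \<Delta>" using wf_eq_rconsts(2)[OF wf eq] by auto
  note dU = defs_okD[OF dk U]
  obtain As q vs where T: "subst \<Gamma> (eta H) = Recur As q vs"
  proof (cases "subst \<Gamma> (eta H)")
    case (Rigid Bs h Ms)
    with has_ty_sort[OF img(1)] tag show thesis by simp
  next
    case (Meta Bs K us)
    have "eval (defs \<Delta>) (sem \<Gamma>) (Suc 0) (Recur [] r xs) =
        eval (defs \<Delta>) (sem \<Gamma>) (Suc 0) (open_tm xs U)"
      using eval_Recur[OF dk U, of "sem \<Gamma>" "Suc 0" "[]" xs] by simp
    then have "not_rec (eopen ys (sem \<Gamma> H (Suc 0)))"
      using ev not_rec_eval[OF sub] dU(1) by (metis sort_of_open_tm)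
    moreover have "mtag K = Rec" using has_ty_sort[OF img(1)] tag Meta by simp
    ultimately have False using Meta by (simp add: sem_def eopen_def)
    then show thesis ..
  qed
  obtain W where W: "(q, W) \<in> ?D" using img(3) T by auto
  note dW = defs_okD[OF dk\<Gamma> W]
  define us where "us = map (opn ys) vs"
  have B: "open_tm ys (subst \<Gamma> (eta H)) = Recur [] q us"
    by (simp add: T open_tm_opn us_def)
  have tyB: "has_ty sig [] Rec (Recur [] q us) (Base (target (mty H)))"
    using has_ty_open[OF img(1,2) H(1)] tag B by simp
  then have us: "pattern [] us (arg_tys (rty q))" "target (rty q) = target (mty H)"
    by (auto simp: has_ty_iff)
  \<comment> \<open>By tightness an argument of \<open>q\<close> is some \<open>ys ! i\<close>
    visible in the common expansion of both sides of the premise; evaluating \<open>r xs\<close>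
    shows only variables of \<open>xs\<close>, so it lies in the intersection.\<close>
  have us_ws: "set us \<subseteq> set ws"
  proof
    fix v assume "v \<in> set us"
    then have "v \<in> occ (open_tm ys (subst \<Gamma> (eta H)))" by (simp add: B)
    from tight_occ[OF sub tight H(4) this] obtain i k where
      v: "v = ys ! i" "i < length ys" "Bnd i \<in> eocc (ewith [] (sem \<Gamma> H k))" .
    have cl: "closed_etm (length ys) (sem \<Gamma> H k)" using sem_okD(2)[OF ok] H(4) by simp
    have "v \<in> eocc (eopen ys (sem \<Gamma> H k))" using v eocc_eopen[OF cl] by auto
    then have "v \<in> occ (Recur [] r xs)"
      using eocc_eval[OF dk ok wf_eq_arities_ok(2)[OF wf eq], of k] ev by auto
    then show "v \<in> set ws" using v(1,2) ws(2) by simp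
  qed
  let ?A = "open_tm us W"
  have "wf_defs sig ?D" using sub by (intro wf_ctx_defs) (simp add: is_subst_def)
  note wW = wf_defsD[OF this W]
  have tyA: "has_ty sig [] Con ?A (Base (target (mty H)))"
    using has_ty_open[OF wW(1,2) us(1)] us(2) by simp
  have "closed_tm (length us) W" using dW(2) us(1) by (simp add: pattern_length)
  then have FVA: "FV ?A \<subseteq> set ws" using occ_open us_ws has_ty_occ_FV[OF tyA] by blast
  note cl = tyA ws(1) FVA
  obtain \<Gamma>' where
    \<Gamma>': "is_subst sig \<Gamma>'" "sdom \<Gamma>' = sdom \<Gamma> \<union> {G}" "defs \<Gamma>' = defs \<Gamma>"
      "\<forall>H. H \<notin> {G} \<longrightarrow> sem \<Gamma>' H = sem \<Gamma> H \<and> subst \<Gamma>' (eta H) = subst \<Gamma> (eta H)"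
      "\<forall>H \<in> {G}. subst \<Gamma>' (eta H) = close_tm ws ?A"
  proof (rule extend_subst[OF sub, of "{G}" "\<lambda>_. close_tm ws ?A"])
    show "has_ty sig [] (mtag H) (close_tm ws ?A) (mty H) \<and> FV (close_tm ws ?A) = {} \<and>
      rconsts (close_tm ws ?A) \<subseteq> Domain (defs \<Gamma>)" if "H \<in> {G}" for H
      using that has_ty_close_tm[OF cl] FV_close_tm[OF cl] wW(3) G(1,2) t(1) tgt
      by (simp add: close_tm_def)
  qed auto
  have "H \<noteq> G" using G(3) H(3) by auto
  have tD: "t \<notin> Domain (defs \<Delta>)" using t(2) by (auto simp: ctx_rconsts_def)
  \<comment> \<open>Freshness of \<open>t\<close> keeps the definitions single-valued.\<close>
  have dk': "defs_ok (defs ?\<Delta>')" using defs_ok_insert_eta[OF dk tD G(1,2)] by simp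
  have expA: "expand ?D k ?A = eopen ys (sem \<Gamma> H k)" for k
  proof -
    have "expand ?D k ?A = expand ?D k (Recur [] q us)"
      using expand_Recur[OF dk\<Gamma> W dW(3), of k "[]" us] expand_open(1)[OF dk\<Gamma> dW(3), of k "[]" us] by simp
    then show ?thesis
      using eval_Meta_Nil[OF sub, of "defs \<Delta>" k H ys] B by simp
  qed
  have tA: "eval (defs ?\<Delta>') (sem \<Gamma>') k (Recur [] t ws) = eopen ys (sem \<Gamma> H k)" for k
  proof -
    have len: "length (arg_tys (mty G)) = length ws" using G(2) t(1) by simp
    have "map (opn ws) (map Bnd [0..<length ws]) = ws" by (rule nth_equalityI) auto
    then have "open_tm ws (eta G :: ('b, 'c) tm) = Meta [] G ws" by (simp add: open_tm_opn eta_def len)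
    then have "eval (defs ?\<Delta>') (sem \<Gamma>') k (Recur [] t ws) = eval (defs ?\<Delta>') (sem \<Gamma>') k (Meta [] G ws)"
      using eval_Recur[OF dk', of t "eta G" "sem \<Gamma>'" k "[]" ws] by simp
    also have "\<dots> = expand ?D k ?A"
      using \<Gamma>'(3,5) open_close_tm_self[OF cl] by (simp add: eval_Meta_Nil(2)[OF \<Gamma>'(1)])
    finally show ?thesis by (simp add: expA)
  qed
  have HA: "eval (defs ?\<Delta>') (sem \<Gamma>') k (Meta [] H ys) = eopen ys (sem \<Gamma> H k)" for k
    using \<Gamma>'(4) \<open>H \<noteq> G\<close> by (simp add: eval_Meta_Nil(1)[OF \<Gamma>'(1)])
  have rA: "eval (defs ?\<Delta>') (sem \<Gamma>') k (Recur [] r xs) = eopen ys (sem \<Gamma> H k)" for k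
  proof -
    have "eval (defs \<Delta>) (sem \<Gamma>) k (Recur [] r xs) = eval (defs ?\<Delta>') (sem \<Gamma>') k (Recur [] r xs)"
    proof (rule eval_extend[OF wf _ dk'])
      show "sem \<Gamma> K j = sem \<Gamma>' K j" if "K \<in> UV \<Delta>" for K j
        using that \<Gamma>'(4) G(3) by auto
    qed (use U in auto)
    then show ?thesis by (simp only: ev)
  qed
  have "unifier sig ?\<Delta>' \<Gamma>' \<and> restrict (UV \<Delta>) \<Gamma>' \<approx> \<Gamma>"
  proof (rule unifier_extendI[OF wf uni, where E = "prune_eqs H ys r xs t ws"])
    show "is_subst sig \<Gamma>'" by (rule \<Gamma>'(1))
    have "mvars (eta G :: ('b, 'c) tm) = {G}" by (simp add: eta_def)
    then have "UV ?\<Delta>' = UV (add_eqs (prune_eqs H ys r xs t ws) \<Delta>) \<union> {G}"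
      by (auto simp: UV_def)
    then show "sdom \<Gamma>' = UV ?\<Delta>'"
      using \<Gamma>'(2) u H(3) by (auto simp: UV_add_eqs prune_eqs_def)
    show "sem \<Gamma>' K = sem \<Gamma> K" if "K \<in> UV \<Delta>" for K
      using that \<Gamma>'(4) G(3) by auto
    show "arities_ok M \<and> arities_ok M'" if "(M, M') \<in> prune_eqs H ys r xs t ws" for M M' :: "('b, 'c) tm"
      using that t(1) H(4) xs by (auto simp: prune_eqs_def)
    show "eval (defs ?\<Delta>') (sem \<Gamma>') k M = eval (defs ?\<Delta>') (sem \<Gamma>') k M'"
      if "(M, M') \<in> prune_eqs H ys r xs t ws" for M M' :: "('b, 'c) tm" and k
      using that tA HA rA by (auto simp only: prune_eqs_def insert_iff prod.inject empty_iff)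
  qed (use dk' in auto)
  then show ?thesis by blast
qed

section \<open>Soundness of the saturation rules\<close>

lemma eval_rename:
  assumes "defs_ok D" "sem_ok s" "arities_ok M"
  shows "eval D s k (rename ys xs M) = eren (rn ys xs) (eval D s k M)"
  using assms by (simp add: rename_rn eval_ren)

lemma sat_extend_tight:
  fixes \<Delta> \<Gamma> :: "('b, 'c) uctx"
  assumes wf: "wf_ctx sig \<Delta>" and sat: "sat_rule sig \<Delta> \<Delta>'"
    and uni: "unifier sig \<Delta> \<Gamma>" and tight: "tight \<Gamma>"
  shows "\<exists>\<Gamma>'. unifier sig \<Delta>' \<Gamma>' \<and> restrict (UV \<Delta>) \<Gamma>' \<approx> \<Gamma>"
proof -
  note u = uni[unfolded unifier_wf_iff[OF wf]]
  then have sub: "is_subst sig \<Gamma>" by simp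
  have dk: "defs_ok (defs \<Delta>)" by (rule wf_ctx_defs_ok[OF wf])
  have ok: "sem_ok (sem \<Gamma>)" by (rule sem_ok_sem[OF sub])
  let ?e = "eval (defs \<Delta>) (sem \<Gamma>)"
  have e: "?e k M = ?e k M'" if "(M, M') \<in> eqs \<Delta>" for k M M'
    using u that by blast
  have add: "\<exists>\<Gamma>'. unifier sig (add_eqs E \<Delta>) \<Gamma>' \<and> restrict (UV \<Delta>) \<Gamma>' \<approx> \<Gamma>"
    if "\<And>M M'. (M, M') \<in> E \<Longrightarrow> mvars M \<subseteq> UV \<Delta> \<and> mvars M' \<subseteq> UV \<Delta> \<and> arities_ok M \<and> arities_ok M'"
      and "\<And>M M' k. (M, M') \<in> E \<Longrightarrow> ?e k M = ?e k M'" for E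
    using unifier_add_eqsI[OF wf uni, of E] that by blast
  note mv = UV_eqs and arities_ok = wf_eq_arities_ok[OF wf]
  have inst: ?thesis
    if "(M, M') \<in> eqs \<Delta>" "\<Delta>' = add_eqs {(open_tm xs M, open_tm xs M')} \<Delta>" for M M' xs
    unfolding that(2)
  proof (rule add)
    fix L L' :: "('b, 'c) tm" and k
    assume L: "(L, L') \<in> {(open_tm xs M, open_tm xs M')}"
    then show "mvars L \<subseteq> UV \<Delta> \<and> mvars L' \<subseteq> UV \<Delta> \<and> arities_ok L \<and> arities_ok L'"
      using mv[OF that(1)] arities_ok[OF that(1)] by simp
    show "?e k L = ?e k L'"
      using L e[OF that(1)] arities_ok[OF that(1)] by (auto simp: eval_open[OF dk ok] simp del: eval.simps)
  qed
  \<comment> \<open>Both right-hand sides evaluate to the image of \<open>H\<close>, opened at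
    \<open>xs\<close> and at \<open>ys\<close>; since that image is closed, renaming
    \<open>ys\<close> to \<open>xs\<close> turns one opening into the other.\<close>
  have agree: ?thesis
    if e1: "(Meta [] H xs, M1) \<in> eqs \<Delta>" and e2: "(Meta [] H ys, M2) \<in> eqs \<Delta>"
      and d: "\<Delta>' = add_eqs {(M1, rename xs ys M2)} \<Delta>" for H xs ys M1 M2
    unfolding d
  proof (rule add)
    fix L L' :: "('b, 'c) tm" and k
    assume L: "(L, L') \<in> {(M1, rename xs ys M2)}"
    then show "mvars L \<subseteq> UV \<Delta> \<and> mvars L' \<subseteq> UV \<Delta> \<and> arities_ok L \<and> arities_ok L'"
      using mv(2)[OF e1] mv(2)[OF e2] arities_ok(2)[OF e1] arities_ok(2)[OF e2] by (simp add: rename_rn)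
    note X = wf_Meta_eq[OF wf disjI1[OF e1]] and Y = wf_Meta_eq[OF wf disjI1[OF e2]]
    have cl: "closed_etm (length ys) (sem \<Gamma> H k)" using sem_okD(2)[OF ok] Y(4) by simp
    have "?e k (rename xs ys M2) = eren (rn xs ys) (?e k M2)"
      by (rule eval_rename[OF dk ok arities_ok(2)[OF e2]])
    also have "?e k M2 = eopen ys (sem \<Gamma> H k)"
      using e[OF e2, of k] by (simp only: eval_Meta_Nil(1)[OF sub])
    also have "eren (rn xs ys) \<dots> = eopen (map (rn xs ys) ys) (sem \<Gamma> H k)" by (rule eren_eopen[OF cl])
    also have "map (rn xs ys) ys = xs"
      using X(4) Y(1,4) by (intro map_rn) (auto simp: pattern_def)
    also have "eopen xs (sem \<Gamma> H k) = ?e k M1"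
      using e[OF e1, of k] by (simp only: eval_Meta_Nil(1)[OF sub])
    finally show "?e k L = ?e k L'" using L by simp
  qed
  have sym: ?thesis if "(M, M') \<in> eqs \<Delta>" "\<Delta>' = add_eqs {(M', M)} \<Delta>" for M M'
    unfolding that(2)
    by (rule add) (use mv[OF that(1)] arities_ok[OF that(1)] e[OF that(1)] in auto)
  have trans: ?thesis
    if "(M1, M2) \<in> eqs \<Delta>" "(M2, M3) \<in> eqs \<Delta>" "\<Delta>' = add_eqs {(M1, M3)} \<Delta>" for M1 M2 M3
    unfolding that(3)
    by (rule add) (use mv(1)[OF that(1)] mv(2)[OF that(2)] arities_ok(1)[OF that(1)] arities_ok(2)[OF that(2)]
      e[OF that(1)] e[OF that(2)] in auto)
  \<comment> \<open>Heads show at depth 1, so distinct rigid heads contradict the existence of the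
    unifier.\<close>
  have clash: ?thesis if "(Rigid [] h Ns, Rigid [] h' Ns') \<in> eqs \<Delta>" "h \<noteq> h'" for h h' Ns Ns'
    using e[OF that(1), of "Suc 0"] that(2) by simp
  show ?thesis
    using sat
  proof cases
    case (U_INST M M' Bs xs)
    then show ?thesis using inst by blast
  next
    case (N_INST M M' Bs xs)
    then show ?thesis using inst by blast
  next
    case SIMP_F1
    then show ?thesis using clash by blast
  next
    case SIMP_F2
    then show ?thesis using clash by blast
  next
    case SIMP_F3
    then show ?thesis using clash by blast
  next
    case (SIMP h Ns Ns')
    show ?thesis
      unfolding SIMP(1)
    proof (rule add)
      fix L L' :: "('b, 'c) tm" and k
      assume L: "(L, L') \<in> set (zip Ns Ns')"
      then have "L \<in> set Ns" "L' \<in> set Ns'" by (auto dest: set_zip_leftD set_zip_rightD)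
      then show "mvars L \<subseteq> UV \<Delta> \<and> mvars L' \<subseteq> UV \<Delta> \<and> arities_ok L \<and> arities_ok L'"
        using mv[OF SIMP(2)] arities_ok[OF SIMP(2)] by auto
      \<comment> \<open>Arguments at depth \<open>k\<close> are read off from the premise at depth
        \<open>Suc k\<close>.\<close>
      have "map (?e k) Ns = map (?e k) Ns'" using e[OF SIMP(2), of "Suc k"] by simp
      with L show "?e k L = ?e k L'" by (auto simp: set_zip dest: map_eq_imp_length_eq nth_map) (metis nth_map)
    qed
  next
    case (PROJ_F H ys z Ns)
    note H = wf_Meta_eq[OF wf disjI1[OF PROJ_F(2)]]
    have *: "eopen ys (sem \<Gamma> H (Suc 0)) = ERigid [] (HVar z) (map (?e 0) Ns)"
      using e[OF PROJ_F(2), of "Suc 0"] unfolding eval_Meta_Nil(1)[OF sub] eval_Rigid .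
    \<comment> \<open>A variable head of the opened image stems from one of its binders, hence is an
      element of \<open>ys\<close>.\<close>
    have "z \<in> set ys"
    proof (rule rigid_image[OF sub PROJ_F(3) H(4) *])
      fix h0 assume "ren_head (opn ys) h0 = HVar z" "\<And>v. v \<in> hvars h0 \<Longrightarrow> \<exists>i < length ys. v = Bnd i"
      then show ?thesis by (cases h0) auto
    qed
    with PROJ_F show ?thesis by blast
  next
    case (IMIT H ys c Ns As Gs)
    show ?thesis
      unfolding IMIT(1)
      by (rule imit_extend[OF wf uni IMIT(2,3) _ IMIT(7-9)]) (simp add: IMIT(5))
  next
    case (PROJ H ys y Ns As Gs)
    show ?thesis
      unfolding PROJ(1)
      by (rule imit_extend[OF wf uni PROJ(2,3) _ PROJ(8-10)]) (simp add: PROJ(6))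
  next
    case (PRUNE H ys r xs ws t G)
    show ?thesis
      unfolding PRUNE(1)
      by (rule prune_extend[OF wf uni tight PRUNE(2,5,6,9,10,11,12,13)])
  next
    case (FF_D G xs H ys zs F)
    note G = wf_Meta_eq[OF wf disjI1[OF FF_D(2)]] and H = wf_Meta_eq[OF wf disjI2[OF FF_D(2)]]
    \<comment> \<open>Tightness makes each variable visible in the expansion of the left side, which
      is also that of the right side and so shows only variables of \<open>ys\<close>.\<close>
    have "occ (open_tm xs (subst \<Gamma> (eta G))) \<subseteq> set zs"
    proof
      fix v assume "v \<in> occ (open_tm xs (subst \<Gamma> (eta G)))"
      from tight_occ[OF sub tight G(4) this] obtain i k where
        v: "v = xs ! i" "i < length xs" "Bnd i \<in> eocc (ewith [] (sem \<Gamma> G k))" .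
      have "eopen xs (sem \<Gamma> G k) = eopen ys (sem \<Gamma> H k)"
        using e[OF FF_D(2), of k] by (simp only: eval_Meta_Nil(1)[OF sub])
      moreover have "v \<in> eocc (eopen xs (sem \<Gamma> G k))"
        using v eocc_eopen[of xs "sem \<Gamma> G k"] sem_okD(2)[OF ok, of G k] G(4) by auto
      moreover have "eocc (eopen ys (sem \<Gamma> H k)) \<subseteq> set ys"
        using sem_okD(2)[OF ok, of H k] H(4) by (intro eocc_eopen_subset) simp
      ultimately show "v \<in> set zs" using v FF_D(6) by auto
    qed
    then show ?thesis
      unfolding FF_D(1) by (intro ff_extend[OF wf uni FF_D(2,5) _ FF_D(11-13)])
  next
    case (FF_S G xs ys zs F)
    note G = wf_Meta_eq[OF wf disjI1[OF FF_S(2)]] and H = wf_Meta_eq[OF wf disjI2[OF FF_S(2)]]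
    \<comment> \<open>The same expansion opened at \<open>xs\<close> and at \<open>ys\<close> gives
      equal results, so \<open>xs\<close> and \<open>ys\<close> must agree at every visible
      position.\<close>
    have "occ (open_tm xs (subst \<Gamma> (eta G))) \<subseteq> set zs"
    proof
      fix v assume "v \<in> occ (open_tm xs (subst \<Gamma> (eta G)))"
      from tight_occ[OF sub tight G(4) this] obtain i k where
        v: "v = xs ! i" "i < length xs" "Bnd i \<in> eocc (ewith [] (sem \<Gamma> G k))" .
      have "eopen xs (sem \<Gamma> G k) = eopen ys (sem \<Gamma> G k)"
        using e[OF FF_S(2), of k] by (simp only: eval_Meta_Nil(1)[OF sub])
      from eren_eqD[OF this[unfolded eopen_def] v(3)] have "xs ! i = ys ! i"
        using v(2) G(4) H(4) by simp
      then show "v \<in> set zs" using v FF_S(5) by blast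
    qed
    then show ?thesis
      unfolding FF_S(1) by (intro ff_extend[OF wf uni FF_S(2,4) _ FF_S(8-10)])
  next
    case (REC_EXP r xs s ys U1 U2)
    show ?thesis
      unfolding REC_EXP(1)
    proof (rule add)
      fix L L' :: "('b, 'c) tm" and k
      assume L: "(L, L') \<in> {(open_tm xs U1, open_tm ys U2)}"
      then show "mvars L \<subseteq> UV \<Delta> \<and> mvars L' \<subseteq> UV \<Delta> \<and> arities_ok L \<and> arities_ok L'"
        using UV_defs[OF REC_EXP(3)] UV_defs[OF REC_EXP(4)] defs_okD(3)[OF dk REC_EXP(3)]
          defs_okD(3)[OF dk REC_EXP(4)] by simp
      show "?e k L = ?e k L'"
        using L e[OF REC_EXP(2), of k] eval_Recur[OF dk REC_EXP(3), of "sem \<Gamma>" k "[]" xs]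
          eval_Recur[OF dk REC_EXP(4), of "sem \<Gamma>" k "[]" ys] by simp
    qed
  next
    case U_AGREE
    then show ?thesis using agree by blast
  next
    case N_AGREE
    then show ?thesis using agree by blast
  next
    case U_SYM
    then show ?thesis using sym by blast
  next
    case N_SYM
    then show ?thesis using sym by blast
  next
    case U_TRANS
    then show ?thesis using trans by blast
  next
    case N_TRANS
    then show ?thesis using trans by blast
  qed
qed

lemma sat_extend:
  assumes wf: "wf_ctx sig \<Delta>" and sat: "sat_rule sig \<Delta> \<Delta>'" and uni: "unifier sig \<Delta> \<Gamma>"
  shows "\<exists>\<Gamma>'. unifier sig \<Delta>' \<Gamma>' \<and> restrict (UV \<Delta>) \<Gamma>' \<approx> \<Gamma>"
proof -
  have "is_subst sig \<Gamma>" using uni by (simp add: unifier_def)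
  then obtain \<Gamma>1 where \<Gamma>1: "is_subst sig \<Gamma>1" "sdom \<Gamma>1 = sdom \<Gamma>" "sem \<Gamma>1 = sem \<Gamma>" "tight \<Gamma>1"
    by (rule tighten)
  then have "unifier sig \<Delta> \<Gamma>1" by (intro unifier_subst_eq[OF wf uni]) (auto simp: subst_eq_sem)
  from sat_extend_tight[OF wf sat this \<Gamma>1(4)] \<Gamma>1 show ?thesis by (simp add: subst_eq_sem)
qed

lemma sat_rule_mono:
  fixes \<Delta> :: "('b, 'c) uctx"
  assumes wf: "wf_ctx sig \<Delta>" and sat: "sat_rule sig \<Delta> \<Delta>'"
  shows "eqs \<Delta> \<subseteq> eqs \<Delta>'" "defs \<Delta> \<subseteq> defs \<Delta>'" "contra \<Delta> \<Longrightarrow> contra \<Delta>'" "defs_ok (defs \<Delta>')"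
proof -
  have dk: "defs_ok (defs \<Delta>)" by (rule wf_ctx_defs_ok[OF wf])
  have "eqs \<Delta> \<subseteq> eqs \<Delta>' \<and> defs \<Delta> \<subseteq> defs \<Delta>' \<and> (contra \<Delta> \<longrightarrow> contra \<Delta>') \<and> defs_ok (defs \<Delta>')"
    using sat
  proof cases
    case (PRUNE H ys r xs ws t G)
    have "t \<notin> Domain (defs \<Delta>)" using PRUNE(10) by (auto simp: ctx_rconsts_def)
    from defs_ok_insert_eta[OF dk this PRUNE(11,12)] show ?thesis by (auto simp: PRUNE(1))
  qed (use dk in auto)
  then show "eqs \<Delta> \<subseteq> eqs \<Delta>'" "defs \<Delta> \<subseteq> defs \<Delta>'" "contra \<Delta> \<Longrightarrow> contra \<Delta>'" "defs_ok (defs \<Delta>')" by auto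
qed

lemma unifier_restrict:
  assumes wf: "wf_ctx sig \<Delta>" and sat: "sat_rule sig \<Delta> \<Delta>'" and uni: "unifier sig \<Delta>' \<Gamma>'"
  shows "unifier sig \<Delta> (restrict (UV \<Delta>) \<Gamma>')"
  unfolding unifier_wf_iff[OF wf]
proof (intro conjI)
  note m = sat_rule_mono[OF wf sat]
  have sub: "is_subst sig \<Gamma>'" and dom: "sdom \<Gamma>' = UV \<Delta>'" using uni by (auto simp: unifier_def)
  show "\<not> contra \<Delta>" using uni m(3) by (auto simp: unifier_def)
  show "is_subst sig (restrict (UV \<Delta>) \<Gamma>')" by (rule is_subst_restrict[OF sub])
  have "UV \<Delta> \<subseteq> UV \<Delta>'" unfolding UV_def using m(1,2) by (intro Un_mono UN_mono) auto
  then show "sdom (restrict (UV \<Delta>) \<Gamma>') = UV \<Delta>" using dom by auto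
  show "\<forall>(M, M') \<in> eqs \<Delta>. \<forall>k. eval (defs \<Delta>) (sem (restrict (UV \<Delta>) \<Gamma>')) k M =
    eval (defs \<Delta>) (sem (restrict (UV \<Delta>) \<Gamma>')) k M'"
  proof safe
    fix M M' k assume e: "(M, M') \<in> eqs \<Delta>"
    let ?S = "subst (ren_ctx sub_rc \<Gamma>')"
    \<comment> \<open>The definition of \<open>unifier\<close> is used directly:
      \<open>unifier_iff\<close> would ask for \<open>arities_ok\<close> on the new equations of
      \<open>\<Delta>'\<close> as well.\<close>
    have "(?S (ren_rc ctx_rc M), ?S (ren_rc ctx_rc M')) \<in> eqs (app_ctx \<Delta>' \<Gamma>')"
      using e m(1) by (force simp: app_ctx_def ren_ctx_def[of ctx_rc])
    then have "expand (app_defs \<Delta>' \<Gamma>') k (?S (ren_rc ctx_rc M)) =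
        expand (app_defs \<Delta>' \<Gamma>') k (?S (ren_rc ctx_rc M'))"
      using uni by (auto simp: unifier_def holds_def app_ctx_def)
    then have "eval (defs \<Delta>') (sem \<Gamma>') k M = eval (defs \<Delta>') (sem \<Gamma>') k M'"
      by (simp only: expand_app_ctx[OF m(4) sub] wf_eq_arities_ok[OF wf e])
    moreover note ext = eval_extend[OF wf m(2,4), of "sem (restrict (UV \<Delta>) \<Gamma>')" "sem \<Gamma>'"]
    ultimately show "eval (defs \<Delta>) (sem (restrict (UV \<Delta>) \<Gamma>')) k M =
        eval (defs \<Delta>) (sem (restrict (UV \<Delta>) \<Gamma>')) k M'"
      using ext[of M k] ext[of M' k] UV_eqs[OF e] wf_eq_rconsts[OF wf e] by (simp add: sem_restrict)
  qed
qed

section \<open>Restriction of most general unifiers\<close>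

lemma subst_eq_restrict: "\<Gamma> \<approx> \<Gamma>' \<Longrightarrow> restrict S \<Gamma> \<approx> restrict S \<Gamma>'"
  by (simp add: subst_eq_sem fun_eq_iff sem_restrict)

lemma subst_eq_trans: "\<Gamma>1 \<approx> \<Gamma>2 \<Longrightarrow> \<Gamma>2 \<approx> \<Gamma>3 \<Longrightarrow> \<Gamma>1 \<approx> \<Gamma>3"
  by (simp add: subst_eq_sem)

text \<open>Restricting \<open>\<Gamma>\<close> first lets composition pull in more equations of
  \<open>\<theta>\<close>, but only for metavariables outside \<open>S\<close>, which the outer
  restriction drops. Definitions are not touched by restriction, so the equality is literal.\<close>

lemma restrict_compose_restrict:
  assumes "S \<subseteq> sdom \<Gamma>" "S \<subseteq> S'"
  shows "restrict S (compose (restrict S \<Gamma>) \<theta>) = restrict S (restrict S' (compose \<Gamma> \<theta>))"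
proof (rule uctx.equality)
  have L: "ren_rc f L = Meta [] H xs \<longleftrightarrow> L = Meta [] H xs" for f and L :: "('a, 'b) tm" and H xs
    by (cases L) auto
  have r: "(L, M) \<in> eqs (restrict S \<Gamma>) \<longleftrightarrow> (L, M) \<in> eqs \<Gamma> \<and> (\<exists>H xs. L = Meta [] H xs \<and> H \<in> S)"
    for L M and \<Gamma> :: "('a, 'b) uctx" and S
    by (simp add: restrict_def)
  have a: "(L, M) \<in> eqs (app_subst \<Gamma> \<theta>) \<longleftrightarrow> (\<exists>L0 M0. (L0, M0) \<in> eqs \<Gamma> \<and>
      L = ren_rc ctx_rc L0 \<and> M = subst (ren_ctx sub_rc \<theta>) (ren_rc ctx_rc M0))" for L M and \<Gamma> :: "('a, 'b) uctx"
    unfolding app_subst_def ren_ctx_def[of ctx_rc] by force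
  have e: "(L, M) \<in> eqs (app_subst (restrict S \<Gamma>) \<theta>) \<longleftrightarrow>
      (L, M) \<in> eqs (app_subst \<Gamma> \<theta>) \<and> (\<exists>H xs. L = Meta [] H xs \<and> H \<in> S)" for L M
    unfolding a r by (auto simp: L) (metis L)
  have c: "(L, M) \<in> eqs (compose \<Gamma> \<theta>) \<longleftrightarrow> (L, M) \<in> eqs (app_subst \<Gamma> \<theta>) \<or>
      (L, M) \<in> eqs (ren_ctx sub_rc \<theta>) \<and> (\<exists>H xs. L = Meta [] H xs \<and> H \<notin> sdom \<Gamma>)"
    for L M and \<Gamma> :: "('a, 'b) uctx"
    by (simp add: compose_def)
  have "(L, M) \<in> eqs (restrict S (compose (restrict S \<Gamma>) \<theta>)) \<longleftrightarrow>
      (L, M) \<in> eqs (restrict S (restrict S' (compose \<Gamma> \<theta>)))" for L M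
    unfolding r c e sdom_restrict using assms by auto
  then show "eqs (restrict S (compose (restrict S \<Gamma>) \<theta>)) = eqs (restrict S (restrict S' (compose \<Gamma> \<theta>)))"
    by (intro set_eqI) auto
qed (simp_all add: compose_def app_subst_def app_defs_def restrict_def ren_ctx_def)

theorem theorem3p8:
  fixes sig :: "'c \<Rightarrow> 'b ty"
    and \<Delta> \<Delta>' :: "('b, 'c) uctx"
  assumes "wf_ctx sig \<Delta>"
    and "sat_rule sig \<Delta> \<Delta>'"
  shows "{\<Gamma>. unifier sig \<Delta> \<Gamma>} =
           {\<Gamma>. is_subst sig \<Gamma> \<and> (\<exists>\<Gamma>'. unifier sig \<Delta>' \<Gamma>' \<and> restrict (UV \<Delta>) \<Gamma>' \<approx> \<Gamma>)} \<and>
         (\<forall>\<Gamma>'. is_mgu sig \<Delta>' \<Gamma>' \<longrightarrow> is_mgu sig \<Delta> (restrict (UV \<Delta>) \<Gamma>'))"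
proof (intro conjI allI impI)
  note m = sat_rule_mono[OF assms]
  show "{\<Gamma>. unifier sig \<Delta> \<Gamma>} =
    {\<Gamma>. is_subst sig \<Gamma> \<and> (\<exists>\<Gamma>'. unifier sig \<Delta>' \<Gamma>' \<and> restrict (UV \<Delta>) \<Gamma>' \<approx> \<Gamma>)}"
    (is "?A = ?B")
  proof (intro equalityI subsetI)
    fix \<Gamma> assume "\<Gamma> \<in> ?A"
    then have uni: "unifier sig \<Delta> \<Gamma>" by simp
    then have "is_subst sig \<Gamma>" by (simp add: unifier_def)
    with sat_extend[OF assms uni] show "\<Gamma> \<in> ?B" by blast
  next
    fix \<Gamma> assume "\<Gamma> \<in> ?B"
    then obtain \<Gamma>' where "is_subst sig \<Gamma>" "unifier sig \<Delta>' \<Gamma>'" "restrict (UV \<Delta>) \<Gamma>' \<approx> \<Gamma>" by blast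
    then show "\<Gamma> \<in> ?A"
      using unifier_subst_eq[OF assms(1) unifier_restrict[OF assms]] by simp
  qed
  fix \<Gamma>' assume mgu: "is_mgu sig \<Delta>' \<Gamma>'"
  show "is_mgu sig \<Delta> (restrict (UV \<Delta>) \<Gamma>')"
    unfolding is_mgu_def
  proof (intro conjI allI impI)
    have uni: "unifier sig \<Delta>' \<Gamma>'" using mgu by (simp add: is_mgu_def)
    then show "unifier sig \<Delta> (restrict (UV \<Delta>) \<Gamma>')" by (rule unifier_restrict[OF assms])
    fix \<Gamma>2 assume \<Gamma>2: "unifier sig \<Delta> \<Gamma>2"
    \<comment> \<open>Generality of \<open>\<Gamma>'\<close> speaks only about unifiers of
      \<open>\<Delta>'\<close>, so the competitor is extended to one. The resulting
      \<open>\<theta>\<close> then witnesses generality of the restricted unifier too, and may still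
      instantiate fresh metavariables left in its right-hand sides.\<close>
    then obtain \<Gamma>3 where \<Gamma>3: "unifier sig \<Delta>' \<Gamma>3" "restrict (UV \<Delta>) \<Gamma>3 \<approx> \<Gamma>2"
      using sat_extend[OF assms] by blast
    with mgu obtain \<theta> where \<theta>: "is_subst sig \<theta>" "restrict (sdom \<Gamma>3) (compose \<Gamma>' \<theta>) \<approx> \<Gamma>3"
      unfolding is_mgu_def more_general_def by blast
    have "UV \<Delta> \<subseteq> UV \<Delta>'" unfolding UV_def using m(1,2) by (intro Un_mono UN_mono) auto
    then have "UV \<Delta> \<subseteq> sdom \<Gamma>'" "UV \<Delta> \<subseteq> sdom \<Gamma>3" and "sdom \<Gamma>2 = UV \<Delta>"
      using uni \<Gamma>3(1) \<Gamma>2 by (simp_all add: unifier_def)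
    then have "restrict (sdom \<Gamma>2) (compose (restrict (UV \<Delta>) \<Gamma>') \<theta>) \<approx> \<Gamma>2"
      using subst_eq_trans[OF subst_eq_restrict[OF \<theta>(2), of "UV \<Delta>"] \<Gamma>3(2)]
      by (simp add: restrict_compose_restrict[of "UV \<Delta>" \<Gamma>' "sdom \<Gamma>3"])
    with \<theta>(1) show "more_general sig (restrict (UV \<Delta>) \<Gamma>') \<Gamma>2" unfolding more_general_def by blast
  qed
qed

end
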